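(* Let $(V,Q)$ be a topological vertex operator algebra, let $A_1,A_2,A_3,A_4\in V$ (homogeneous with respect to the fermionic grading), let $t>0$, and let the positive parameters $\rho,\epsilon_1,\epsilon_2,\alpha_1,\alpha_2,\xi$ satisfy $\rho\gg\epsilon_2,\alpha_2\gg\epsilon_1,\alpha_1,\xi$. Let $P=P(\xi,\alpha_1,\alpha_2,\epsilon_1,\epsilon_2)$ be the pentagon $$P=\{(x,y)\in\mathbb{R}^2:\ \epsilon_2\le x\le\rho-\alpha_1,\ \epsilon_1\le y\le\rho-\alpha_2,\ x-y\ge\xi\}.$$ Put $$p'_P(A_1,A_2,A_3,A_4)(t)=(-1)^{|A_2|}A_1(\rho+t)\int_P[b_{-1},A_2(x+t)]\,[b_{-1},A_3(y+t)]\,dx\wedge dy\;A_4(t),$$ $$p_P(A_1,A_2,A_3,A_4)(t)=p'_P(A_1,A_2,A_3,A_4)(t)+n_{\rho,\alpha_2,\epsilon_1}\big(m_{\alpha_1}(A_1,A_2),A_3,A_4\big)(t)+\big(\tilde m_{\alpha_2,\alpha_1,\xi}(A_1,A_2,A_3),A_4\big)_{\rho}(t).$$ Then the operations $n(\cdot,\cdot,\cdot)$ and $(\cdot,\cdot)$ satisfy the following "pentagon relation" in the weak sense: \begin{align*} &Qp_P(A_1,A_2,A_3,A_4)(t)-p_P(QA_1,A_2,A_3,A_4)(t)-(-1)^{|A_1|}p_P(A_1,QA_2,A_3,A_4)(t)\\ &\quad-(-1)^{|A_1|+|A_2|}p_P(A_1,A_2,QA_3,A_4)(t)-(-1)^{|A_1|+|A_2|+|A_3|}p_P(A_1,A_2,A_3,QA_4)(t)\\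 &=(-1)^{|A_1|}\big(A_1,n_{\epsilon_2,\xi,\epsilon_1}(A_2,A_3,A_4)\big)_{\rho}(t)-n_{\rho,\alpha_1,\epsilon_2}\big(A_1,A_2,(A_3,A_4)_{\epsilon_1}\big)(t)\\ &\quad+n_{\rho,\alpha_2,\epsilon_2}\big(A_1,(A_2,A_3)_{\xi},A_4\big)(t)-n_{\rho,\alpha_2,\epsilon_1}\big((A_1,A_2)_{\alpha_1},A_3,A_4\big)(t)\\ &\quad+\big(n_{\alpha_2,\alpha_1,\xi}(A_1,A_2,A_3),A_4\big)_{\rho}(t). \end{align*}
   Context: A topological vertex operator algebra (TVOA) is a $\mathbb{Z}$-graded vertex operator superalgebra $V=\bigoplus_{i,\mu}V^i[\mu]$ ($i$ the conformal weight, $\mu$ the fermionic grading) together with elements $J\in V^1[1]$, $b\in V^2[-1]$, $F\in V^1[0]$, $L\in V^2[0]$, with modes $J(z)=\sum_n J_nz^{-n-1}$, $b(z)=\sum_n b_nz^{-n-2}$, $F(z)=\sum_nF_nz^{-n-1}$, $L(z)=\sum_nL_nz^{-n-2}$, such that, with $Q=J_0$, one has $[Q,b(z)]=L(z)$, $Q^2=0$, $b_0^2=0$; here $L$ is the Virasoro element of $V$, and $F_0,L_0$ are diagonalizable, commute, and have as eigenvalues the fermionic grading and the conformal weight respectively. For $A\in V$, $A(z)$ denotes the vertex operator $Y(A,z)$; $|A|$ is the fermionic degree. All brackets $[\cdot,\cdot]$ are supercommutators. The symbol $\ll$ means "much smaller than" and is not quantified further. Weak sense. Arguments $t$ of vertex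 operators are real and positive. For $v\in V$ and $v^*\in V^*$ (restricted dual), the matrix element $\langle v^*,A_1(t_1)\cdots A_n(t_n)v\rangle$ is well defined for $t_1>\cdots>t_n>0$. An operator expression (a product of vertex operators at decreasing arguments, or an integral of such products over a polytope) is weakly defined if its matrix elements are, and an identity holds in the weak sense if it holds for all matrix elements. Such operators are called nonlocal operators. For such an operator $X$, $QX$ means the supercommutator $[Q,X]$; for $A\in V$ this agrees with $(QA)(t)=[Q,A(t)]$. Operations. Let $X,Y,Z$ be families of operators $X(s),Y(s),Z(s)$ (vertex operators $A(s)$, or nonlocal operators built by the operations below, with $|X|$ the total fermionic degree). For parameters for which the expressions are weakly defined, put $$(X,Y)_\epsilon(t)=X(t+\epsilon)Y(t),\qquad m_\epsilon(X,Y)(t)=\int_{-\epsilon}^{0}[b_{-1},X(t'+t+\epsilon)Y(t'+t)]\,dt',$$ $$n'_{\rho,\alpha_1,\alpha_2}(X,Y,Z)(t)=\int_{\alpha_2}^{\rho-\alpha_1}(-1)^{|X|}X(t+\rho)\,[b_{-1},Y(t'+t)]\,Z(t)\,dt',$$ $$n_{\rho,\alpha_1,\alpha_2}(X,Y,Z)(t)=n'_{\rho,\alpha_1,\alpha_2}(X,Y,Z)(t)+\big(m_{\alpha_1}(X,Y),Z\big)_\rho(t),$$ $$\tilde m_{\rho,\epsilon_1,\epsilon_2}(X,Y,Z)(t)=\int_{-\rho}^{0}\big[b_{-1},\,n'_{\rho,\epsilon_1,\epsilon_2}(X,Y,Z)(t+s)\big]\,ds.$$ Nested expressions are obtained by inserting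 the inner operation as a family of operators in its variable $t$; e.g. $\big(m_{\alpha_1}(A,B),C\big)_\rho(t)=m_{\alpha_1}(A,B)(t+\rho)\,C(t)$, and $n_{\rho,\alpha_2,\epsilon_2}(A_1,(A_2,A_3)_\xi,A_4)$ uses the family $s\mapsto A_2(s+\xi)A_3(s)$ in the middle slot. The degree of $m_\epsilon(X,Y)$ is $|X|+|Y|-1$, that of $n'$ and $n$ is $|X|+|Y|+|Z|-1$, and that of $\tilde m$ is $|X|+|Y|+|Z|-2$.
   Formalization: The integral over P with dx∧dy in p'_P is taken with P oriented clockwise (minus the Lebesgue integral), since with the standard orientation the pentagon relation fails by a sign; ≫ is read as ε2+α2<ρ, ε1+ξ<ε2, α1+ξ<α2. *)

theory Defs
  imports "HOL-Analysis.Analysis" "HOL-Library.Groups_Big_Fun"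
begin

section \<open>Topological vertex operator algebras\<close>

text \<open>
  The ground field is the field of complex numbers and the underlying space of \<open>V\<close> is a whole
  type. \<open>gr V i \<mu>\<close> is the homogeneous subspace of conformal weight \<open>i\<close> and fermionic degree
  \<open>\<mu>\<close>, and \<open>md V A n\<close> is the mode \<open>A\<^sub>(\<^sub>n\<^sub>)\<close>, the coefficient of \<open>z\<close> to the power \<open>-n-1\<close> in \<open>Y(A,z)\<close>,
  for every \<open>A\<close> regardless of its weight.  A field written with weight-\<open>h\<close> indexing,
  \<open>A(z) = \<Sum> A\<^sub>n z^(-n-h)\<close>, thus has \<open>A\<^sub>n = md V A (n + h - 1)\<close>.
\<close>

record 'v vosa =
  scl :: "complex \<Rightarrow> 'v \<Rightarrow> 'v"
  gr :: "int \<Rightarrow> int \<Rightarrow> 'v set"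
  vac :: 'v
  md :: "'v \<Rightarrow> int \<Rightarrow> 'v \<Rightarrow> 'v"
  elL :: 'v

definition sg :: "int \<Rightarrow> complex" where
  "sg k = (-1) powi k"

definition Lmode :: "('v, 'm) vosa_scheme \<Rightarrow> int \<Rightarrow> 'v \<Rightarrow> 'v" where
  "Lmode V n = md V (elL V) (n + 1)"

text \<open>
  The parity of an element is its fermionic degree modulo 2.  The Jacobi identity is stated in
  components (Borcherds identity); by truncation only finitely many summands are nonzero.  The
  conditions that the weight spaces be finite dimensional and vanish for small weights, often made
  part of the notion of a vertex operator algebra, are not imposed, so that the class considered
  here contains the one with these conditions.
\<close>

locale vertex_operator_superalgebra =
  fixes V :: "('v :: ab_group_add, 'm) vosa_scheme"
  assumes vector_space: "vector_space (scl V)"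
    and gr_subspace: "module.subspace (scl V) (gr V i \<mu>)"
    and gr_direct_sum: "\<exists>!p :: int \<times> int \<Rightarrow> 'v. (\<forall>i \<mu>. p (i, \<mu>) \<in> gr V i \<mu>) \<and>
      finite {x. p x \<noteq> 0} \<and> v = (\<Sum>x\<in>{x. p x \<noteq> 0}. p x)"
    and md_linear_left: "Vector_Spaces.linear (scl V) (scl V) (\<lambda>A. md V A n B)"
    and md_linear_right: "Vector_Spaces.linear (scl V) (scl V) (\<lambda>B. md V A n B)"
    and md_graded: "A \<in> gr V i \<mu> \<Longrightarrow> B \<in> gr V j \<nu> \<Longrightarrow> md V A n B \<in> gr V (i + j - n - 1) (\<mu> + \<nu>)"
    and truncation: "\<exists>N. \<forall>n\<ge>N. md V A n B = 0"
    and vac_graded: "vac V \<in> gr V 0 0"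
    and vacuum: "md V (vac V) n B = (if n = -1 then B else 0)"
    and creation: "md V A (-1) (vac V) = A" "n \<ge> 0 \<Longrightarrow> md V A n (vac V) = 0"
    and Borcherds: "A \<in> gr V i \<mu> \<Longrightarrow> B \<in> gr V j \<nu> \<Longrightarrow>
      Sum_any (\<lambda>k :: nat. scl V (of_int m gchoose k) (md V (md V A (l + int k) B) (m + n - int k) C)) =
      Sum_any (\<lambda>k :: nat. scl V ((-1) ^ k * (of_int l gchoose k))
        (md V A (m + l - int k) (md V B (n + int k) C) -
         scl V (sg l * sg (\<mu> * \<nu>)) (md V B (n + l - int k) (md V A (m + int k) C))))"
    and L_graded: "elL V \<in> gr V 2 0"
    and Virasoro: "\<exists>c. \<forall>m n v. Lmode V m (Lmode V n v) - Lmode V n (Lmode V m v) =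
      scl V (of_int (m - n)) (Lmode V (m + n) v) +
      (if m + n = 0 then scl V (of_int (m ^ 3 - m) / 12 * c) v else 0)"
    and L0_eigen: "v \<in> gr V i \<mu> \<Longrightarrow> Lmode V 0 v = scl V (of_int i) v"
    and L_derivative: "md V (Lmode V (-1) A) n B = scl V (- of_int n) (md V A (n - 1) B)"

record 'v tvoa = "'v vosa" +
  elJ :: 'v
  elb :: 'v
  elF :: 'v

definition Qop :: "('v, 'm) tvoa_scheme \<Rightarrow> 'v \<Rightarrow> 'v" where
  "Qop V = md V (elJ V) 0"

definition bmode :: "('v, 'm) tvoa_scheme \<Rightarrow> int \<Rightarrow> 'v \<Rightarrow> 'v" where
  "bmode V n = md V (elb V) (n + 1)"

locale topological_voa = vertex_operator_superalgebra V
  for V :: "('v :: ab_group_add, 'm) tvoa_scheme" +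
  assumes J_graded: "elJ V \<in> gr V 1 1"
    and b_graded: "elb V \<in> gr V 2 (-1)"
    and F_graded: "elF V \<in> gr V 1 0"
    and Q_b: "Qop V (bmode V n v) + bmode V n (Qop V v) = Lmode V n v"
    and Q_square: "Qop V (Qop V v) = 0"
    and b0_square: "bmode V 0 (bmode V 0 v) = 0"
    and F0_eigen: "v \<in> gr V i \<mu> \<Longrightarrow> md V (elF V) 0 v = scl V (of_int \<mu>) v"

definition fermionic_space :: "('v :: ab_group_add, 'm) vosa_scheme \<Rightarrow> int \<Rightarrow> 'v set" where
  "fermionic_space V \<mu> = module.span (scl V) (\<Union>i. gr V i \<mu>)"

definition restricted_dual :: "('v :: ab_group_add, 'm) vosa_scheme \<Rightarrow> ('v \<Rightarrow> complex) set" where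
  "restricted_dual V = {f. Vector_Spaces.linear (scl V) (*) f \<and>
     finite {(i, \<mu>). \<exists>v\<in>gr V i \<mu>. f v \<noteq> 0}}"


section \<open>Operator expressions and their matrix elements\<close>

text \<open>
  A letter is a vertex operator \<open>A(t)\<close> or a single mode \<open>A\<^sub>(\<^sub>n\<^sub>)\<close>.  Operator expressions are built
  from letters by products, linear combinations and integrals over subsets of the line
  or the plane.
\<close>

datatype 'v letter = Vertex 'v real | Mode 'v int

datatype 'v opex =
    Letter "'v letter"
  | OProd "'v opex" "'v opex"
  | OSum "'v opex" "'v opex"
  | OScale complex "'v opex"
  | OInt "real set" "real \<Rightarrow> 'v opex"
  | OInt2 "(real \<times> real) set" "real \<times> real \<Rightarrow> 'v opex"

instantiation opex :: (type) "{plus, minus, times}"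
begin
definition plus_opex :: "'a opex \<Rightarrow> 'a opex \<Rightarrow> 'a opex" where
  "X + Y = OSum X Y"
definition minus_opex :: "'a opex \<Rightarrow> 'a opex \<Rightarrow> 'a opex" where
  "X - Y = OSum X (OScale (-1) Y)"
definition times_opex :: "'a opex \<Rightarrow> 'a opex \<Rightarrow> 'a opex" where
  "X * Y = OProd X Y"
instance ..
end

notation OScale (infixr "\<cdot>" 75)

text \<open>
  The matrix element of a product of letters is the sum, over all choices of one mode for each
  vertex operator, of the matrix elements of the resulting products of modes.  It is defined if
  the arguments are positive and decreasing and the sum converges (unconditionally, equivalently
  absolutely).
\<close>

fun letter_modes :: "'v letter \<Rightarrow> int set" where
  "letter_modes (Vertex A t) = UNIV"
| "letter_modes (Mode A n) = {n}"

fun letter_term :: "('v, 'm) vosa_scheme \<Rightarrow> 'v letter \<Rightarrow> int \<Rightarrow> 'v \<Rightarrow> 'v" where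
  "letter_term V (Vertex A t) k v = scl V (complex_of_real t powi (- k - 1)) (md V A k v)"
| "letter_term V (Mode A n) k v = md V A k v"

definition word_term :: "('v, 'm) vosa_scheme \<Rightarrow> 'v letter list \<Rightarrow> int list \<Rightarrow> 'v \<Rightarrow> 'v" where
  "word_term V w ks v = foldr (\<lambda>(l, k). letter_term V l k) (zip w ks) v"

fun word_args :: "'v letter list \<Rightarrow> real list" where
  "word_args [] = []"
| "word_args (Vertex A t # w) = t # word_args w"
| "word_args (Mode A n # w) = word_args w"

definition word_mel ::
  "('v, 'm) vosa_scheme \<Rightarrow> ('v \<Rightarrow> complex) \<Rightarrow> 'v \<Rightarrow> 'v letter list \<Rightarrow> complex option" where
  "word_mel V f v w =
    (let g = (\<lambda>ks. f (word_term V w ks v)); K = listset (map letter_modes w)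
     in if sorted_wrt (>) (word_args w) \<and> (\<forall>t\<in>set (word_args w). t > 0) \<and> g summable_on K
        then Some (infsum g K) else None)"

definition integral_opt :: "'a :: euclidean_space set \<Rightarrow> ('a \<Rightarrow> complex option) \<Rightarrow> complex option" where
  "integral_opt S g =
    (if (\<forall>s\<in>S. g s \<noteq> None) \<and> (\<lambda>s. the (g s)) integrable_on S
     then Some (integral S (\<lambda>s. the (g s))) else None)"

text \<open>
  \<open>opex_value X \<phi>\<close> is the value of \<open>X\<close> when \<open>\<phi>\<close> gives the values of products of letters: a product
  of expressions is expanded into sums and integrals of products of letters, and sums and integrals
  are taken of the (complex) values of those.  \<open>None\<close> stands for an undefined value.
\<close>

primrec opex_value :: "'v opex \<Rightarrow> ('v letter list \<Rightarrow> complex option) \<Rightarrow> complex option" where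
  "opex_value (Letter l) \<phi> = \<phi> [l]"
| "opex_value (OProd X Y) \<phi> = opex_value X (\<lambda>w. opex_value Y (\<lambda>w'. \<phi> (w @ w')))"
| "opex_value (OSum X Y) \<phi> =
    Option.bind (opex_value X \<phi>) (\<lambda>a. Option.bind (opex_value Y \<phi>) (\<lambda>b. Some (a + b)))"
| "opex_value (OScale c X) \<phi> = map_option (\<lambda>a. c * a) (opex_value X \<phi>)"
| "opex_value (OInt S X) \<phi> = integral_opt S (\<lambda>s. opex_value (X s) \<phi>)"
| "opex_value (OInt2 S X) \<phi> = integral_opt S (\<lambda>s. opex_value (X s) \<phi>)"

definition matrix_element ::
  "('v, 'm) vosa_scheme \<Rightarrow> ('v \<Rightarrow> complex) \<Rightarrow> 'v opex \<Rightarrow> 'v \<Rightarrow> complex option" where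
  "matrix_element V f X v = opex_value X (word_mel V f v)"

text \<open>Equality in the weak sense includes that both sides are weakly defined.\<close>

definition weakly_equal :: "('v :: ab_group_add, 'm) vosa_scheme \<Rightarrow> 'v opex \<Rightarrow> 'v opex \<Rightarrow> bool" where
  "weakly_equal V X Y \<longleftrightarrow> (\<forall>f\<in>restricted_dual V. \<forall>v. \<exists>c.
     matrix_element V f X v = Some c \<and> matrix_element V f Y v = Some c)"


section \<open>The operations\<close>

text \<open>A family of operators together with its total fermionic degree.\<close>

datatype 'v fam = Fam (deg: int) (op_at: "real \<Rightarrow> 'v opex")

definition vertex :: "int \<Rightarrow> 'v \<Rightarrow> 'v fam" where
  "vertex a A = Fam a (\<lambda>t. Letter (Vertex A t))"

text \<open>
  \<open>bbr V d X\<close> and \<open>Qbr V d X\<close> are the supercommutators of \<open>b\<^sub>-\<^sub>1\<close> (degree \<open>-1\<close>) and of \<open>Q\<close>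
  (degree \<open>1\<close>) with an operator \<open>X\<close> of degree \<open>d\<close>.
\<close>

definition bbr :: "('v, 'm) tvoa_scheme \<Rightarrow> int \<Rightarrow> 'v opex \<Rightarrow> 'v opex" where
  "bbr V d X = Letter (Mode (elb V) 0) * X - sg (- d) \<cdot> (X * Letter (Mode (elb V) 0))"

definition Qbr :: "('v, 'm) tvoa_scheme \<Rightarrow> int \<Rightarrow> 'v opex \<Rightarrow> 'v opex" where
  "Qbr V d X = Letter (Mode (elJ V) 0) * X - sg d \<cdot> (X * Letter (Mode (elJ V) 0))"

definition op_pair :: "real \<Rightarrow> 'v fam \<Rightarrow> 'v fam \<Rightarrow> 'v fam" where
  "op_pair \<epsilon> X Y = Fam (deg X + deg Y) (\<lambda>t. op_at X (t + \<epsilon>) * op_at Y t)"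

definition op_m :: "('v, 'm) tvoa_scheme \<Rightarrow> real \<Rightarrow> 'v fam \<Rightarrow> 'v fam \<Rightarrow> 'v fam" where
  "op_m V \<epsilon> X Y = Fam (deg X + deg Y - 1)
     (\<lambda>t. OInt {-\<epsilon>..0} (\<lambda>t'. bbr V (deg X + deg Y) (op_at X (t' + t + \<epsilon>) * op_at Y (t' + t))))"

definition op_n' ::
  "('v, 'm) tvoa_scheme \<Rightarrow> real \<Rightarrow> real \<Rightarrow> real \<Rightarrow> 'v fam \<Rightarrow> 'v fam \<Rightarrow> 'v fam \<Rightarrow> 'v fam" where
  "op_n' V \<rho> \<alpha>1 \<alpha>2 X Y Z = Fam (deg X + deg Y + deg Z - 1)
     (\<lambda>t. OInt {\<alpha>2..\<rho> - \<alpha>1}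
        (\<lambda>t'. sg (deg X) \<cdot> (op_at X (t + \<rho>) * bbr V (deg Y) (op_at Y (t' + t)) * op_at Z t)))"

definition op_n ::
  "('v, 'm) tvoa_scheme \<Rightarrow> real \<Rightarrow> real \<Rightarrow> real \<Rightarrow> 'v fam \<Rightarrow> 'v fam \<Rightarrow> 'v fam \<Rightarrow> 'v fam" where
  "op_n V \<rho> \<alpha>1 \<alpha>2 X Y Z = Fam (deg X + deg Y + deg Z - 1)
     (\<lambda>t. op_at (op_n' V \<rho> \<alpha>1 \<alpha>2 X Y Z) t + op_at (op_pair \<rho> (op_m V \<alpha>1 X Y) Z) t)"

definition op_mt ::
  "('v, 'm) tvoa_scheme \<Rightarrow> real \<Rightarrow> real \<Rightarrow> real \<Rightarrow> 'v fam \<Rightarrow> 'v fam \<Rightarrow> 'v fam \<Rightarrow> 'v fam" where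
  "op_mt V \<rho> \<epsilon>1 \<epsilon>2 X Y Z = Fam (deg X + deg Y + deg Z - 2)
     (\<lambda>t. OInt {-\<rho>..0} (\<lambda>s. bbr V (deg X + deg Y + deg Z - 1) (op_at (op_n' V \<rho> \<epsilon>1 \<epsilon>2 X Y Z) (t + s))))"

definition pentagon :: "real \<Rightarrow> real \<Rightarrow> real \<Rightarrow> real \<Rightarrow> real \<Rightarrow> real \<Rightarrow> (real \<times> real) set" where
  "pentagon \<rho> \<xi> \<alpha>1 \<alpha>2 \<epsilon>1 \<epsilon>2 =
     {(x, y). \<epsilon>2 \<le> x \<and> x \<le> \<rho> - \<alpha>1 \<and> \<epsilon>1 \<le> y \<and> y \<le> \<rho> - \<alpha>2 \<and> x - y \<ge> \<xi>}"

text \<open>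
  The integral of the two-form \<open>X(x,y) dx \<and> dy\<close> over a plane region \<open>P\<close>.  The sign depends on
  the orientation of \<open>P\<close>.  We use the orientation given by \<open>dy \<and> dx\<close> (boundary traversed
  clockwise), that is, minus the Lebesgue integral.  This choice matters: with it the boundary terms
  of \<open>p'\<close> on the edges \<open>x = \<rho> - \<alpha>\<^sub>1\<close> and \<open>y = \<rho> - \<alpha>\<^sub>2\<close> cancel those of the other two summands of \<open>p\<close>
  and the remaining three edges give the terms of the pentagon relation; with the opposite
  orientation all boundary terms of \<open>p'\<close> have the wrong sign and the relation fails.
\<close>

definition int_dx_dy :: "(real \<times> real) set \<Rightarrow> (real \<times> real \<Rightarrow> 'v opex) \<Rightarrow> 'v opex" where
  "int_dx_dy P X = (-1) \<cdot> OInt2 P X"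

definition op_p' :: "('v, 'm) tvoa_scheme \<Rightarrow> real \<Rightarrow> real \<Rightarrow> real \<Rightarrow> real \<Rightarrow> real \<Rightarrow> real \<Rightarrow>
    'v fam \<Rightarrow> 'v fam \<Rightarrow> 'v fam \<Rightarrow> 'v fam \<Rightarrow> 'v fam" where
  "op_p' V \<rho> \<xi> \<alpha>1 \<alpha>2 \<epsilon>1 \<epsilon>2 X1 X2 X3 X4 = Fam (deg X1 + deg X2 + deg X3 + deg X4 - 2)
     (\<lambda>t. sg (deg X2) \<cdot> (op_at X1 (\<rho> + t) *
        int_dx_dy (pentagon \<rho> \<xi> \<alpha>1 \<alpha>2 \<epsilon>1 \<epsilon>2)
          (\<lambda>(x, y). bbr V (deg X2) (op_at X2 (x + t)) * bbr V (deg X3) (op_at X3 (y + t))) *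
        op_at X4 t))"

definition op_p :: "('v, 'm) tvoa_scheme \<Rightarrow> real \<Rightarrow> real \<Rightarrow> real \<Rightarrow> real \<Rightarrow> real \<Rightarrow> real \<Rightarrow>
    'v fam \<Rightarrow> 'v fam \<Rightarrow> 'v fam \<Rightarrow> 'v fam \<Rightarrow> 'v fam" where
  "op_p V \<rho> \<xi> \<alpha>1 \<alpha>2 \<epsilon>1 \<epsilon>2 X1 X2 X3 X4 = Fam (deg X1 + deg X2 + deg X3 + deg X4 - 2)
     (\<lambda>t. op_at (op_p' V \<rho> \<xi> \<alpha>1 \<alpha>2 \<epsilon>1 \<epsilon>2 X1 X2 X3 X4) t +
          op_at (op_n V \<rho> \<alpha>2 \<epsilon>1 (op_m V \<alpha>1 X1 X2) X3 X4) t +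
          op_at (op_pair \<rho> (op_mt V \<alpha>2 \<alpha>1 \<xi> X1 X2 X3) X4) t)"

text \<open>
  For \<open>A\<close> of degree \<open>a\<close>: the family of vertex operators of \<open>QA\<close>, which has degree \<open>a + 1\<close>.
\<close>

definition Qvertex :: "('v, 'm) tvoa_scheme \<Rightarrow> int \<Rightarrow> 'v \<Rightarrow> 'v fam" where
  "Qvertex V a A = vertex (a + 1) (Qop V A)"

definition Qfam :: "('v, 'm) tvoa_scheme \<Rightarrow> 'v fam \<Rightarrow> 'v fam" where
  "Qfam V X = Fam (deg X + 1) (\<lambda>t. Qbr V (deg X) (op_at X t))"

end

theory Submission
  imports Defs
begin

text \<open>
  The matrix elements of \<open>A\<^sub>1(t\<^sub>1)\<cdots>A\<^sub>n(t\<^sub>n)\<close> converge absolutely for \<open>t\<^sub>1 > \<cdots> > t\<^sub>n > 0\<close>: a mode of \<open>A\<^sub>1\<close>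
  of large index annihilates the vector on the right, so by the commutator formula it reduces to
  products of \<open>n - 1\<close> operators with coefficients that sum to a geometric series, while the remaining
  modes of \<open>A\<^sub>1\<close> contribute finitely many nonzero terms, because the index sum is bounded on both sides
  (above by the same commutation argument, below by the conformal weight).

  With \<open>t\<close> fixed, \<open>U\<^sub>1 = \<langle>(bA\<^sub>1)(x) A\<^sub>2(y) A\<^sub>3(z) A\<^sub>4(t)\<rangle>\<close>, \<open>U\<^sub>2 = \<plusminus>\<langle>A\<^sub>1(x) (bA\<^sub>2)(y) A\<^sub>3(z) A\<^sub>4(t)\<rangle>\<close> and
  \<open>U\<^sub>3 = \<plusminus>\<langle>A\<^sub>1(x) A\<^sub>2(y) (bA\<^sub>3)(z) A\<^sub>4(t)\<rangle>\<close> are the components of a one-form on the region \<open>x > y > z > t\<close>.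
  The integrand of \<open>p\<close> is the two-form with two factors \<open>b\<close>; since \<open>[Q, b\<^sub>-\<^sub>1] = L\<^sub>-\<^sub>1\<close> acts as the
  derivative and \<open>b\<^sub>-\<^sub>1\<close> squares to zero, the left-hand side of the relation is the integral of the
  exterior derivative of that one-form over four faces (the pentagon and three rectangles).  The
  common edges of the faces cancel, and the ten outer edges are the summands of the right-hand side.
\<close>

section \<open>Algebra of modes\<close>

text \<open>The restricted dual is closed under composition with modes, so the leftmost letter of a
  word can be absorbed into the functional f. Statements about words are therefore proved for all f
  at once, by induction from the left, with bounds whose data do not depend on f. Expanding brackets
  adds single modes of b and J as letters, so convergence has to cover words that mix vertex
  operators and modes before any rearrangement is possible. Both b_{-1} and Q are zero modes of odd
  elements. A zero mode C_0 satisfies [C_0, A(s)] = (C_0 A)(s) without shifting an index, so it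
  passes through a convergent series term by term. A Q at the left end goes into f, a Q at the right
  end into v. What remains is a pointwise identity between four-point functions: each slot without b
  cancels against the summand with Q A_i, and each slot with b yields (Q b + b Q) A_i = L_{-1} A_i,
  a partial derivative. The relation "much smaller" enters through three strict inequalities, which
  keep all faces inside the region of decreasing arguments.\<close>

lemma sg_mult [simp]: "sg a * sg a = 1" "sg a * (sg a * z) = z"
  by (auto simp: sg_def power_int_minus_one_mult_self simp flip: mult.assoc)

lemma sg_cases: "sg a = (if even a then 1 else -1)"
  by (simp add: sg_def power_int_minus_left)

context vertex_operator_superalgebra
begin

lemma module_hom_md: "module_hom (scl V) (scl V) (\<lambda>A. md V A n B)" "module_hom (scl V) (scl V) (md V A n)"
  using md_linear_left md_linear_right by (simp_all add: module_hom_iff_linear)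

lemmas md_left = module_hom_md(1)[THEN module_hom.add] module_hom_md(1)[THEN module_hom.scale]
  module_hom_md(1)[THEN module_hom.zero]
lemmas md_right = module_hom_md(2)[THEN module_hom.add] module_hom_md(2)[THEN module_hom.scale]
  module_hom_md(2)[THEN module_hom.zero] module_hom_md(2)[THEN module_hom.diff]

sublocale vs: vector_space "scl V"
  by (rule vector_space)

lemma homogeneous_induct [case_names homogeneous add]:
  assumes hom: "\<And>i \<mu> A. A \<in> gr V i \<mu> \<Longrightarrow> P A" and add: "\<And>A B. P A \<Longrightarrow> P B \<Longrightarrow> P (A + B)"
  shows "P A"
proof -
  from gr_direct_sum[of A] obtain p :: "int \<times> int \<Rightarrow> 'v" where
    p: "\<And>i \<mu>. p (i, \<mu>) \<in> gr V i \<mu>" "finite {x. p x \<noteq> 0}" "A = (\<Sum>x\<in>{x. p x \<noteq> 0}. p x)"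
    by auto
  have "finite S \<Longrightarrow> P (\<Sum>x\<in>S. p x)" for S
  proof (induction S rule: finite_induct)
    case empty
    \<comment> \<open>The empty sum has to count as homogeneous; bidegree (0, 0) serves as well as
      any other.\<close>
    have "(0::'v) \<in> gr V 0 0"
      using gr_subspace[of 0 0] by (simp add: vs.subspace_0)
    then show ?case using hom by simp
  next
    case (insert x F)
    obtain i \<mu> where x: "x = (i, \<mu>)" by (cases x)
    have "P (p x)" using hom[OF p(1)[of i \<mu>]] x by simp
    with insert add show ?case by simp
  qed
  with p show ?thesis by simp
qed

text \<open>This is the Borcherds identity at l = 0: the binomials of 0 over k vanish for k > 0, so
  the right side collapses to the supercommutator, and truncation at J makes the left side a finite
  sum.\<close>

lemma commutator_mode:
  assumes A: "A \<in> gr V i \<mu>" and B: "B \<in> gr V j \<nu>" and J: "\<And>k. k \<ge> J \<Longrightarrow> md V A (int k) B = 0"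
  shows "md V A m (md V B n C) = scl V (sg (\<mu> * \<nu>)) (md V B n (md V A m C)) +
    (\<Sum>k<J. scl V (of_int m gchoose k) (md V (md V A (int k) B) (m + n - int k) C))"
proof -
  have "Sum_any (\<lambda>k :: nat. scl V (of_int m gchoose k) (md V (md V A (int k) B) (m + n - int k) C)) =
      (\<Sum>k<J. scl V (of_int m gchoose k) (md V (md V A (int k) B) (m + n - int k) C))"
    by (rule Sum_any.expand_superset) (auto simp: J md_left not_less[symmetric] intro: ccontr)
  moreover have "Sum_any (\<lambda>k :: nat. scl V ((-1) ^ k * (of_int 0 gchoose k))
        (md V A (m + 0 - int k) (md V B (n + int k) C) -
         scl V (sg 0 * sg (\<mu> * \<nu>)) (md V B (n + 0 - int k) (md V A (m + int k) C)))) =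
      (\<Sum>k\<in>{0}. scl V ((-1) ^ k * (of_int 0 gchoose k))
        (md V A (m + 0 - int k) (md V B (n + int k) C) -
         scl V (sg 0 * sg (\<mu> * \<nu>)) (md V B (n + 0 - int k) (md V A (m + int k) C))))"
  proof (rule Sum_any.expand_superset)
    show "{a. scl V ((- 1) ^ a * (of_int 0 gchoose a))
          (md V A (m + 0 - int a) (md V B (n + int a) C) -
           scl V (sg 0 * sg (\<mu> * \<nu>)) (md V B (n + 0 - int a) (md V A (m + int a) C))) \<noteq> 0} \<subseteq> {0}"
      by (auto simp: gbinomial_0_left)
  qed auto
  ultimately show ?thesis
    using Borcherds[OF A B, where l=0 and m=m and n=n and C=C]
    by (simp add: sg_def algebra_simps)
qed

text \<open>For m = 0 only the k = 0 correction survives, so a zero mode acts as a superderivation.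
  The sign depends on the fermionic degree of B alone, hence the extension by linearity to sums of
  different weights.\<close>

lemma zero_mode_commutator:
  assumes A: "A \<in> gr V i \<mu>" and B: "B \<in> fermionic_space V \<nu>"
  shows "md V A 0 (md V B n C) = scl V (sg (\<mu> * \<nu>)) (md V B n (md V A 0 C)) + md V (md V A 0 B) n C"
  using B unfolding fermionic_space_def
proof (induction B rule: vs.span_induct_alt)
  case base
  then show ?case by (simp add: md_left md_right)
next
  case (step c x y)
  then obtain j where x: "x \<in> gr V j \<nu>" by auto
  obtain N where N: "\<And>n. n \<ge> N \<Longrightarrow> md V A n x = 0" using truncation by blast
  \<comment> \<open>\<open>Suc\<close> guarantees that the summand k = 0 is in range even when N is
    not positive.\<close>
  have "md V A 0 (md V x n C) = scl V (sg (\<mu> * \<nu>)) (md V x n (md V A 0 C)) +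
    (\<Sum>k<Suc (nat N). scl V (of_int 0 gchoose k) (md V (md V A (int k) x) (0 + n - int k) C))"
    by (rule commutator_mode[OF A x]) (use N in auto)
  also have "(\<Sum>k<Suc (nat N). scl V (of_int 0 gchoose k) (md V (md V A (int k) x) (0 + n - int k) C)) = md V (md V A 0 x) n C"
    by (subst sum.lessThan_Suc_shift) (simp add: gbinomial_0_left)
  finally show ?case using step(2) by (simp add: md_left md_right vs.scale_right_distrib vs.scale_left_commute)
qed

lemma fermionic_space_md:
  assumes A: "A \<in> gr V i \<mu>" and B: "B \<in> fermionic_space V \<nu>"
  shows "md V A n B \<in> fermionic_space V (\<mu> + \<nu>)"
  using B unfolding fermionic_space_def
proof (induction B rule: vs.span_induct_alt)
  case base
  then show ?case by (simp add: md_right vs.span_zero)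
next
  case (step c x y)
  then obtain j where x: "x \<in> gr V j \<nu>" by auto
  from md_graded[OF A this, of n] have "md V A n x \<in> vs.span (\<Union>i. gr V i (\<mu> + \<nu>))"
    by (intro vs.span_base) auto
  with step(2) show ?case by (simp add: md_right vs.span_add vs.span_scale)
qed

section \<open>Closure properties of the restricted dual\<close>

lemma restricted_dual_linear:
  assumes "f \<in> restricted_dual V"
  shows "f (x + y) = f x + f y" "f (scl V c x) = c * f x" "f 0 = 0" "f (x - y) = f x - f y"
proof -
  from assms have "module_hom (scl V) (*) f"
    by (auto simp: restricted_dual_def module_hom_iff_linear)
  then show "f (x + y) = f x + f y" "f (scl V c x) = c * f x" "f 0 = 0" "f (x - y) = f x - f y"
    by (auto simp: module_hom.add module_hom.scale module_hom.zero module_hom.diff)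
qed

lemma restricted_dual_sum:
  assumes "f \<in> restricted_dual V"
  shows "f (\<Sum>i\<in>I. g i) = (\<Sum>i\<in>I. f (g i))"
  by (induction I rule: infinite_finite_induct) (auto simp: restricted_dual_linear[OF assms])

lemma restricted_dualI:
  assumes "\<And>x y. f (x + y) = f x + f y" "\<And>c x. f (scl V c x) = c * f x"
    "finite {(i, \<mu>). \<exists>v\<in>gr V i \<mu>. f v \<noteq> 0}"
  shows "f \<in> restricted_dual V"
proof -
  have "vector_space ((*) :: complex \<Rightarrow> _)"
    by (simp add: vector_space_def algebra_simps)
  then have "Vector_Spaces.linear (scl V) (*) f"
    using assms vector_space
    by (auto simp: Vector_Spaces.linear_def module_hom_def module_hom_axioms_def vector_space_def module_def)
  with assms show ?thesis by (auto simp: restricted_dual_def)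
qed

lemma restricted_dual_add:
  assumes "f \<in> restricted_dual V" "g \<in> restricted_dual V"
  shows "(\<lambda>v. f v + g v) \<in> restricted_dual V"
proof (rule restricted_dualI)
  have "f v \<noteq> 0 \<or> g v \<noteq> 0" if "f v + g v \<noteq> 0" for v
    using that by auto
  then have "{(i, \<mu>). \<exists>v\<in>gr V i \<mu>. f v + g v \<noteq> 0} \<subseteq>
    {(i, \<mu>). \<exists>v\<in>gr V i \<mu>. f v \<noteq> 0} \<union> {(i, \<mu>). \<exists>v\<in>gr V i \<mu>. g v \<noteq> 0}"
    by blast
  with assms show "finite {(i, \<mu>). \<exists>v\<in>gr V i \<mu>. f v + g v \<noteq> 0}"
    by (auto simp: restricted_dual_def intro: finite_subset)
qed (auto simp: restricted_dual_linear[OF assms(1)] restricted_dual_linear[OF assms(2)] algebra_simps)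

lemma restricted_dual_scale:
  assumes "f \<in> restricted_dual V"
  shows "(\<lambda>v. c * f v) \<in> restricted_dual V"
proof (rule restricted_dualI)
  have "{(i, \<mu>). \<exists>v\<in>gr V i \<mu>. c * f v \<noteq> 0} \<subseteq> {(i, \<mu>). \<exists>v\<in>gr V i \<mu>. f v \<noteq> 0}"
    by auto
  with assms show "finite {(i, \<mu>). \<exists>v\<in>gr V i \<mu>. c * f v \<noteq> 0}"
    by (auto simp: restricted_dual_def intro: finite_subset)
qed (auto simp: restricted_dual_linear[OF assms(1)] algebra_simps)

text \<open>A homogeneous mode shifts the bidegree by a fixed amount, so the finite support of f is
  pulled back to a finite set; general A follows by decomposition. This closure carries every
  induction that strips the leftmost letter of a word.\<close>

lemma restricted_dual_md:
  assumes f: "f \<in> restricted_dual V"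
  shows "(\<lambda>v. f (md V A n v)) \<in> restricted_dual V"
proof (induction A rule: homogeneous_induct)
  case (homogeneous i \<mu> A)
  show ?case
  proof (rule restricted_dualI)
    let ?S = "{(i, \<mu>). \<exists>v\<in>gr V i \<mu>. f v \<noteq> 0}"
    have "{(j, \<nu>). \<exists>v\<in>gr V j \<nu>. f (md V A n v) \<noteq> 0} \<subseteq> (\<lambda>(j, \<nu>). (j - i + n + 1, \<nu> - \<mu>)) ` ?S"
    proof safe
      fix j \<nu> v assume v: "v \<in> gr V j \<nu>" "f (md V A n v) \<noteq> 0"
      with md_graded[OF homogeneous v(1), of n] have "(i + j - n - 1, \<mu> + \<nu>) \<in> ?S" by auto
      then show "(j, \<nu>) \<in> (\<lambda>(j, \<nu>). (j - i + n + 1, \<nu> - \<mu>)) ` ?S"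
        by (rule rev_image_eqI) auto
    qed
    then show "finite {(j, \<nu>). \<exists>v\<in>gr V j \<nu>. f (md V A n v) \<noteq> 0}"
      by (rule finite_subset[OF _ finite_imageI]) (use f in \<open>simp add: restricted_dual_def\<close>)
  qed (auto simp: md_right restricted_dual_linear[OF f])
next
  case (add A B)
  from restricted_dual_add[OF add] show ?case by (simp add: md_left restricted_dual_linear[OF f])
qed

lemma restricted_dual_letter:
  assumes f: "f \<in> restricted_dual V"
  shows "(\<lambda>v. f (letter_term V l n v)) \<in> restricted_dual V"
  using restricted_dual_scale[OF restricted_dual_md[OF f]] restricted_dual_md[OF f]
  by (cases l) (auto simp: restricted_dual_linear[OF f])

lemma word_term_simps [simp]:
  "word_term V [] ks v = v" "word_term V (l # w) (k # ks) v = letter_term V l k (word_term V w ks v)"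
  by (auto simp: word_term_def)

end

section \<open>Absolute convergence of matrix elements\<close>

text \<open>Sums of nonnegative terms as integrals over the counting measure: they always exist, so
  reordering and exchanging sums need no summability conditions.\<close>

abbreviation nsum :: "'a set \<Rightarrow> ('a \<Rightarrow> ennreal) \<Rightarrow> ennreal" where
  "nsum S g \<equiv> \<integral>\<^sup>+k. g k \<partial>count_space S"

lemma summable_power_mult_geometric:
  fixes x :: real
  assumes "\<bar>x\<bar> < 1"
  shows "summable (\<lambda>n. of_nat n ^ j * x ^ n)"
  using assms
proof (induction j arbitrary: x)
  case 0
  then show ?case by (simp add: summable_geometric)
next
  case (Suc j)
  \<comment> \<open>\<open>diffs\<close> sends the coefficients n^j to (n + 1)^(j + 1); the
    differentiated series, multiplied by x, is the wanted one with its index shifted by one.\<close>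
  have "summable (\<lambda>n. diffs (\<lambda>n. of_nat n ^ j :: real) n * x ^ n)"
    by (rule termdiff_converges[where K = 1]) (use Suc in auto)
  then have "summable (\<lambda>n. x * (of_nat (Suc n) ^ Suc j * x ^ n))"
    unfolding diffs_def by (intro summable_mult) simp
  then have "summable (\<lambda>n. of_nat (Suc n) ^ Suc j * x ^ Suc n)"
    by (simp add: mult_ac)
  then show ?case by (subst (asm) summable_Suc_iff)
qed

lemma summable_binomial_mult_geometric:
  fixes x :: real
  assumes "0 \<le> x" "x < 1"
  shows "summable (\<lambda>n. of_nat (n choose j) * x ^ n)"
proof (rule summable_comparison_test')
  show "summable (\<lambda>n. of_nat n ^ j * x ^ n)"
    by (rule summable_power_mult_geometric) (use assms in auto)
  show "norm (real (n choose j) * x ^ n) \<le> of_nat n ^ j * x ^ n" for n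
    using assms
    by (cases "j \<le> n") (auto simp: binomial_le_pow binomial_eq_0 simp flip: of_nat_power intro!: mult_right_mono)
qed

text \<open>The coefficients created by commuting the modes m of an operator at s0 past one at s: a
  binomial from the commutator formula and s^(m - p) from the index shift. Their sum is geometric of
  ratio s / s0 up to a polynomial factor, so this is where the strict decrease of the arguments is
  used.\<close>

lemma binomial_tail_finite:
  fixes s s0 :: real
  assumes s: "0 < s" "s < s0"
  shows "nsum {M..} (\<lambda>m. ennreal (s0 powi (- int m - 1)) * ennreal (real (m choose p) * s powi (int m - int p))) < top"
    (is "nsum _ ?g < top")
proof -
  let ?h = "\<lambda>m. inverse s0 * s powi (- int p) * (real (m choose p) * (s / s0) ^ m)"
  have g: "?g m = ennreal (?h m)" for m
  proof -
    have "s0 powi (- int m - 1) = inverse s0 * inverse (s0 ^ m)" "s powi (int m - int p) = s powi (- int p) * s ^ m"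
      using s by (simp_all add: power_int_diff power_int_minus field_simps)
    then show ?thesis using s by (simp add: power_divide field_simps flip: ennreal_mult)
  qed
  have "(nsum {M..} (\<lambda>m. ?g m)) \<le> (nsum UNIV (\<lambda>m. ?g m))"
    by (subst nn_integral_count_space_indicator) (auto intro!: nn_integral_mono simp: indicator_def)
  also have "\<dots> = suminf (\<lambda>m. ennreal (?h m))"
    unfolding g by (rule nn_integral_count_space_nat)
  also have "\<dots> < top"
    unfolding less_top[symmetric]
  proof (rule ennreal_suminf_neq_top)
    show "summable ?h"
      by (intro summable_mult summable_binomial_mult_geometric) (use s in auto)
  qed (use s in simp)
  finally show ?thesis .
qed

lemma nn_integral_count_space_int_split:
  fixes g :: "int \<Rightarrow> ennreal"
  assumes "\<And>k. k < L \<Longrightarrow> g k = 0"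
  shows "(nsum UNIV (\<lambda>k. g k)) \<le> (\<Sum>k\<in>{L..<int M}. g k) + (nsum {M..} (\<lambda>m. g (int m)))"
proof -
  have "(nsum UNIV (\<lambda>k. g k)) \<le>
    (nsum UNIV (\<lambda>k. g k * indicator {L..<int M} k + g k * indicator {int M..} k))"
    by (rule nn_integral_mono) (use assms in \<open>auto simp: indicator_def not_less\<close>)
  also have "\<dots> = (nsum {L..<int M} (\<lambda>k. g k)) + (nsum {int M..} (\<lambda>k. g k))"
    by (simp add: nn_integral_add nn_integral_count_space_indicator)
  also have "(nsum {L..<int M} (\<lambda>k. g k)) = (\<Sum>k\<in>{L..<int M}. g k)"
    by (simp add: nn_integral_count_space_finite)
  also have "(nsum {int M..} (\<lambda>k. g k)) = (nsum {M..} (\<lambda>m. g (int m)))"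
    by (rule nn_integral_bij_count_space[symmetric]) (rule bij_betw_byWitness[where f' = nat], auto)
  finally show ?thesis .
qed

text \<open>The iterated sum of the absolute values of all mode terms of a word. The recursion
  changes only the functional, so that a bound valid for every f can be inserted under the sum over
  the first letter.\<close>

primrec abs_series :: "('v, 'm) vosa_scheme \<Rightarrow> 'v letter list \<Rightarrow> ('v \<Rightarrow> complex) \<Rightarrow> 'v \<Rightarrow> ennreal" where
  "abs_series V [] = (\<lambda>f v. ennreal (norm (f v)))"
| "abs_series V (l # w) =
    (\<lambda>f v. nsum (letter_modes l) (\<lambda>k. abs_series V w (\<lambda>u. f (letter_term V l k u)) v))"

text \<open>A pointwise estimate of functionals passes under all mode sums, because the letters act
  only on the argument u. The finite weighted sum has the shape of a commutator formula: one swapped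
  product and several corrections.\<close>

lemma abs_series_mono_sum:
  assumes "\<And>u. ennreal (norm (f u)) \<le> (\<Sum>i\<in>I. c i * ennreal (norm (g i u)))"
  shows "abs_series V w f v \<le> (\<Sum>i\<in>I. c i * abs_series V w (g i) v)"
  using assms
proof (induction w arbitrary: f g)
  case (Cons l w)
  have "abs_series V (l # w) f v \<le>
      (nsum (letter_modes l) (\<lambda>k. (\<Sum>i\<in>I. c i * abs_series V w (\<lambda>u. g i (letter_term V l k u)) v)))"
    by (simp, rule nn_integral_mono, rule Cons.IH, rule Cons.prems)
  also have "\<dots> = (\<Sum>i\<in>I. c i * abs_series V (l # w) (g i) v)"
    by (simp add: nn_integral_sum nn_integral_cmult)
  finally show ?case .
qed simp

lemma abs_series_le_add:
  assumes "\<And>u. norm (f u) \<le> norm (g u) + norm (h u)"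
  shows "abs_series V w f v \<le> abs_series V w g v + abs_series V w h v"
proof -
  have "abs_series V w f v \<le> (\<Sum>i\<in>{False, True}. 1 * abs_series V w (if i then g else h) v)"
    by (rule abs_series_mono_sum) (use assms in \<open>auto simp: add.commute simp flip: ennreal_plus intro!: ennreal_leI\<close>)
  then show ?thesis by (simp add: add.commute)
qed

lemma abs_series_scale:
  "abs_series V w (\<lambda>u. c * f u) v = ennreal (norm c) * abs_series V w f v"
proof (induction w arbitrary: f)
  case Nil
  then show ?case by (simp add: norm_mult ennreal_mult)
next
  case (Cons l w)
  then show ?case by (simp add: nn_integral_cmult)
qed

lemma abs_series_eq_0:
  assumes "\<And>ks. length ks = length w \<Longrightarrow> f (word_term V w ks v) = 0"
  shows "abs_series V w f v = 0"
  using assms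
proof (induction w arbitrary: f)
  case Nil
  from Nil[of "[]"] show ?case by (simp add: word_term_def)
next
  case (Cons l w)
  have "abs_series V w (\<lambda>u. f (letter_term V l k u)) v = 0" for k
  proof (rule Cons.IH)
    fix ks :: "int list" assume "length ks = length w"
    with Cons.prems[of "k # ks"] show "f (letter_term V l k (word_term V w ks v)) = 0"
      by (simp add: word_term_def)
  qed
  then show ?case by simp
qed

context vertex_operator_superalgebra
begin

section \<open>Bounds on the index sum of nonvanishing mode products\<close>

definition hom_word :: "'v letter list \<Rightarrow> bool" where
  "hom_word w \<longleftrightarrow> (\<forall>l\<in>set w. \<exists>A s i \<mu>. l = Vertex A s \<and> s > 0 \<and> A \<in> gr V i \<mu>)"

lemma hom_word_simps [simp]:
  "hom_word []" "hom_word (l # w) \<longleftrightarrow> (\<exists>A s i \<mu>. l = Vertex A s \<and> s > 0 \<and> A \<in> gr V i \<mu>) \<and> hom_word w"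
  "hom_word (w @ w') \<longleftrightarrow> hom_word w \<and> hom_word w'"
  by (auto simp: hom_word_def)

lemma length_word_args: "hom_word w \<Longrightarrow> length (word_args w) = length w"
  by (induction w) auto

lemma abs_series_Vertex:
  assumes f: "f \<in> restricted_dual V" and s: "s > 0"
  shows "abs_series V (Vertex A s # w) f v =
    (nsum UNIV (\<lambda>k. ennreal (s powi (- k - 1)) * abs_series V w (\<lambda>u. f (md V A k u)) v))"
  by (simp add: restricted_dual_linear[OF f] abs_series_scale norm_power_int abs_of_pos[OF s])

text \<open>A transfer of vanishing: if f kills the words of T from index sum X - J on, then it
  kills A_m followed by w from index sum X on, provided m is at least M. Quantifying over f and X
  inside lets a further letter B_k be absorbed into f while X is lowered by k.\<close>

definition supported_by ::
    "'v letter list list \<Rightarrow> int \<Rightarrow> 'v \<Rightarrow> int \<Rightarrow> 'v letter list \<Rightarrow> 'v \<Rightarrow> bool" where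
  "supported_by T J A M w v \<longleftrightarrow>
    (\<forall>f\<in>restricted_dual V. \<forall>X :: int.
      (\<forall>C\<in>set T. \<forall>ks. length ks = length w \<longrightarrow> sum_list ks \<ge> X - J \<longrightarrow> f (word_term V C ks v) = 0) \<longrightarrow>
      (\<forall>m\<ge>M. \<forall>ks. length ks = length w \<longrightarrow> m + sum_list ks \<ge> X \<longrightarrow> f (md V A m (word_term V w ks v)) = 0))"

lemma supported_byD:
  assumes "supported_by T J A M w v" "f \<in> restricted_dual V"
    and "\<And>C ks. C \<in> set T \<Longrightarrow> length ks = length w \<Longrightarrow> sum_list ks \<ge> X - J \<Longrightarrow> f (word_term V C ks v) = 0"
    and "m \<ge> M" "length ks = length w" "m + sum_list ks \<ge> X"
  shows "f (md V A m (word_term V w ks v)) = 0"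
  using assms(1)[unfolded supported_by_def, rule_format, OF assms(2) _ assms(4-6)] assms(3) by blast

text \<open>Move A_m to the right until it meets v, which it annihilates because m is at least M.
  Each commutator with a letter B replaces the two letters by the single letter A_p B, and lowers
  the index sum by p, which is bounded by truncation. Thus T consists of words as short as
  w.\<close>

lemma commute_support:
  assumes A: "A \<in> gr V i \<mu>" and M: "\<And>m. m \<ge> M \<Longrightarrow> md V A m v = 0" and w: "hom_word w"
  shows "\<exists>T J. (\<forall>C\<in>set T. hom_word C \<and> length C = length w) \<and> supported_by T J A M w v"
  using w
proof (induction w)
  case Nil
  have "supported_by [] 0 A M [] v"
    unfolding supported_by_def
  proof (intro ballI allI impI)
    fix f X m and ks :: "int list"
    assume f: "f \<in> restricted_dual V" and m: "M \<le> m"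
    show "f (md V A m (word_term V [] ks v)) = 0"
      using M[OF m] by (simp add: restricted_dual_linear(3)[OF f])
  qed
  then show ?case by (intro exI[of _ "[]"] exI[of _ 0]) simp
next
  case (Cons l w)
  then obtain B s j \<nu> where l: "l = Vertex B s" "s > 0" "B \<in> gr V j \<nu>" and w: "hom_word w" by auto
  obtain T J where TJ: "\<And>C. C \<in> set T \<Longrightarrow> hom_word C \<and> length C = length w"
    "supported_by T J A M w v"
    using Cons.IH[OF w] by blast
  obtain N where N: "\<And>n. n \<ge> N \<Longrightarrow> md V A n B = 0" using truncation by blast
  define J0 where "J0 = nat N"
  have J0: "md V A (int k) B = 0" if "k \<ge> J0" for k using that N by (simp add: J0_def)
  \<comment> \<open>The first part keeps B and lets A_m commute further into w; the second collects
    the commutators of A_m with B itself.\<close>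
  define T' where "T' = map (\<lambda>C. Vertex B s # C) T @ map (\<lambda>k. Vertex (md V A (int k) B) s # w) [0..<J0]"
  define J' where "J' = max J (int J0)"
  show ?case
  proof (intro exI[of _ T'] exI[of _ J'] conjI ballI)
    fix C assume C: "C \<in> set T'"
    moreover have "\<exists>i \<mu>. md V A n B \<in> gr V i \<mu>" "\<exists>i \<mu>. B \<in> gr V i \<mu>" for n
      using md_graded[OF A l(3)] l(3) by blast+
    ultimately show "hom_word C" "length C = length (l # w)"
      using l w TJ(1) by (auto simp: T'_def; blast)+
  next
    show "supported_by T' J' A M (l # w) v"
      unfolding supported_by_def
    proof (intro ballI allI impI)
    fix f X m and ks :: "int list"
    assume f: "f \<in> restricted_dual V"
      and hyp: "\<forall>C\<in>set T'. \<forall>ks. length ks = length (l # w) \<longrightarrow> X - J' \<le> sum_list ks \<longrightarrow> f (word_term V C ks v) = 0"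
      and m: "M \<le> m" and ks: "length ks = length (l # w)" "X \<le> m + sum_list ks"
    obtain k ks' where ks': "ks = k # ks'" using ks by (cases ks) auto
    let ?u = "word_term V w ks' v"
    have 1: "f (md V B k (md V A m ?u)) = 0"
    proof (rule supported_byD[OF TJ(2) restricted_dual_md[OF f], where X = "X - k"])
      fix C ks'' assume C: "C \<in> set T" "length ks'' = length w" "X - k - J \<le> sum_list ks''"
      have "f (word_term V (Vertex B s # C) (k # ks'') v) = 0"
        by (rule hyp[rule_format]) (use C in \<open>auto simp: T'_def J'_def\<close>)
      then show "f (md V B k (word_term V C ks'' v)) = 0"
        using l(2) by (simp add: restricted_dual_linear[OF f])
    qed (use ks m ks' in auto)
    have 2: "f (md V (md V A (int p) B) (m + k - int p) ?u) = 0" if p: "p < J0" for p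
    proof -
      have "f (word_term V (Vertex (md V A (int p) B) s # w) ((m + k - int p) # ks') v) = 0"
        by (rule hyp[rule_format]) (use p ks ks' in \<open>auto simp: T'_def J'_def\<close>)
      then show ?thesis
        using l(2) by (simp add: restricted_dual_linear[OF f])
    qed
    show "f (md V A m (word_term V (l # w) ks v)) = 0"
      by (simp add: l ks' md_right restricted_dual_linear[OF f] restricted_dual_sum[OF f] commutator_mode[OF A l(3) J0] 1 2)
    qed
  qed
qed

text \<open>Induction on the length. For a first index at least M the words of
  \<open>commute_support\<close>, one letter shorter, control the vanishing; for a smaller first
  index the remaining index sum is large, and the hypothesis applies to f composed with that mode.
  The bound is uniform in f, which both cases require.\<close>

lemma word_support:
  assumes "hom_word w"
  shows "\<exists>N. \<forall>f\<in>restricted_dual V. \<forall>ks. length ks = length w \<and> sum_list ks \<ge> N \<longrightarrow> f (word_term V w ks v) = 0"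
  using assms
proof (induction "length w" arbitrary: w)
  case 0
  then show ?case by (intro exI[of _ 1]) auto
next
  case (Suc n)
  then obtain A s i \<mu> w' where w: "w = Vertex A s # w'" "s > 0" "A \<in> gr V i \<mu>" "hom_word w'" "length w' = n"
    by (cases w) auto
  obtain M where M: "\<And>m. m \<ge> M \<Longrightarrow> md V A m v = 0" using truncation by blast
  obtain T J where TJ: "\<And>C. C \<in> set T \<Longrightarrow> hom_word C \<and> length C = length w'"
    "supported_by T J A M w' v"
    using commute_support[OF w(3) M w(4)] by blast
  let ?P = "\<lambda>w N. \<forall>f\<in>restricted_dual V. \<forall>ks. length ks = length w \<and> sum_list ks \<ge> N \<longrightarrow> f (word_term V w ks v) = 0"
  have "\<forall>C\<in>set T. \<exists>N. ?P C N" 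
  proof
    fix C assume "C \<in> set T"
    with TJ(1) w(5) have "hom_word C" "n = length C" by auto
    then show "\<exists>N. ?P C N" using Suc.hyps(1) by blast
  qed
  then obtain NC where NC: "\<And>C. C \<in> set T \<Longrightarrow> ?P C (NC C)" by metis
  obtain N0 where N0: "?P w' N0" using Suc.hyps(1) w by blast
  define N1 where "N1 = Max (insert 0 (NC ` set T))"
  have N1: "NC C \<le> N1" if "C \<in> set T" for C using that by (auto simp: N1_def)
  \<comment> \<open>The two entries of the maximum serve the cases of first index at least M and
    below M.\<close>
  show ?case
  proof (intro exI[of _ "max (N1 + J) (M + N0)"] ballI allI impI; elim conjE)
    fix f and ks :: "int list" assume f: "f \<in> restricted_dual V" and ks: "length ks = length w" "max (N1 + J) (M + N0) \<le> sum_list ks"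
    then obtain m ks' where ks': "ks = m # ks'" "length ks' = length w'" using w by (cases ks) auto
    have "f (md V A m (word_term V w' ks' v)) = 0"
    proof (cases "m \<ge> M")
      case True
      show ?thesis
      proof (rule supported_byD[OF TJ(2) f _ True ks'(2), where X = "N1 + J"])
        fix C and ks :: "int list" assume "C \<in> set T" "length ks = length w'" "N1 + J - J \<le> sum_list ks"
        with NC[of C] N1[of C] f TJ(1)[of C] show "f (word_term V C ks v) = 0" by auto
      qed (use ks ks' in auto)
    next
      case False
      with N0 restricted_dual_md[OF f, of A m] ks ks' show ?thesis by auto
    qed
    then show "f (word_term V w ks v) = 0"
      by (simp add: w ks' restricted_dual_linear[OF f])
  qed
qed

lemma word_term_graded:
  assumes "hom_word w" "v \<in> gr V h \<eta>"
  shows "\<exists>c d. \<forall>ks. length ks = length w \<longrightarrow> word_term V w ks v \<in> gr V (c - sum_list ks) d"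
  using assms
proof (induction w)
  case Nil
  then show ?case by (intro exI[of _ h] exI[of _ \<eta>]) auto
next
  case (Cons l w)
  then obtain c d where cd: "\<And>ks. length ks = length w \<Longrightarrow> word_term V w ks v \<in> gr V (c - sum_list ks) d"
    by auto
  from Cons obtain A s i \<mu> where l: "l = Vertex A s" "s > 0" "A \<in> gr V i \<mu>" by auto
  show ?case
  proof (intro exI allI impI)
    fix ks :: "int list" assume "length ks = length (l # w)"
    then obtain k ks' where ks: "ks = k # ks'" "length ks' = length w" by (cases ks) auto
    have "md V A k (word_term V w ks' v) \<in> gr V (i + (c - sum_list ks') - k - 1) (\<mu> + d)"
      by (rule md_graded[OF l(3) cd[OF ks(2)]])
    then have "word_term V (l # w) ks v \<in> gr V (i + (c - sum_list ks') - k - 1) (\<mu> + d)"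
      by (simp add: ks l gr_subspace vs.subspace_scale)
    then show "word_term V (l # w) ks v \<in> gr V (i + c - 1 - sum_list ks) (\<mu> + d)"
      by (simp add: ks algebra_simps)
  qed
qed

lemma word_lower_bound:
  assumes "hom_word w" "v \<in> gr V h \<eta>" "f \<in> restricted_dual V"
  shows "\<exists>K. \<forall>ks. length ks = length w \<and> sum_list ks < K \<longrightarrow> f (word_term V w ks v) = 0"
proof -
  obtain c d where cd: "\<And>ks. length ks = length w \<Longrightarrow> word_term V w ks v \<in> gr V (c - sum_list ks) d"
    using word_term_graded[OF assms(1,2)] by blast
  let ?S = "{(i, \<mu>). \<exists>v\<in>gr V i \<mu>. f v \<noteq> 0}"
  have fin: "finite (fst ` ?S)" using assms(3) by (auto simp: restricted_dual_def)
  show ?thesis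
  proof (intro exI allI impI; elim conjE)
    \<comment> \<open>The weight c - \<open>sum_list ks\<close> then exceeds every weight on which f
      is nonzero; inserting 0 keeps the maximum meaningful for f = 0.\<close>
    fix ks :: "int list" assume ks: "length ks = length w" "sum_list ks < c - Max (insert 0 (fst ` ?S))"
    show "f (word_term V w ks v) = 0"
    proof (rule ccontr)
      assume "f (word_term V w ks v) \<noteq> 0"
      with cd[OF ks(1)] have "c - sum_list ks \<in> fst ` ?S" by force
      then have "c - sum_list ks \<le> Max (insert 0 (fst ` ?S))" using fin by (intro Max_ge) auto
      with ks show False by simp
    qed
  qed
qed

text \<open>The part of the series of A(s) w that commutation handles: M is chosen later so that
  these modes annihilate v. A natural index keeps the binomials of the commutator formula ordinary
  ones.\<close>

definition tail_series :: "'v \<Rightarrow> real \<Rightarrow> nat \<Rightarrow> 'v letter list \<Rightarrow> ('v \<Rightarrow> complex) \<Rightarrow> 'v \<Rightarrow> ennreal" where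
  "tail_series A s M w f v =
    (nsum {M..} (\<lambda>m. ennreal (s powi (- int m - 1)) * abs_series V w (\<lambda>u. f (md V A (int m) u)) v))"

text \<open>
  The list \<open>T\<close> is independent of \<open>f\<close>, so the bound can be summed over the modes of a letter standing
  further to the left, which \<open>f\<close> absorbs.
\<close>

lemma commute_bound:
  assumes A: "A \<in> gr V i \<mu>" and M: "\<And>m. m \<ge> int M \<Longrightarrow> md V A m v = 0"
    and w: "hom_word w" "\<And>s. s \<in> set (word_args w) \<Longrightarrow> s < s0" and s0: "s0 > 0"
  shows "\<exists>T. (\<forall>(c, C)\<in>set T. c < top \<and> hom_word C \<and> word_args C = word_args w) \<and>
    (\<forall>f\<in>restricted_dual V. tail_series A s0 M w f v \<le> (\<Sum>(c, C)\<leftarrow>T. c * abs_series V C f v))"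
  using w
proof (induction w)
  case Nil
  have "tail_series A s0 M [] f v = 0" if f: "f \<in> restricted_dual V" for f
    unfolding tail_series_def by (subst nn_integral_0_iff_AE) (auto simp: AE_count_space M restricted_dual_linear(3)[OF f])
  then show ?case by (intro exI[of _ "[]"]) auto
next
  case (Cons l w)
  then obtain B s j \<nu> where l: "l = Vertex B s" "s > 0" "B \<in> gr V j \<nu>" and w: "hom_word w" by auto
  from Cons.prems l have s: "s < s0" by auto
  have "\<exists>T. (\<forall>(c, C)\<in>set T. c < top \<and> hom_word C \<and> word_args C = word_args w) \<and>
    (\<forall>f\<in>restricted_dual V. tail_series A s0 M w f v \<le> (\<Sum>(c, C)\<leftarrow>T. c * abs_series V C f v))"
    by (rule Cons.IH) (use Cons.prems l in auto)
  then obtain T where T: "\<And>c C. (c, C) \<in> set T \<Longrightarrow> c < top \<and> hom_word C \<and> word_args C = word_args w"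
    and T': "\<forall>f\<in>restricted_dual V. tail_series A s0 M w f v \<le> (\<Sum>(c, C)\<leftarrow>T. c * abs_series V C f v)"
    by blast
  obtain N where N: "\<And>n. n \<ge> N \<Longrightarrow> md V A n B = 0" using truncation by blast
  define J where "J = nat N"
  have J: "md V A (int k) B = 0" if "k \<ge> J" for k using that N by (simp add: J_def)
  \<comment> \<open>For fixed m the sum over k is reindexed by the index m + k - p of A_p B. The
    weight s^(-k-1) then splits into s^(m-p) and the weight of the new index, so the sum over m
    separates and equals this constant.\<close>
  define c where "c p = (nsum {M..} (\<lambda>m. ennreal (s0 powi (- int m - 1)) * ennreal (real (m choose p) * s powi (int m - int p))))" for p
  define T2 where "T2 = map (\<lambda>(c, C). (c, Vertex B s # C)) T @ map (\<lambda>p. (c p, Vertex (md V A (int p) B) s # w)) [0..<J]"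
  have c: "c p < top" for p
    unfolding c_def by (rule binomial_tail_finite[OF l(2) s])
  show ?case
  proof (intro exI[of _ T2] conjI ballI)
    fix x assume "x \<in> set T2"
    moreover have "\<exists>i \<mu>. md V A n B \<in> gr V i \<mu>" "\<exists>i \<mu>. B \<in> gr V i \<mu>" for n
      using md_graded[OF A l(3)] l(3) by blast+
    ultimately show "case x of (c, C) \<Rightarrow> c < top \<and> hom_word C \<and> word_args C = word_args (l # w)"
      using T c l w by (auto simp: T2_def; blast)
  next
    fix f assume f: "f \<in> restricted_dual V"
    note lin = restricted_dual_linear[OF f] restricted_dual_sum[OF f]
    define e where "e s k = ennreal (s powi (- k - 1))" for s :: real and k :: int
    let ?S = "\<lambda>B k. abs_series V w (\<lambda>u. f (md V B k u)) v"
    let ?S2 = "\<lambda>k m. abs_series V w (\<lambda>u. f (md V B k (md V A (int m) u))) v"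
    let ?T = "\<lambda>p m k. e s0 (int m) * (e s k * (ennreal (real (m choose p)) * ?S (md V A (int p) B) (int m + k - int p)))"
    have step: "abs_series V w (\<lambda>u. f (md V A (int m) (md V B k u))) v \<le>
        ?S2 k m + (\<Sum>p<J. ennreal (real (m choose p)) * ?S (md V A (int p) B) (int m + k - int p))" for m k
    proof -
      \<comment> \<open>\<open>None\<close> labels the swapped product, \<open>Some p\<close> the
        p-th correction of the commutator formula.\<close>
      let ?g = "\<lambda>q u. case q of None \<Rightarrow> f (md V B k (md V A (int m) u)) | Some p \<Rightarrow> f (md V (md V A (int p) B) (int m + k - int p) u)"
      let ?c = "\<lambda>q. case q of None \<Rightarrow> 1 | Some p \<Rightarrow> ennreal (real (m choose p))"
      have "abs_series V w (\<lambda>u. f (md V A (int m) (md V B k u))) v \<le>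
        (\<Sum>q\<in>insert None (Some ` {..<J}). ?c q * abs_series V w (?g q) v)"
      proof (rule abs_series_mono_sum)
        fix u
        have "norm (f (md V A (int m) (md V B k u))) \<le> norm (f (md V B k (md V A (int m) u))) +
          (\<Sum>p<J. real (m choose p) * norm (f (md V (md V A (int p) B) (int m + k - int p) u)))"
        proof -
          have "norm (sg (\<mu> * \<nu>)) = 1" by (auto simp: sg_cases)
          then show ?thesis
            by (subst commutator_mode[OF A l(3) J])
              (auto simp: lin norm_mult binomial_gbinomial[symmetric] intro!: norm_triangle_mono sum_norm_le)
        qed
        then have "ennreal (norm (f (md V A (int m) (md V B k u)))) \<le> ennreal (norm (f (md V B k (md V A (int m) u)))) +
          (\<Sum>p<J. ennreal (real (m choose p)) * ennreal (norm (f (md V (md V A (int p) B) (int m + k - int p) u))))"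
          by (simp add: sum_nonneg ennreal_leI flip: ennreal_plus ennreal_mult)
        then show "ennreal (norm (f (md V A (int m) (md V B k u)))) \<le>
          (\<Sum>q\<in>insert None (Some ` {..<J}). ?c q * ennreal (norm (?g q u)))"
          by (simp add: sum.reindex)
      qed
      then show ?thesis by (simp add: sum.reindex)
    qed
    \<comment> \<open>Exchanging the sums puts the sum over m inside, where it is the tail series of
      A and w for the functional f composed with B_k, and the induction hypothesis applies.\<close>
    have "(nsum {M..} (\<lambda>m. nsum UNIV (\<lambda>k. e s0 (int m) * (e s k * ?S2 k m)))) =
        (nsum UNIV (\<lambda>k. nsum {M..} (\<lambda>m. e s0 (int m) * (e s k * ?S2 k m))))"
      by (rule pair_sigma_finite.Fubini')
        (auto simp: pair_sigma_finite_def sigma_finite_measure_count_space_countable pair_measure_countable)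
    also have "\<dots> = (nsum UNIV (\<lambda>k. e s k * (nsum {M..} (\<lambda>m. e s0 (int m) * ?S2 k m))))"
      by (simp add: mult.left_commute[of "e s0 _"] nn_integral_cmult)
    also have "\<dots> \<le> (nsum UNIV (\<lambda>k. e s k * (\<Sum>(c, C)\<leftarrow>T. c * abs_series V C (\<lambda>u. f (md V B k u)) v)))"
      by (intro nn_integral_mono mult_left_mono T'[rule_format, OF restricted_dual_md[OF f], unfolded tail_series_def, folded e_def]) auto
    also have "\<dots> = (\<Sum>(c, C)\<leftarrow>T. c * abs_series V (Vertex B s # C) f v)"
      unfolding abs_series_Vertex[OF f l(2)] e_def[symmetric]
    proof (induction T)
      case (Cons cC T)
      then show ?case
        by (cases cC) (simp add: distrib_left nn_integral_add mult.left_commute[of "e s _"] nn_integral_cmult)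
    qed simp
    finally have first: "(nsum {M..} (\<lambda>m. nsum UNIV (\<lambda>k. e s0 (int m) * (e s k * ?S2 k m)))) \<le>
        (\<Sum>(c, C)\<leftarrow>T. c * abs_series V (Vertex B s # C) f v)" .
    have "(nsum {M..} (\<lambda>m. e s0 (int m) * abs_series V (l # w) (\<lambda>u. f (md V A (int m) u)) v)) =
        (nsum {M..} (\<lambda>m. nsum UNIV (\<lambda>k. e s0 (int m) * (e s k * abs_series V w (\<lambda>u. f (md V A (int m) (md V B k u))) v))))"
      unfolding l e_def abs_series_Vertex[OF restricted_dual_md[OF f] l(2)] by (simp add: nn_integral_cmult)
    also have "\<dots> \<le> (nsum {M..} (\<lambda>m. nsum UNIV (\<lambda>k. e s0 (int m) * (e s k * (?S2 k m +
        (\<Sum>p<J. ennreal (real (m choose p)) * ?S (md V A (int p) B) (int m + k - int p)))))))"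
      by (intro nn_integral_mono mult_left_mono step) auto
    also have "\<dots> = (nsum {M..} (\<lambda>m. nsum UNIV (\<lambda>k. e s0 (int m) * (e s k * ?S2 k m)))) +
        (nsum {M..} (\<lambda>m. nsum UNIV (\<lambda>k. (\<Sum>p<J. ?T p m k))))"
      by (simp add: distrib_left sum_distrib_left nn_integral_add)
    also have "(nsum {M..} (\<lambda>m. nsum UNIV (\<lambda>k. (\<Sum>p<J. ?T p m k)))) =
        (\<Sum>p<J. nsum {M..} (\<lambda>m. nsum UNIV (\<lambda>k. ?T p m k)))"
      by (simp add: nn_integral_sum)
    also have "\<dots> = (\<Sum>p<J. c p * abs_series V (Vertex (md V A (int p) B) s # w) f v)"
    proof (rule sum.cong[OF refl])
      fix p
      let ?R = "abs_series V (Vertex (md V A (int p) B) s # w) f v"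
      have "(nsum UNIV (\<lambda>k. ?T p m k))
         = e s0 (int m) * ennreal (real (m choose p) * s powi (int m - int p)) * ?R" for m
      proof -
        have "?R = (nsum UNIV (\<lambda>k. e s (int m + k - int p) * ?S (md V A (int p) B) (int m + k - int p)))"
          unfolding abs_series_Vertex[OF f l(2)] e_def[symmetric]
          by (rule nn_integral_bij_count_space[symmetric])
            (rule bij_betw_byWitness[where f' = "\<lambda>k. k - int m + int p"], auto)
        then have "e s0 (int m) * ennreal (real (m choose p) * s powi (int m - int p)) * ?R =
          (nsum UNIV (\<lambda>k. e s0 (int m) * ennreal (real (m choose p) * s powi (int m - int p)) *
            (e s (int m + k - int p) * ?S (md V A (int p) B) (int m + k - int p))))"
          by (simp add: nn_integral_cmult)
        also have "\<dots> = (nsum UNIV (\<lambda>k. ?T p m k))"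
        proof (rule nn_integral_cong)
          fix k
          have "s powi (- k - 1) = s powi (int m - int p) * s powi (- (int m + k - int p) - 1)"
            using l(2) by (simp flip: power_int_add)
          then have "e s k = ennreal (s powi (int m - int p)) * e s (int m + k - int p)"
            using l(2) by (simp add: e_def flip: ennreal_mult)
          then show "e s0 (int m) * ennreal (real (m choose p) * s powi (int m - int p)) *
              (e s (int m + k - int p) * ?S (md V A (int p) B) (int m + k - int p)) =
            ?T p m k"
            using l(2) by (simp add: ennreal_mult mult_ac)
        qed
        finally show ?thesis by simp
      qed
      then show "(nsum {M..} (\<lambda>m. nsum UNIV (\<lambda>k. ?T p m k)))
        = c p * ?R"
        by (simp add: nn_integral_multc c_def e_def)
    qed
    also note add_right_mono[OF first]
    also have "(\<Sum>(c, C)\<leftarrow>T. c * abs_series V (Vertex B s # C) f v) + (\<Sum>p<J. c p * abs_series V (Vertex (md V A (int p) B) s # w) f v) =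
        (\<Sum>(c, C)\<leftarrow>T2. c * abs_series V C f v)"
      by (simp add: T2_def o_def case_prod_unfold interv_sum_list_conv_sum_set_nat atLeast0LessThan)
    finally show "tail_series A s0 M (l # w) f v \<le> (\<Sum>(c, C)\<leftarrow>T2. c * abs_series V C f v)"
      unfolding e_def tail_series_def .
  qed
qed

lemma abs_series_hom_finite:
  assumes "hom_word w" "sorted_wrt (>) (word_args w)" "v \<in> gr V h \<eta>" "f \<in> restricted_dual V"
  shows "abs_series V w f v < top"
  using assms
proof (induction "length w" arbitrary: w f)
  case 0
  then show ?case by simp
next
  case (Suc n)
  then obtain A s i \<mu> w' where w: "w = Vertex A s # w'" "s > 0" "A \<in> gr V i \<mu>" "hom_word w'" "length w' = n"
    by (cases w) auto
  note f = \<open>f \<in> restricted_dual V\<close>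
  have args: "\<And>t. t \<in> set (word_args w') \<Longrightarrow> t < s" "sorted_wrt (>) (word_args w')" using Suc.prems w by auto
  obtain M' where M': "\<And>m. m \<ge> M' \<Longrightarrow> md V A m v = 0" using truncation by blast
  define M where "M = nat M'"
  have M: "md V A m v = 0" if "m \<ge> int M" for m
    by (rule M') (use that in \<open>auto simp: M_def split: if_splits\<close>)
  obtain K where K: "\<And>ks. length ks = length w \<Longrightarrow> sum_list ks < K \<Longrightarrow> f (word_term V w ks v) = 0"
    using word_lower_bound[OF Suc.prems(1) Suc.prems(3) f] by blast
  obtain N where N: "\<And>g ks. g \<in> restricted_dual V \<Longrightarrow> length ks = length w' \<Longrightarrow> sum_list ks \<ge> N \<Longrightarrow> g (word_term V w' ks v) = 0"
    using word_support[OF w(4), of v] by metis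
  let ?g = "\<lambda>k. ennreal (s powi (- k - 1)) * abs_series V w' (\<lambda>u. f (md V A k u)) v"
  \<comment> \<open>If the remaining index sum is at least N, the upper bound gives zero; otherwise
    the total is below K and the lower bound does. Hence only finitely many modes below M
    contribute.\<close>
  have low: "?g k = 0" if k: "k < K - N" for k
  proof -
    have "abs_series V w' (\<lambda>u. f (md V A k u)) v = 0"
    proof (rule abs_series_eq_0)
      fix ks :: "int list" assume ks: "length ks = length w'"
      show "f (md V A k (word_term V w' ks v)) = 0"
      proof (cases "sum_list ks \<ge> N")
        case True
        then show ?thesis using N[OF restricted_dual_md[OF f] ks] by simp
      next
        case False
        then have "f (word_term V w (k # ks) v) = 0" by (intro K) (use ks w k in auto)
        then show ?thesis using w(2) by (simp add: w(1) restricted_dual_linear[OF f])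
      qed
    qed
    then show ?thesis by simp
  qed
  have fin: "?g k < top" for k
    using Suc.hyps(1)[of w' "\<lambda>u. f (md V A k u)"] w args Suc.prems restricted_dual_md[OF f]
    by (simp add: ennreal_mult_less_top)
  obtain T where T: "\<And>c C. (c, C) \<in> set T \<Longrightarrow> c < top \<and> hom_word C \<and> word_args C = word_args w'"
    and T': "\<forall>f\<in>restricted_dual V.
      tail_series A s M w' f v
      \<le> (\<Sum>(c, C)\<leftarrow>T. c * abs_series V C f v)"
    using commute_bound[OF w(3) M w(4) args(1) w(2)] by blast
  \<comment> \<open>The words of T have the arguments of w', so they are decreasing and of length n,
    and the induction hypothesis covers them.\<close>
  have T_fin: "(\<Sum>(c, C)\<leftarrow>T. c * abs_series V C f v) < top"
    using T
  proof (induction T)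
    case (Cons cC T)
    obtain c C where cC: "cC = (c, C)" by (cases cC)
    have C: "c < top" "hom_word C" "word_args C = word_args w'" using Cons.prems[of c C] cC by auto
    then have "length C = n" using length_word_args[of C] length_word_args[OF w(4)] w(5) by simp
    with Suc.hyps(1)[of C f] C args Suc.prems have "abs_series V C f v < top" by simp
    moreover have "(\<Sum>(c, C)\<leftarrow>T. c * abs_series V C f v) < top"
      by (rule Cons.IH) (use Cons.prems in auto)
    ultimately show ?case using C by (simp add: cC ennreal_mult_less_top)
  qed simp
  have "abs_series V w f v = (nsum UNIV (\<lambda>k. ?g k))"
    unfolding w(1) by (rule abs_series_Vertex[OF f w(2)])
  also have "\<dots> \<le> (\<Sum>k\<in>{K - N..<int M}. ?g k) + (nsum {M..} (\<lambda>m. ?g (int m)))"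
    by (rule nn_integral_count_space_int_split) (rule low)
  also have "\<dots> \<le> (\<Sum>k\<in>{K - N..<int M}. ?g k) + (\<Sum>(c, C)\<leftarrow>T. c * abs_series V C f v)"
    using T'[rule_format, OF f] by (intro add_left_mono) (simp add: tail_series_def)
  also have "\<dots> < top" using T_fin fin by simp
  finally show ?case .
qed

section \<open>From homogeneous vertex operators to arbitrary words\<close>

lemma abs_series_vertex_add:
  assumes "f \<in> restricted_dual V"
  shows "abs_series V (w @ Vertex (A + B) s # w') f v \<le>
    abs_series V (w @ Vertex A s # w') f v + abs_series V (w @ Vertex B s # w') f v"
  using assms
proof (induction w arbitrary: f)
  case Nil
  note lin = restricted_dual_linear[OF Nil]
  have "abs_series V (Vertex (A + B) s # w') f v \<le>
    (nsum UNIV (\<lambda>k. abs_series V w' (\<lambda>u. f (letter_term V (Vertex A s) k u)) v +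
           abs_series V w' (\<lambda>u. f (letter_term V (Vertex B s) k u)) v))"
    by (simp, intro nn_integral_mono abs_series_le_add)
      (simp add: md_left lin norm_mult distrib_left[symmetric] norm_triangle_ineq mult_left_mono)
  then show ?case by (simp add: nn_integral_add)
next
  case (Cons l w)
  have "abs_series V ((l # w) @ Vertex (A + B) s # w') f v \<le>
    (nsum (letter_modes l) (\<lambda>k. abs_series V (w @ Vertex A s # w') (\<lambda>u. f (letter_term V l k u)) v +
           abs_series V (w @ Vertex B s # w') (\<lambda>u. f (letter_term V l k u)) v))"
    by (simp, intro nn_integral_mono Cons.IH restricted_dual_letter Cons.prems)
  then show ?case by (simp add: nn_integral_add)
qed

lemma abs_series_right_add:
  assumes "f \<in> restricted_dual V"
  shows "abs_series V w f (u + v) \<le> abs_series V w f u + abs_series V w f v"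
  using assms
proof (induction w arbitrary: f)
  case Nil
  then show ?case
    by (simp add: restricted_dual_linear[OF Nil] norm_triangle_ineq flip: ennreal_plus)
next
  case (Cons l w)
  have "abs_series V (l # w) f (u + v) \<le>
    (nsum (letter_modes l) (\<lambda>k. abs_series V w (\<lambda>u. f (letter_term V l k u)) u +
           abs_series V w (\<lambda>u. f (letter_term V l k u)) v))"
    by (simp, intro nn_integral_mono Cons.IH restricted_dual_letter Cons.prems)
  then show ?case by (simp add: nn_integral_add)
qed

definition vertex_word :: "'v letter list \<Rightarrow> bool" where
  "vertex_word w \<longleftrightarrow> (\<forall>l\<in>set w. \<exists>A s. l = Vertex A s \<and> s > 0)"

text \<open>Homogeneity is removed one letter at a time: w1 is the part still homogeneous, w2 the
  part with arbitrary letters. Decomposing the first letter of w2, and finally v, is harmless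
  because the series is subadditive in each.\<close>

lemma abs_series_vertex_finite:
  assumes "vertex_word w" "sorted_wrt (>) (word_args w)" "f \<in> restricted_dual V"
  shows "abs_series V w f v < top"
proof -
  have "abs_series V (w1 @ w2) f v < top"
    if "hom_word w1" "vertex_word w2" "sorted_wrt (>) (word_args (w1 @ w2))" for w1 w2
    using that
  proof (induction w2 arbitrary: w1)
    case Nil
    show ?case
    proof (induction v rule: homogeneous_induct)
      case (homogeneous i \<mu> A)
      from abs_series_hom_finite[OF _ _ this assms(3)] Nil show ?case by simp
    next
      case (add A B)
      then have "abs_series V w1 f A + abs_series V w1 f B < top" by simp
      with abs_series_right_add[OF assms(3), of w1 A B] show ?case by (auto simp: less_le_trans le_less_trans)
    qed
  next
    case (Cons l w2)
    then obtain A s where l: "l = Vertex A s" "s > 0" by (auto simp: vertex_word_def)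
    have args: "word_args (w1 @ Vertex A s # w2) = word_args (w1 @ Vertex B s # w2)" for A B and w1 w2 :: "'v letter list"
    proof (induction w1)
      case (Cons l w1)
      then show ?case by (cases l) auto
    qed simp
    have "abs_series V (w1 @ Vertex A s # w2) f v < top"
    proof (induction A rule: homogeneous_induct)
      case (homogeneous i \<mu> A')
      have "abs_series V ((w1 @ [Vertex A' s]) @ w2) f v < top"
      proof (rule Cons.IH)
        show "hom_word (w1 @ [Vertex A' s])" using Cons.prems l homogeneous by auto
        show "vertex_word w2" using Cons.prems by (simp add: vertex_word_def)
        show "sorted_wrt (>) (word_args ((w1 @ [Vertex A' s]) @ w2))"
          using Cons.prems(3) by (simp add: l args[of w1 A' w2 A])
      qed
      then show ?case by simp
    next
      case (add A B)
      then have "abs_series V (w1 @ Vertex A s # w2) f v + abs_series V (w1 @ Vertex B s # w2) f v < top" by simp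
      then show ?case by (rule le_less_trans[OF abs_series_vertex_add[OF assms(3)]])
    qed
    then show ?case by (simp add: l)
  qed
  from this[of "[]" w] assms show ?thesis by simp
qed

lemma abs_series_Mode_bound:
  assumes "f \<in> restricted_dual V" "s > 0"
  shows "abs_series V (Mode A n # w) f v \<le> ennreal (s powi (n + 1)) * abs_series V (Vertex A s # w) f v"
proof -
  let ?g = "\<lambda>k. ennreal (s powi (- k - 1)) * abs_series V w (\<lambda>u. f (md V A k u)) v"
  have "?g n \<le> (nsum UNIV (\<lambda>k. ?g k))"
    by (rule nn_integral_ge_point) simp
  also have "\<dots> = abs_series V (Vertex A s # w) f v"
    by (rule abs_series_Vertex[OF assms, symmetric])
  finally have "ennreal (s powi (n + 1)) * ?g n \<le> ennreal (s powi (n + 1)) * abs_series V (Vertex A s # w) f v"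
    by (rule mult_left_mono) simp
  moreover have "s powi (n + 1) * s powi (- n - 1) = 1"
    using assms(2) by (simp flip: power_int_add)
  then have "ennreal (s powi (n + 1)) * ?g n = abs_series V (Mode A n # w) f v"
    using assms(2) by (simp add: nn_integral_count_space_finite flip: ennreal_mult mult.assoc)
  ultimately show ?thesis by simp
qed

text \<open>
  A single mode is, up to a constant, one summand of the vertex operator at any argument between
  those of its neighbours.
\<close>

lemma abs_series_le_vertex_word:
  assumes "sorted_wrt (>) (word_args w)" "\<And>t. t \<in> set (word_args w) \<Longrightarrow> 0 < t \<and> t < U" "U > 0"
  shows "\<exists>c w'. c < top \<and> vertex_word w' \<and> sorted_wrt (>) (word_args w') \<and> (\<forall>t\<in>set (word_args w'). t < U) \<and>
    (\<forall>f\<in>restricted_dual V. abs_series V w f v \<le> c * abs_series V w' f v)"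
  using assms
proof (induction w arbitrary: U)
  case Nil
  then show ?case by (intro exI[of _ 1] exI[of _ "[]"]) (auto simp: vertex_word_def)
next
  case (Cons l w)
  \<comment> \<open>U bounds all arguments strictly and so leaves room for modes further left. A
    vertex operator passes on its own argument; a mode is given the midpoint between U and the
    largest argument to its right (or 0).\<close>
  have "\<exists>U'. 0 < U' \<and> U' < U \<and> (\<forall>t\<in>set (word_args w). t < U') \<and> (\<forall>A s. l = Vertex A s \<longrightarrow> U' = s)"
  proof (cases l)
    case (Vertex A s)
    with Cons.prems show ?thesis by (intro exI[of _ s]) auto
  next
    case (Mode A n)
    define m where "m = Max (insert 0 (set (word_args w)))"
    have "m \<in> insert 0 (set (word_args w))" unfolding m_def by (rule Max_in) auto
    then have "m < U" using Cons.prems Mode by auto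
    moreover have "0 \<le> m" "\<And>t. t \<in> set (word_args w) \<Longrightarrow> t \<le> m" by (auto simp: m_def)
    ultimately show ?thesis using Mode by (intro exI[of _ "(m + U) / 2"]) force
  qed
  then obtain s where s: "0 < s" "s < U" "\<forall>t\<in>set (word_args w). t < s" "\<And>A t. l = Vertex A t \<Longrightarrow> s = t" by blast
  have "sorted_wrt (>) (word_args w)" "\<And>t. t \<in> set (word_args w) \<Longrightarrow> 0 < t \<and> t < s"
    using Cons.prems s(3) by (cases l; auto)+
  from Cons.IH[OF this s(1)] obtain c w' where c: "c < top" "vertex_word w'" "sorted_wrt (>) (word_args w')"
    "\<forall>t\<in>set (word_args w'). t < s" and le: "\<And>f. f \<in> restricted_dual V \<Longrightarrow> abs_series V w f v \<le> c * abs_series V w' f v" by blast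
  obtain A where A: "l = Vertex A s \<or> (\<exists>n. l = Mode A n)" using s(4) by (cases l) auto
  have Vle: "abs_series V (Vertex A s # w) f v \<le> c * abs_series V (Vertex A s # w') f v" if "f \<in> restricted_dual V" for f
    by (simp add: nn_integral_cmult[symmetric], intro nn_integral_mono le)
      (use restricted_dual_letter[OF that, of "Vertex A s"] in simp)
  obtain c' where c': "c' < top" "\<And>f. f \<in> restricted_dual V \<Longrightarrow> abs_series V (l # w) f v \<le> c' * abs_series V (Vertex A s # w) f v"
  proof (cases "l = Vertex A s")
    case True
    then show ?thesis by (intro that[of 1]) auto
  next
    case False
    with A obtain n where "l = Mode A n" by auto
    then show ?thesis using abs_series_Mode_bound[OF _ s(1)] by (intro that[of "ennreal (s powi (n + 1))"]) auto
  qed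
  show ?case
  proof (intro exI[of _ "c' * c"] exI[of _ "Vertex A s # w'"] conjI ballI)
    fix f assume f: "f \<in> restricted_dual V"
    from c'(2)[OF f] have "abs_series V (l # w) f v \<le> c' * abs_series V (Vertex A s # w) f v" .
    also have "\<dots> \<le> c' * (c * abs_series V (Vertex A s # w') f v)"
      by (intro mult_left_mono Vle f) simp
    finally show "abs_series V (l # w) f v \<le> c' * c * abs_series V (Vertex A s # w') f v"
      by (simp only: mult.assoc)
  qed (use c c' s in \<open>auto simp: vertex_word_def ennreal_mult_less_top\<close>)
qed

definition good_args :: "real list \<Rightarrow> bool" where
  "good_args ts \<longleftrightarrow> sorted_wrt (>) ts \<and> (\<forall>t\<in>set ts. t > 0)"

lemma abs_series_finite:
  assumes "good_args (word_args w)" "f \<in> restricted_dual V"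
  shows "abs_series V w f v < top"
proof -
  define U where "U = Max (insert 0 (set (word_args w))) + 1"
  have U: "t < U" if "t \<in> insert 0 (set (word_args w))" for t
  proof -
    have "t \<le> Max (insert 0 (set (word_args w)))" by (rule Max_ge) (use that in auto)
    then show ?thesis unfolding U_def by linarith
  qed
  then have U0: "U > 0" by simp
  obtain c w' where c: "c < top" "vertex_word w'" "sorted_wrt (>) (word_args w')"
    "\<forall>f\<in>restricted_dual V. abs_series V w f v \<le> c * abs_series V w' f v"
    using abs_series_le_vertex_word[OF _ _ U0, of w v] assms(1) U unfolding good_args_def by blast
  have "c * abs_series V w' f v < top"
    using abs_series_vertex_finite[OF c(2,3) assms(2)] c(1) by (simp add: ennreal_mult_less_top)
  with c(4) assms(2) show ?thesis by (auto intro: le_less_trans)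
qed

end

section \<open>Values of matrix elements\<close>

context vertex_operator_superalgebra
begin

definition word_modes :: "'v letter list \<Rightarrow> int list set" where
  "word_modes w = listset (map letter_modes w)"

lemma word_modes_simps [simp]:
  "word_modes [] = {[]}" "word_modes (l # w) = (\<lambda>(k, ks). k # ks) ` (letter_modes l \<times> word_modes w)"
  by (auto simp: word_modes_def set_Cons_def)

text \<open>The link from the iterated sum to unconditional convergence over lists of modes: a
  finite set of lists is contained in the product of its heads and its tails.\<close>

lemma sum_le_abs_series:
  assumes "finite F" "F \<subseteq> word_modes w"
  shows "(\<Sum>ks\<in>F. ennreal (norm (f (word_term V w ks v)))) \<le> abs_series V w f v"
  using assms
proof (induction w arbitrary: f F)
  case Nil
  then have "F = {} \<or> F = {[]}" by auto
  then show ?case by auto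
next
  case (Cons l w)
  define H where "H = hd ` F"
  define T where "T = tl ` F"
  have H: "finite H" "H \<subseteq> letter_modes l" and T: "finite T" "T \<subseteq> word_modes w"
    using Cons.prems by (auto simp: H_def T_def)
  have "F \<subseteq> (\<lambda>(k, ks). k # ks) ` (H \<times> T)"
  proof
    fix ks assume ks: "ks \<in> F"
    then have "ks \<noteq> []" using Cons.prems by auto
    then have "ks = (\<lambda>(k, ks). k # ks) (hd ks, tl ks)" by simp
    moreover have "(hd ks, tl ks) \<in> H \<times> T" using ks by (auto simp: H_def T_def)
    ultimately show "ks \<in> (\<lambda>(k, ks). k # ks) ` (H \<times> T)" by (rule image_eqI)
  qed
  then have "(\<Sum>ks\<in>F. ennreal (norm (f (word_term V (l # w) ks v)))) \<le>
    (\<Sum>ks\<in>(\<lambda>(k, ks). k # ks) ` (H \<times> T). ennreal (norm (f (word_term V (l # w) ks v))))"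
    by (intro sum_mono2) (use H T in auto)
  also have "\<dots> = (\<Sum>k\<in>H. \<Sum>ks\<in>T. ennreal (norm (f (letter_term V l k (word_term V w ks v)))))"
    by (subst sum.reindex) (auto simp: inj_on_def sum.cartesian_product case_prod_unfold simp del: sum_ennreal)
  also have "\<dots> \<le> (\<Sum>k\<in>H. abs_series V w (\<lambda>u. f (letter_term V l k u)) v)"
    by (intro sum_mono Cons.IH T)
  also have "\<dots> = (nsum UNIV (\<lambda>k. abs_series V w (\<lambda>u. f (letter_term V l k u)) v * indicator H k))"
    using H by (simp add: nn_integral_count_space_finite flip: nn_integral_count_space_indicator)
  also have "\<dots> \<le> (nsum UNIV (\<lambda>k. abs_series V w (\<lambda>u. f (letter_term V l k u)) v * indicator (letter_modes l) k))"
    by (intro nn_integral_mono) (use H in \<open>auto simp: indicator_def\<close>)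
  also have "\<dots> = abs_series V (l # w) f v"
    by (simp flip: nn_integral_count_space_indicator)
  finally show ?case .
qed

lemma word_summable:
  assumes "good_args (word_args w)" "f \<in> restricted_dual V"
  shows "(\<lambda>ks. f (word_term V w ks v)) summable_on word_modes w"
proof -
  have fin: "abs_series V w f v < top" by (rule abs_series_finite[OF assms])
  have "(\<lambda>ks. norm (f (word_term V w ks v))) summable_on word_modes w"
  proof (rule nonneg_bdd_above_summable_on)
    show "bdd_above (sum (\<lambda>ks. norm (f (word_term V w ks v))) ` {F. F \<subseteq> word_modes w \<and> finite F})"
    proof (rule bdd_aboveI2)
      fix F assume "F \<in> {F. F \<subseteq> word_modes w \<and> finite F}"
      then have "ennreal (\<Sum>ks\<in>F. norm (f (word_term V w ks v))) \<le> abs_series V w f v"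
        using sum_le_abs_series[of F w f v] by simp
      then show "(\<Sum>ks\<in>F. norm (f (word_term V w ks v))) \<le> enn2real (abs_series V w f v)"
        using fin enn2real_mono[of "ennreal (\<Sum>ks\<in>F. norm (f (word_term V w ks v)))" "abs_series V w f v"]
        by (simp add: sum_nonneg)
    qed
  qed auto
  then show ?thesis by (rule abs_summable_summable)
qed

text \<open>Total companion of \<open>word_mel\<close>: \<open>infsum\<close> defaults to 0 where
  the sum does not converge, so identities can be stated without options, and
  \<open>word_mel_eq\<close> tells where the two agree.\<close>

definition mel :: "('v \<Rightarrow> complex) \<Rightarrow> 'v letter list \<Rightarrow> 'v \<Rightarrow> complex" where
  "mel f w v = infsum (\<lambda>ks. f (word_term V w ks v)) (word_modes w)"

lemma word_mel_eq:
  assumes "f \<in> restricted_dual V"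
  shows "word_mel V f v w = (if good_args (word_args w) then Some (mel f w v) else None)"
  using word_summable[OF _ assms, of w v]
  by (auto simp: word_mel_def good_args_def mel_def word_modes_def Let_def)

lemma mel_Nil [simp]: "mel f [] v = f v"
  by (simp add: mel_def)

lemma good_args_simps [simp]:
  "good_args []" "good_args (t # ts) \<longleftrightarrow> t > 0 \<and> (\<forall>s\<in>set ts. s < t) \<and> good_args ts"
  by (auto simp: good_args_def)

lemma good_args_Cons: "good_args (word_args (l # w)) \<Longrightarrow> good_args (word_args w)"
  by (cases l) auto

text \<open>Unconditional convergence allows summing the inner modes first. This is how a letter is
  stripped from the left at the level of values.\<close>

lemma mel_Cons:
  assumes "good_args (word_args (l # w))" "f \<in> restricted_dual V"
  shows "((\<lambda>k. mel (\<lambda>u. f (letter_term V l k u)) w v) has_sum mel f (l # w) v) (letter_modes l)"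
proof -
  have inj: "inj_on (\<lambda>(k, ks). k # ks) (letter_modes l \<times> word_modes w)" by (auto simp: inj_on_def)
  have "(\<lambda>ks. f (word_term V (l # w) ks v)) summable_on (\<lambda>(k, ks). k # ks) ` (letter_modes l \<times> word_modes w)"
    using word_summable[OF assms, of v] by simp
  then have "(\<lambda>(k, ks). f (letter_term V l k (word_term V w ks v))) summable_on letter_modes l \<times> word_modes w"
    by (subst (asm) summable_on_reindex[OF inj]) (simp add: o_def case_prod_unfold)
  moreover have "mel f (l # w) v = (\<Sum>\<^sub>\<infinity>(k, ks)\<in>letter_modes l \<times> word_modes w. f (letter_term V l k (word_term V w ks v)))"
    unfolding mel_def word_modes_simps infsum_reindex[OF inj] by (simp add: o_def case_prod_unfold)
  ultimately show ?thesis
    using summable_on_Sigma_banach[of "\<lambda>k ks. f (letter_term V l k (word_term V w ks v))"]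
      infsum_Sigma'_banach[of "\<lambda>k ks. f (letter_term V l k (word_term V w ks v))"]
    by (auto simp: has_sum_iff mel_def)
qed

lemma mel_Mode: "mel f (Mode A n # w) v = mel (\<lambda>u. f (md V A n u)) w v"
proof -
  have inj: "inj_on (\<lambda>(k, ks). k # ks) ({n} \<times> word_modes w)" by (auto simp: inj_on_def)
  have [simp]: "inj_on (Pair n) X" for X :: "int list set" by (auto simp: inj_on_def)
  have "{n} \<times> word_modes w = Pair n ` word_modes w" by auto
  then have "mel f (Mode A n # w) v = (\<Sum>\<^sub>\<infinity>(k, ks)\<in>Pair n ` word_modes w. f (letter_term V (Mode A n) k (word_term V w ks v)))"
    unfolding mel_def word_modes_simps letter_modes.simps infsum_reindex[OF inj] by (simp add: o_def case_prod_unfold)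
  then show ?thesis by (simp add: infsum_reindex o_def mel_def)
qed

lemma mel_lincomb:
  assumes "good_args (word_args w)" "g \<in> restricted_dual V" "h \<in> restricted_dual V"
    "\<And>u. f u = c * g u + d * h u"
  shows "mel f w v = c * mel g w v + d * mel h w v"
  using word_summable[OF assms(1,2), of v] word_summable[OF assms(1,3), of v]
  by (simp add: mel_def assms(4) infsum_add summable_on_cmult_right infsum_cmult_right)

text \<open>A linear relation that holds for every functional survives putting letters in front,
  since these can be absorbed into the functional. The three vectors may differ, so that relations
  moving a mode onto v are included.\<close>

lemma mel_prefix:
  assumes "\<And>f. f \<in> restricted_dual V \<Longrightarrow> mel f u1 v1 = c2 * mel f u2 v2 + c3 * mel f u3 v3"
    and "good_args (word_args (l @ u1))" "good_args (word_args (l @ u2))" "good_args (word_args (l @ u3))"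
    and "f \<in> restricted_dual V"
  shows "mel f (l @ u1) v1 = c2 * mel f (l @ u2) v2 + c3 * mel f (l @ u3) v3"
  using assms(2-5)
proof (induction l arbitrary: f)
  case Nil
  then show ?case using assms(1) by simp
next
  case (Cons l ls)
  have good: "good_args (word_args (ls @ u1))" "good_args (word_args (ls @ u2))" "good_args (word_args (ls @ u3))"
    using Cons.prems good_args_Cons by auto
  have "((\<lambda>k. mel (\<lambda>u. f (letter_term V l k u)) (ls @ u1) v1) has_sum
    (c2 * mel f (l # ls @ u2) v2 + c3 * mel f (l # ls @ u3) v3)) (letter_modes l)"
    unfolding Cons.IH[OF good restricted_dual_letter[OF Cons.prems(4)]]
    by (intro has_sum_add has_sum_cmult_right mel_Cons) (use Cons.prems in auto)
  moreover have "((\<lambda>k. mel (\<lambda>u. f (letter_term V l k u)) (ls @ u1) v1) has_sum mel f (l # ls @ u1) v1) (letter_modes l)"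
    by (intro mel_Cons) (use Cons.prems in auto)
  ultimately show ?case by (simp add: has_sum_unique)
qed

text \<open>The superderivation property of A_0 keeps the index of each mode of B, so it can be
  applied term by term in the sum over these modes.\<close>

lemma mel_zero_mode_head:
  assumes A: "A \<in> gr V i \<mu>" and B: "B \<in> fermionic_space V \<nu>"
    and good: "good_args (s # word_args w)" and f: "f \<in> restricted_dual V"
  shows "mel f (Mode A 0 # Vertex B s # w) v =
    sg (\<mu> * \<nu>) * mel f (Vertex B s # Mode A 0 # w) v + 1 * mel f (Vertex (md V A 0 B) s # w) v"
proof -
  note lin = restricted_dual_linear[OF f]
  let ?l = "\<lambda>B k u. letter_term V (Vertex B s) k u"
  have "mel (\<lambda>u. f (md V A 0 (?l B k u))) w v =
    sg (\<mu> * \<nu>) * mel (\<lambda>u. f (?l B k (md V A 0 u))) w v + 1 * mel (\<lambda>u. f (?l (md V A 0 B) k u)) w v" for k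
  proof (rule mel_lincomb)
    show "(\<lambda>u. f (?l B k (md V A 0 u))) \<in> restricted_dual V"
      using restricted_dual_letter[OF restricted_dual_letter[OF f], of "Vertex B s" k "Mode A 0" 0] by simp
    show "(\<lambda>u. f (?l (md V A 0 B) k u)) \<in> restricted_dual V"
      by (rule restricted_dual_letter[OF f])
  qed (use good in \<open>auto simp: lin md_right zero_mode_commutator[OF A B] algebra_simps\<close>)
  then have "((\<lambda>k. mel (\<lambda>u. f (md V A 0 (?l B k u))) w v) has_sum
    (sg (\<mu> * \<nu>) * mel f (Vertex B s # Mode A 0 # w) v + 1 * mel f (Vertex (md V A 0 B) s # w) v)) UNIV"
    using mel_Cons[of "Vertex B s" "Mode A 0 # w" f v] mel_Cons[of "Vertex (md V A 0 B) s" w f v] good f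
    by (auto simp: mel_Mode intro!: has_sum_add has_sum_cmult_right)
  moreover have "((\<lambda>k. mel (\<lambda>u. f (md V A 0 (?l B k u))) w v) has_sum mel f (Mode A 0 # Vertex B s # w) v) UNIV"
    unfolding mel_Mode using mel_Cons[of "Vertex B s" w "\<lambda>u. f (md V A 0 u)" v] good restricted_dual_md[OF f]
    by simp
  ultimately show ?thesis by (simp add: has_sum_unique)
qed

lemma mel_vertex_lincomb_head:
  assumes good: "good_args (s # word_args w)" and f: "f \<in> restricted_dual V"
  shows "mel f (Vertex (scl V a A + scl V b B) s # w) v = a * mel f (Vertex A s # w) v + b * mel f (Vertex B s # w) v"
proof -
  note lin = restricted_dual_linear[OF f]
  let ?l = "\<lambda>B k u. letter_term V (Vertex B s) k u"
  have "mel (\<lambda>u. f (?l (scl V a A + scl V b B) k u)) w v =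
    a * mel (\<lambda>u. f (?l A k u)) w v + b * mel (\<lambda>u. f (?l B k u)) w v" for k
    by (rule mel_lincomb) (use good in \<open>auto simp: restricted_dual_letter[OF f] lin md_left algebra_simps
        simp del: letter_term.simps, auto simp: lin md_left algebra_simps\<close>)
  then have "((\<lambda>k. mel (\<lambda>u. f (?l (scl V a A + scl V b B) k u)) w v) has_sum
    (a * mel f (Vertex A s # w) v + b * mel f (Vertex B s # w) v)) UNIV"
    using mel_Cons[of "Vertex A s" w f v] mel_Cons[of "Vertex B s" w f v] good f
    by (auto intro!: has_sum_add has_sum_cmult_right)
  moreover have "((\<lambda>k. mel (\<lambda>u. f (?l (scl V a A + scl V b B) k u)) w v) has_sum mel f (Vertex (scl V a A + scl V b B) s # w) v) UNIV"
    using mel_Cons[of "Vertex (scl V a A + scl V b B) s" w f v] good f by simp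
  ultimately show ?thesis by (simp add: has_sum_unique)
qed

lemma word_args_append [simp]: "word_args (w @ w') = word_args w @ word_args w'"
  by (induction w rule: word_args.induct) auto

lemma good_args_append: "good_args (ts @ ts') \<Longrightarrow> good_args ts'"
  by (induction ts) auto

lemma mel_zero_mode:
  assumes A: "A \<in> gr V i \<mu>" and B: "B \<in> fermionic_space V \<nu>"
    and good: "good_args (word_args w @ s # word_args w')" and f: "f \<in> restricted_dual V"
  shows "mel f (w @ Mode A 0 # Vertex B s # w') v =
    sg (\<mu> * \<nu>) * mel f (w @ Vertex B s # Mode A 0 # w') v + mel f (w @ Vertex (md V A 0 B) s # w') v"
proof -
  have "mel f (w @ Mode A 0 # Vertex B s # w') v =
    sg (\<mu> * \<nu>) * mel f (w @ Vertex B s # Mode A 0 # w') v + 1 * mel f (w @ Vertex (md V A 0 B) s # w') v"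
    by (rule mel_prefix[OF mel_zero_mode_head[OF A B good_args_append[OF good]]]) (use good f in auto)
  then show ?thesis by simp
qed

lemma mel_vertex_lincomb:
  assumes good: "good_args (word_args w @ s # word_args w')" and f: "f \<in> restricted_dual V"
  shows "mel f (w @ Vertex (scl V a A + scl V b B) s # w') v =
    a * mel f (w @ Vertex A s # w') v + b * mel f (w @ Vertex B s # w') v"
  by (rule mel_prefix[OF mel_vertex_lincomb_head[OF good_args_append[OF good]]]) (use good f in auto)

lemma mel_vertex_0:
  assumes good: "good_args (word_args w @ s # word_args w')" and f: "f \<in> restricted_dual V"
  shows "mel f (w @ Vertex 0 s # w') v = 0"
  using mel_vertex_lincomb[OF assms, of 0 0 0 0 v] by simp

lemma mel_Mode_last:
  assumes good: "good_args (word_args w)" and f: "f \<in> restricted_dual V"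
  shows "mel f (w @ [Mode A n]) v = mel f w (md V A n v)"
proof -
  have "mel f (w @ [Mode A n]) v = 1 * mel f (w @ []) (md V A n v) + 0 * mel f (w @ []) v"
    by (rule mel_prefix) (use good f in \<open>auto simp: mel_Mode\<close>)
  then show ?thesis by simp
qed

text \<open>L_{-1} is the zero mode of the even Virasoro element, hence a derivation; the derivative
  axiom evaluates it on B.\<close>

lemma translation_commutator:
  assumes B: "B \<in> gr V j \<nu>"
  shows "Lmode V (-1) (md V B n C) = md V B n (Lmode V (-1) C) - scl V (of_int n) (md V B (n - 1) C)"
proof -
  from B have "B \<in> fermionic_space V \<nu>"
    unfolding fermionic_space_def by (intro vs.span_base) auto
  from zero_mode_commutator[OF L_graded this, of n C] L_derivative[of B n C]
  show ?thesis by (simp add: Lmode_def sg_def)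
qed

end

context topological_voa
begin

text \<open>Apply \<open>ad L\<^sub>-\<^sub>1\<close> twice to \<open>b\<^sub>0\<^sup>2 = 0\<close>, using \<open>[L\<^sub>-\<^sub>1, b\<^sub>0] = - b\<^sub>-\<^sub>1\<close> and \<open>[L\<^sub>-\<^sub>1, b\<^sub>-\<^sub>1] = 0\<close>.\<close>

lemma b_minus_one_square: "bmode V (-1) (bmode V (-1) v) = 0"
proof -
  let ?T = "Lmode V (-1)"
  have b1: "bmode V 0 u = md V (elb V) 1 u" for u by (simp add: bmode_def)
  have T1: "?T (bmode V 0 u) = bmode V 0 (?T u) - bmode V (-1) u" for u
    using translation_commutator[OF b_graded, of 1 u] by (simp add: bmode_def)
  have T0: "?T (bmode V (-1) u) = bmode V (-1) (?T u)" for u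
    using translation_commutator[OF b_graded, of 0 u] by (simp add: bmode_def)
  have T_add: "?T (x + y) = ?T x + ?T y" "?T (0::'v) = 0" for x y by (auto simp: Lmode_def md_right)
  have b_diff: "bmode V n (x - y) = bmode V n x - bmode V n y" for n x y by (simp add: bmode_def md_right)
  have anti: "bmode V 0 (bmode V (-1) u) + bmode V (-1) (bmode V 0 u) = 0" for u
  proof -
    have "0 = ?T (bmode V 0 (bmode V 0 u))" by (simp add: b0_square T_add)
    also have "\<dots> = bmode V 0 (bmode V 0 (?T u)) - bmode V 0 (bmode V (-1) u) - bmode V (-1) (bmode V 0 u)"
      by (simp add: T1 b_diff)
    finally show ?thesis by (simp add: b0_square algebra_simps)
  qed
  have "0 = ?T (bmode V 0 (bmode V (-1) v) + bmode V (-1) (bmode V 0 v))" by (simp add: anti T_add)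
  also have "\<dots> = (bmode V 0 (bmode V (-1) (?T v)) + bmode V (-1) (bmode V 0 (?T v)))
      - (bmode V (-1) (bmode V (-1) v) + bmode V (-1) (bmode V (-1) v))"
    by (simp add: T_add T1 T0 b_diff algebra_simps)
  finally have "bmode V (-1) (bmode V (-1) v) + bmode V (-1) (bmode V (-1) v) = 0"
    unfolding anti by (metis diff_0 neg_equal_0_iff_equal)
  then have "scl V 2 (bmode V (-1) (bmode V (-1) v)) = 0"
    using vs.scale_left_distrib[of 1 1] by simp
  then show ?thesis by (simp add: vs.scale_eq_0_iff)
qed

end

section \<open>Laurent series in three variables\<close>

text \<open>Termwise differentiation for unordered sums. The derivatives converge uniformly by the
  M-test, so the fundamental theorem for finite partial sums passes to the limit; the sum is then an
  integral of a continuous function.\<close>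

lemma has_vector_derivative_infsum:
  fixes g g' :: "'k \<Rightarrow> real \<Rightarrow> complex"
  assumes der: "\<And>k r. r \<in> {a..b} \<Longrightarrow> (g k has_vector_derivative g' k r) (at r within {a..b})"
    and cont: "\<And>k. continuous_on {a..b} (g' k)"
    and bound: "\<And>k r. r \<in> {a..b} \<Longrightarrow> norm (g' k r) \<le> M k" "M summable_on UNIV"
    and summ: "\<And>r. r \<in> {a..b} \<Longrightarrow> (\<lambda>k. g k r) summable_on UNIV"
    and r: "r \<in> {a<..<b}"
  shows "((\<lambda>r. \<Sum>\<^sub>\<infinity>k. g k r) has_vector_derivative (\<Sum>\<^sub>\<infinity>k. g' k r)) (at r)"
proof -
  let ?F = "finite_subsets_at_top (UNIV :: 'k set)"
  have unif: "uniform_limit {a..b} (\<lambda>X r. \<Sum>k\<in>X. g' k r) (\<lambda>r. \<Sum>\<^sub>\<infinity>k. g' k r) ?F"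
    by (rule Weierstrass_m_test_general[OF bound])
  have cont_sum: "continuous_on {a..b} (\<lambda>r. \<Sum>k\<in>X. g' k r)" for X
    by (intro continuous_intros cont)
  have cont_lim: "continuous_on {a..b} (\<lambda>r. \<Sum>\<^sub>\<infinity>k. g' k r)"
    by (rule uniform_limit_theorem[OF always_eventually unif]) (use cont_sum in auto)
  have eq: "(\<Sum>\<^sub>\<infinity>k. g k y) = (\<Sum>\<^sub>\<infinity>k. g k a) + integral {a..y} (\<lambda>r. \<Sum>\<^sub>\<infinity>k. g' k r)" if y: "y \<in> {a..b}" for y
  proof -
    have sub: "{a..y} \<subseteq> {a..b}" using y by auto
    obtain I J where I: "\<And>X. ((\<lambda>r. \<Sum>k\<in>X. g' k r) has_integral I X) {a..y}"
      and J: "((\<lambda>r. \<Sum>\<^sub>\<infinity>k. g' k r) has_integral J) {a..y}" "(I \<longlongrightarrow> J) ?F"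
      by (rule uniform_limit_integral[OF uniform_limit_on_subset[OF unif sub] continuous_on_subset[OF cont_sum sub]]) auto
    have "((\<lambda>r. \<Sum>k\<in>X. g' k r) has_integral ((\<Sum>k\<in>X. g k y) - (\<Sum>k\<in>X. g k a))) {a..y}" for X
    proof (rule fundamental_theorem_of_calculus)
      show "((\<lambda>r. \<Sum>k\<in>X. g k r) has_vector_derivative (\<Sum>k\<in>X. g' k x)) (at x within {a..y})" if "x \<in> {a..y}" for x
        using that sub by (intro has_vector_derivative_sum has_vector_derivative_within_subset[OF der _]) auto
    qed (use y in auto)
    then have I_eq: "I X = (\<Sum>k\<in>X. g k y) - (\<Sum>k\<in>X. g k a)" for X
      using I has_integral_unique by blast
    have "(I \<longlongrightarrow> (\<Sum>\<^sub>\<infinity>k. g k y) - (\<Sum>\<^sub>\<infinity>k. g k a)) ?F"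
      unfolding I_eq using summ[of y] summ[of a] y
      by (intro tendsto_diff) (auto simp flip: has_sum_def)
    with J(2) have "J = (\<Sum>\<^sub>\<infinity>k. g k y) - (\<Sum>\<^sub>\<infinity>k. g k a)"
      by (rule tendsto_unique[rotated]) simp
    with J(1) show ?thesis by (simp add: integral_unique)
  qed
  have "((\<lambda>y. (\<Sum>\<^sub>\<infinity>k. g k a) + integral {a..y} (\<lambda>r. \<Sum>\<^sub>\<infinity>k. g' k r)) has_vector_derivative
      0 + (\<Sum>\<^sub>\<infinity>k. g' k r)) (at r within {a..b})"
    by (intro has_vector_derivative_add has_vector_derivative_const integral_has_vector_derivative cont_lim) (use r in auto)
  then have "((\<lambda>y. (\<Sum>\<^sub>\<infinity>k. g k y)) has_vector_derivative (\<Sum>\<^sub>\<infinity>k. g' k r)) (at r within {a..b})"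
    using r by (intro has_vector_derivative_transform[OF _ eq]) auto
  moreover have "at r within {a..b} = at r"
    using r by (intro at_within_interior) (simp add: interior_atLeastAtMost_real)
  ultimately show ?thesis by simp
qed

lemma power_int_le_endpoints:
  fixes x :: real
  assumes "0 < l" "l \<le> x" "x \<le> u"
  shows "x powi n \<le> l powi n + u powi n"
proof (cases "n \<ge> 0")
  case True
  then have "x powi n \<le> u powi n" using assms by (intro power_int_mono) auto
  moreover have "l powi n \<ge> 0" using assms by simp
  ultimately show ?thesis by linarith
next
  case False
  have "x powi n = inverse (x powi (- n))" "l powi n = inverse (l powi (- n))"
    by (simp_all add: power_int_minus)
  moreover have "l powi (- n) \<le> x powi (- n)" using assms False by (intro power_int_mono) auto
  moreover have "0 < l powi (- n)" using assms by simp
  ultimately have "x powi n \<le> l powi n" by (simp add: le_imp_inverse_le)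
  moreover have "u powi n \<ge> 0" using assms by simp
  ultimately show ?thesis by linarith
qed

type_synonym real3 = "real \<times> real \<times> real"

text \<open>A series \<open>\<Sum>\<^sub>k a(k) x\<^bsup>d(k)\<^esup> y\<^bsup>e(k)\<^esup> z\<^bsup>f(k)\<^esup>\<close> is given by the tuple \<open>(a, d, e, f)\<close>.\<close>

type_synonym 'k laurent = "('k \<Rightarrow> complex) \<times> ('k \<Rightarrow> int) \<times> ('k \<Rightarrow> int) \<times> ('k \<Rightarrow> int)"

definition laurent_term ::
  "'k laurent \<Rightarrow> 'k \<Rightarrow> real3 \<Rightarrow> complex" where
  "laurent_term = (\<lambda>(a, d, e, f) k (x, y, z). a k * of_real (x powi d k * y powi e k * z powi f k))"

definition laurent_sum ::
  "'k laurent \<Rightarrow> real3 \<Rightarrow> complex" where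
  "laurent_sum S p = (\<Sum>\<^sub>\<infinity>k. laurent_term S k p)"

text \<open>
  A monomial is monotone in each variable, so convergence at the corners of a box gives a majorant
  for the Weierstrass test on the whole box.
\<close>

lemma laurent_box_bound:
  fixes S :: "'k laurent"
  assumes summ: "\<And>q. q \<in> {l1, u1} \<times> {l2, u2} \<times> {l3, u3} \<Longrightarrow> (\<lambda>k. laurent_term S k q) summable_on UNIV"
    and pos: "0 < l1" "0 < l2" "0 < l3"
  shows "\<exists>M. M summable_on UNIV \<and>
    (\<forall>k. \<forall>q\<in>{l1..u1} \<times> {l2..u2} \<times> {l3..u3}. norm (laurent_term S k q) \<le> M k)"
proof (cases "l1 \<le> u1 \<and> l2 \<le> u2 \<and> l3 \<le> u3")
  case True
  obtain a d e f where S: "S = (a, d, e, f)" by (cases S) auto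
  define N where "N k x y z = norm (laurent_term S k (x, y, z))" for k x y z
  \<comment> \<open>These are the eight corners of the box: for positive arguments, expanding the
    product of the three endpoint sums gives exactly these terms.\<close>
  define M where "M k = N k l1 l2 l3 + N k l1 l2 u3 + N k l1 u2 l3 + N k l1 u2 u3 +
    N k u1 l2 l3 + N k u1 l2 u3 + N k u1 u2 l3 + N k u1 u2 u3" for k
  have summ': "(\<lambda>k. N k x y z) summable_on UNIV" if "(x, y, z) \<in> {l1, u1} \<times> {l2, u2} \<times> {l3, u3}" for x y z
    using summ[OF that] by (simp add: N_def summable_on_iff_abs_summable_on_complex)
  have le: "norm (laurent_term S k (x, y, z)) \<le> M k"
    if q: "x \<in> {l1..u1}" "y \<in> {l2..u2}" "z \<in> {l3..u3}" for k x y z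
  proof -
    have N: "N k x y z = norm (a k) * (x powi d k * y powi e k * z powi f k)" if "x > 0" "y > 0" "z > 0" for x y z
      using that by (simp add: N_def S laurent_term_def norm_mult norm_power_int)
    have "x powi d k * y powi e k * z powi f k \<le>
      (l1 powi d k + u1 powi d k) * (l2 powi e k + u2 powi e k) * (l3 powi f k + u3 powi f k)"
      using q pos by (intro mult_mono power_int_le_endpoints mult_nonneg_nonneg add_nonneg_nonneg) auto
    then have "N k x y z \<le> norm (a k) *
      ((l1 powi d k + u1 powi d k) * (l2 powi e k + u2 powi e k) * (l3 powi f k + u3 powi f k))"
      using q pos by (subst N) (auto intro: mult_left_mono)
    also have "\<dots> = M k"
      using True pos by (simp add: M_def N algebra_simps)
    finally show ?thesis by (simp add: N_def)
  qed
  have "M summable_on UNIV"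
    unfolding M_def by (intro summable_on_add summ') auto
  with le show ?thesis by (intro exI[of _ M]) auto
next
  case False
  then show ?thesis by (intro exI[of _ "\<lambda>_. 0"]) auto
qed

lemma open_contains_box3:
  fixes R :: "real3 set"
  assumes "open R" "(x, y, z) \<in> R"
  shows "\<exists>e>0. {x - e..x + e} \<times> {y - e..y + e} \<times> {z - e..z + e} \<subseteq> R"
proof -
  obtain A BC where A: "open A" "open BC" "(x, y, z) \<in> A \<times> BC" "A \<times> BC \<subseteq> R"
    using assms by (rule open_prod_elim)
  then have "(y, z) \<in> BC" by simp
  with A(2) obtain B C where B: "open B" "open C" "(y, z) \<in> B \<times> C" "B \<times> C \<subseteq> BC"
    by (rule open_prod_elim)
  obtain e1 where e1: "e1 > 0" "cball x e1 \<subseteq> A" using A open_contains_cball by blast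
  obtain e2 where e2: "e2 > 0" "cball y e2 \<subseteq> B" using B open_contains_cball by blast
  obtain e3 where e3: "e3 > 0" "cball z e3 \<subseteq> C" using B open_contains_cball by blast
  note e = e1 e2 e3
  show ?thesis
  proof (intro exI[of _ "min e1 (min e2 e3)"] conjI)
    let ?e = "min e1 (min e2 e3)"
    have "?e \<le> e1" "?e \<le> e2" "?e \<le> e3" by auto
    then have "{x - ?e..x + ?e} \<times> {y - ?e..y + ?e} \<times> {z - ?e..z + ?e} \<subseteq>
      {x - e1..x + e1} \<times> {y - e2..y + e2} \<times> {z - e3..z + e3}"
      by (intro Sigma_mono) auto
    also have "\<dots> \<subseteq> R"
      using e A B by (auto simp: cball_eq_atLeastAtMost subset_iff)
    finally show "{x - ?e..x + ?e} \<times> {y - ?e..y + ?e} \<times> {z - ?e..z + ?e} \<subseteq> R" .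
  qed (use e in auto)
qed

lemma laurent_local_bound:
  fixes S :: "'k laurent"
  assumes R: "open R" "R \<subseteq> {(x, y, z). 0 < x \<and> 0 < y \<and> 0 < z}"
    and summ: "\<And>q. q \<in> R \<Longrightarrow> (\<lambda>k. laurent_term S k q) summable_on UNIV"
    and e: "e > 0" "{x - e..x + e} \<times> {y - e..y + e} \<times> {z - e..z + e} \<subseteq> R"
  shows "\<exists>M. M summable_on UNIV \<and>
    (\<forall>k. \<forall>q\<in>{x - e..x + e} \<times> {y - e..y + e} \<times> {z - e..z + e}. norm (laurent_term S k q) \<le> M k)"
proof (rule laurent_box_bound)
  have "(x - e, y - e, z - e) \<in> R" using e by auto
  with R(2) show "0 < x - e" "0 < y - e" "0 < z - e" by auto
next
  fix q assume "q \<in> {x - e, x + e} \<times> {y - e, y + e} \<times> {z - e, z + e}"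
  then have "q \<in> {x - e..x + e} \<times> {y - e..y + e} \<times> {z - e..z + e}"
    using e(1) by auto
  with e(2) show "(\<lambda>k. laurent_term S k q) summable_on UNIV" by (intro summ) blast
qed

lemma continuous_on_laurent_term:
  "continuous_on {(x, y, z). 0 < x \<and> 0 < y \<and> 0 < z} (laurent_term S k)"
  by (cases S) (auto simp: laurent_term_def case_prod_unfold intro!: continuous_intros)

lemma laurent_sum_continuous:
  fixes S :: "'k laurent"
  assumes R: "open R" "R \<subseteq> {(x, y, z). 0 < x \<and> 0 < y \<and> 0 < z}"
    and summ: "\<And>q. q \<in> R \<Longrightarrow> (\<lambda>k. laurent_term S k q) summable_on UNIV"
  shows "continuous_on R (laurent_sum S)"
  unfolding continuous_on_eq_continuous_at[OF R(1)]
proof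
  fix p assume "p \<in> R"
  obtain x y z where p: "p = (x, y, z)" by (cases p)
  obtain e where e: "e > 0" "{x - e..x + e} \<times> {y - e..y + e} \<times> {z - e..z + e} \<subseteq> R"
    using open_contains_box3[OF R(1)] \<open>p \<in> R\<close> p by blast
  let ?B = "{x - e..x + e} \<times> {y - e..y + e} \<times> {z - e..z + e}"
  obtain M where M: "M summable_on UNIV" "\<And>k q. q \<in> ?B \<Longrightarrow> norm (laurent_term S k q) \<le> M k"
    using laurent_local_bound[OF R summ e] by blast
  have "uniform_limit ?B (\<lambda>X q. \<Sum>k\<in>X. laurent_term S k q) (\<lambda>q. \<Sum>\<^sub>\<infinity>k. laurent_term S k q) (finite_subsets_at_top UNIV)"
    by (rule Weierstrass_m_test_general[OF M(2,1)])
  moreover have "continuous_on ?B (\<lambda>q. \<Sum>k\<in>X. laurent_term S k q)" for X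
    by (intro continuous_intros continuous_on_subset[OF continuous_on_laurent_term]) (use e R in blast)
  ultimately have "continuous_on ?B (laurent_sum S)"
    unfolding laurent_sum_def[abs_def] by (intro uniform_limit_theorem[OF always_eventually]) auto
  moreover have "p \<in> interior ?B"
    using e by (auto simp: p interior_Times)
  ultimately show "isCont (laurent_sum S) p"
    using continuous_on_interior by blast
qed

fun laurent_deriv :: "nat \<Rightarrow> 'k laurent \<Rightarrow>
    'k laurent" where
  "laurent_deriv i (a, d, e, f) =
    (if i = 1 then (\<lambda>k. of_int (d k) * a k, \<lambda>k. d k - 1, e, f)
     else if i = 2 then (\<lambda>k. of_int (e k) * a k, d, \<lambda>k. e k - 1, f)
     else (\<lambda>k. of_int (f k) * a k, d, e, \<lambda>k. f k - 1))"

lemma laurent_term_derivative: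
  assumes "0 < x + c1 * r" "0 < y + c2 * r" "0 < z + c3 * r"
  shows "((\<lambda>r. laurent_term S k (x + c1 * r, y + c2 * r, z + c3 * r)) has_vector_derivative
    (let p = (x + c1 * r, y + c2 * r, z + c3 * r) in
      of_real c1 * laurent_term (laurent_deriv 1 S) k p + of_real c2 * laurent_term (laurent_deriv 2 S) k p +
      of_real c3 * laurent_term (laurent_deriv 3 S) k p)) (at r within T)"
proof -
  obtain a d e f where S: "S = (a, d, e, f)" by (cases S) auto
  have pw: "((\<lambda>r. (x + c * r) powi n) has_real_derivative c * (of_int n * (x + c * r) powi (n - 1))) (at r within T)"
    if "0 < x + c * r" for x c n
    using that by (auto intro!: derivative_eq_intros simp: mult_ac)
  have "((\<lambda>r. (x + c1 * r) powi d k * (y + c2 * r) powi e k * (z + c3 * r) powi f k) has_real_derivative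
    (c1 * (of_int (d k) * (x + c1 * r) powi (d k - 1)) * (y + c2 * r) powi e k * (z + c3 * r) powi f k +
     c2 * (of_int (e k) * (x + c1 * r) powi d k * (y + c2 * r) powi (e k - 1)) * (z + c3 * r) powi f k +
     c3 * (of_int (f k) * (x + c1 * r) powi d k * (y + c2 * r) powi e k * (z + c3 * r) powi (f k - 1)))) (at r within T)"
    by (rule DERIV_cong[OF DERIV_mult[OF DERIV_mult[OF pw[OF assms(1)] pw[OF assms(2)]] pw[OF assms(3)]]]) (simp add: algebra_simps)
  from has_vector_derivative_mult_right[OF has_vector_derivative_of_real[OF this], of "a k"]
  show ?thesis
    by (simp add: S laurent_term_def Let_def algebra_simps)
qed

text \<open>Derivatives are taken along straight lines, which suffices because all faces and edges
  are affine. Summability of the derived series is assumed: for correlation functions these are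
  correlation functions again.\<close>

lemma laurent_sum_derivative:
  fixes S :: "'k laurent"
  assumes R: "open R" "R \<subseteq> {(x, y, z). 0 < x \<and> 0 < y \<and> 0 < z}"
    and summ: "\<And>q. q \<in> R \<Longrightarrow> (\<lambda>k. laurent_term S k q) summable_on UNIV"
    and summ': "\<And>i q. i \<in> {1, 2, 3} \<Longrightarrow> q \<in> R \<Longrightarrow> (\<lambda>k. laurent_term (laurent_deriv i S) k q) summable_on UNIV"
    and r: "(x + c1 * r, y + c2 * r, z + c3 * r) \<in> R"
  shows "((\<lambda>r. laurent_sum S (x + c1 * r, y + c2 * r, z + c3 * r)) has_vector_derivative
    (let p = (x + c1 * r, y + c2 * r, z + c3 * r) in
      of_real c1 * laurent_sum (laurent_deriv 1 S) p + of_real c2 * laurent_sum (laurent_deriv 2 S) p +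
      of_real c3 * laurent_sum (laurent_deriv 3 S) p)) (at r)"
proof -
  let ?p = "\<lambda>r. (x + c1 * r, y + c2 * r, z + c3 * r)"
  obtain e where e: "e > 0"
    "{x + c1 * r - e..x + c1 * r + e} \<times> {y + c2 * r - e..y + c2 * r + e} \<times> {z + c3 * r - e..z + c3 * r + e} \<subseteq> R"
    using open_contains_box3[OF R(1) r] by blast
  let ?B = "{x + c1 * r - e..x + c1 * r + e} \<times> {y + c2 * r - e..y + c2 * r + e} \<times> {z + c3 * r - e..z + c3 * r + e}"
  obtain M1 where M1: "M1 summable_on UNIV" "\<And>k q. q \<in> ?B \<Longrightarrow> norm (laurent_term (laurent_deriv 1 S) k q) \<le> M1 k"
    using laurent_local_bound[OF R summ'[of 1] e] by blast
  obtain M2 where M2: "M2 summable_on UNIV" "\<And>k q. q \<in> ?B \<Longrightarrow> norm (laurent_term (laurent_deriv 2 S) k q) \<le> M2 k"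
    using laurent_local_bound[OF R summ'[of 2] e] by blast
  obtain M3 where M3: "M3 summable_on UNIV" "\<And>k q. q \<in> ?B \<Longrightarrow> norm (laurent_term (laurent_deriv 3 S) k q) \<le> M3 k"
    using laurent_local_bound[OF R summ'[of 3] e] by blast
  \<comment> \<open>C bounds each speed, so the line stays in the box of half-width e as long as the
    parameter changes by at most e / C.\<close>
  define C where "C = 1 + \<bar>c1\<bar> + \<bar>c2\<bar> + \<bar>c3\<bar>"
  define \<delta> where "\<delta> = e / C"
  have C: "C > 0" by (simp add: C_def)
  have \<delta>: "\<delta> > 0" using e C by (simp add: \<delta>_def)
  have near: "c * s \<in> {c * r - e..c * r + e}" if "s \<in> {r - \<delta>..r + \<delta>}" "\<bar>c\<bar> \<le> C" for c s
  proof -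
    have "\<bar>c * (s - r)\<bar> \<le> C * \<delta>"
      unfolding abs_mult using that \<delta> C by (intro mult_mono) auto
    then show ?thesis using C by (simp add: \<delta>_def abs_le_iff algebra_simps)
  qed
  have pB: "?p s \<in> ?B" if "s \<in> {r - \<delta>..r + \<delta>}" for s
    using near[OF that, of c1] near[OF that, of c2] near[OF that, of c3] by (auto simp: C_def)
  have pR: "?p s \<in> R" if "s \<in> {r - \<delta>..r + \<delta>}" for s using pB[OF that] e by blast
  have pos: "0 < x + c1 * s" "0 < y + c2 * s" "0 < z + c3 * s" if "s \<in> {r - \<delta>..r + \<delta>}" for s
    using pR[OF that] R by auto
  let ?g' = "\<lambda>k s. of_real c1 * laurent_term (laurent_deriv 1 S) k (?p s) +
    of_real c2 * laurent_term (laurent_deriv 2 S) k (?p s) + of_real c3 * laurent_term (laurent_deriv 3 S) k (?p s)"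
  have "((\<lambda>s. \<Sum>\<^sub>\<infinity>k. laurent_term S k (?p s)) has_vector_derivative (\<Sum>\<^sub>\<infinity>k. ?g' k r)) (at r)"
  proof (rule has_vector_derivative_infsum[where a = "r - \<delta>" and b = "r + \<delta>" and M = "\<lambda>k. \<bar>c1\<bar> * M1 k + \<bar>c2\<bar> * M2 k + \<bar>c3\<bar> * M3 k"])
    show "((\<lambda>r. laurent_term S k (?p r)) has_vector_derivative ?g' k s) (at s within {r - \<delta>..r + \<delta>})"
      if "s \<in> {r - \<delta>..r + \<delta>}" for k s
      using laurent_term_derivative[OF pos[OF that], of S k] by (simp add: Let_def)
    have "continuous_on {r - \<delta>..r + \<delta>} (\<lambda>s. laurent_term S k (?p s))" for S :: "'k laurent" and k
      by (rule continuous_on_compose2[OF continuous_on_laurent_term]) (use pos in \<open>auto intro!: continuous_intros\<close>)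
    then show "continuous_on {r - \<delta>..r + \<delta>} (?g' k)" for k
      by (intro continuous_intros)
    show "norm (?g' k s) \<le> \<bar>c1\<bar> * M1 k + \<bar>c2\<bar> * M2 k + \<bar>c3\<bar> * M3 k" if "s \<in> {r - \<delta>..r + \<delta>}" for k s
      by (intro norm_triangle_mono; simp only: norm_mult norm_of_real)
        (intro mult_left_mono M1 M2 M3 pB[OF that] abs_ge_zero)+
    show "(\<lambda>k. \<bar>c1\<bar> * M1 k + \<bar>c2\<bar> * M2 k + \<bar>c3\<bar> * M3 k) summable_on UNIV"
      by (intro summable_on_add summable_on_cmult_right M1 M2 M3)
    show "(\<lambda>k. laurent_term S k (?p s)) summable_on UNIV" if "s \<in> {r - \<delta>..r + \<delta>}" for s
      by (rule summ[OF pR[OF that]])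
  qed (use \<delta> in auto)
  moreover have "(\<Sum>\<^sub>\<infinity>k. ?g' k r) = of_real c1 * laurent_sum (laurent_deriv 1 S) (?p r) +
    of_real c2 * laurent_sum (laurent_deriv 2 S) (?p r) + of_real c3 * laurent_sum (laurent_deriv 3 S) (?p r)"
    unfolding laurent_sum_def
    by (intro infsumI has_sum_add has_sum_cmult_right) (auto intro!: summ'[OF _ r] has_sum_infsum simp del: laurent_deriv.simps)
  ultimately show ?thesis by (simp add: laurent_sum_def Let_def)
qed

section \<open>Stokes' theorem for the pentagon\<close>

text \<open>Exchange the order of integration for g, then apply the fundamental theorem in r to G
  and in s to H. Only derivatives in the direction of the respective variable are needed.\<close>

lemma green_rectangle:
  fixes G H g h :: "real \<Rightarrow> real \<Rightarrow> complex"
  assumes "a \<le> b" "c \<le> d"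
    and G: "\<And>r s. r \<in> {a..b} \<Longrightarrow> s \<in> {c..d} \<Longrightarrow> ((\<lambda>r. G r s) has_vector_derivative g r s) (at r)"
    and H: "\<And>r s. r \<in> {a..b} \<Longrightarrow> s \<in> {c..d} \<Longrightarrow> ((\<lambda>s. H r s) has_vector_derivative h r s) (at s)"
    and g: "continuous_on ({a..b} \<times> {c..d}) (\<lambda>(r, s). g r s)"
    and h: "continuous_on ({a..b} \<times> {c..d}) (\<lambda>(r, s). h r s)"
    and G': "continuous_on {c..d} (G a)" "continuous_on {c..d} (G b)"
    and H': "continuous_on {a..b} (\<lambda>r. H r c)" "continuous_on {a..b} (\<lambda>r. H r d)"
  shows "integral {a..b} (\<lambda>r. integral {c..d} (\<lambda>s. g r s - h r s)) =
    integral {c..d} (G b) - integral {c..d} (G a) - (integral {a..b} (\<lambda>r. H r d) - integral {a..b} (\<lambda>r. H r c))"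
proof -
  have slice: "continuous_on {c..d} (f r)" if "continuous_on ({a..b} \<times> {c..d}) (\<lambda>(r, s). f r s)" "r \<in> {a..b}"
    for f :: "real \<Rightarrow> real \<Rightarrow> complex" and r
  proof -
    have "continuous_on {c..d} (\<lambda>s. case_prod f (r, s))"
      by (rule continuous_on_compose2[OF that(1)]) (use that(2) in \<open>auto intro!: continuous_intros\<close>)
    then show ?thesis by simp
  qed
  have outer: "(\<lambda>r. integral {c..d} (f r)) integrable_on {a..b}" if "continuous_on ({a..b} \<times> {c..d}) (\<lambda>(r, s). f r s)"
    for f :: "real \<Rightarrow> real \<Rightarrow> complex"
    using integral_continuous_on_param[of "{a..b}" c d f] that by (intro integrable_continuous_real) simp
  have "integral {a..b} (\<lambda>r. integral {c..d} (\<lambda>s. g r s - h r s)) =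
    integral {a..b} (\<lambda>r. integral {c..d} (g r) - integral {c..d} (h r))"
    by (intro integral_cong integral_diff integrable_continuous_real slice g h)
  also have "\<dots> = integral {a..b} (\<lambda>r. integral {c..d} (g r)) - integral {a..b} (\<lambda>r. integral {c..d} (h r))"
    by (intro integral_diff outer g h)
  also have "integral {a..b} (\<lambda>r. integral {c..d} (g r)) = integral {c..d} (\<lambda>s. integral {a..b} (\<lambda>r. g r s))"
    using integral_swap_continuous[of a c b d g] g by (simp add: cbox_Pair_eq)
  also have "\<dots> = integral {c..d} (\<lambda>s. G b s - G a s)"
    by (intro integral_cong integral_unique fundamental_theorem_of_calculus)
      (use assms in \<open>auto intro: has_vector_derivative_at_within\<close>)
  also have "\<dots> = integral {c..d} (G b) - integral {c..d} (G a)"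
    by (intro integral_diff integrable_continuous_real G')
  also have "integral {a..b} (\<lambda>r. integral {c..d} (h r)) = integral {a..b} (\<lambda>r. H r d - H r c)"
    by (intro integral_cong integral_unique fundamental_theorem_of_calculus)
      (use assms in \<open>auto intro: has_vector_derivative_at_within\<close>)
  also have "\<dots> = integral {a..b} (\<lambda>r. H r d) - integral {a..b} (\<lambda>r. H r c)"
    by (intro integral_diff integrable_continuous_real H')
  finally show ?thesis .
qed

lemma integrable_on_compact:
  fixes h :: "'a::euclidean_space \<Rightarrow> complex"
  assumes "compact P" "continuous_on P h"
  shows "h integrable_on P"
  using set_borel_integral_eq_integral(1)[of P h] borel_integrable_compact[OF assms]
  by (simp add: set_integrable_def)

text \<open>Fubini for a compact region with interval slices: the gauge integrals are turned into
  Lebesgue integrals of indicator multiples and back.\<close>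

lemma integral_compact_fst:
  fixes h :: "real \<times> real \<Rightarrow> complex"
  assumes P: "compact P" "continuous_on P h" and sub: "P \<subseteq> {a..b} \<times> UNIV"
    and slice: "\<And>x. x \<in> {a..b} \<Longrightarrow> {y. (x, y) \<in> P} = {l x..u x}"
  shows "integral P h = integral {a..b} (\<lambda>x. integral {l x..u x} (\<lambda>y. h (x, y)))"
proof -
  let ?f = "\<lambda>x y. indicator P (x, y) *\<^sub>R h (x, y)"
  have int: "integrable (lborel \<Otimes>\<^sub>M lborel) (case_prod ?f)"
    using borel_integrable_compact[OF P] by (simp add: lborel_prod case_prod_unfold)
  have inner: "(\<integral>y. ?f x y \<partial>lborel) = indicator {a..b} x *\<^sub>R integral {l x..u x} (\<lambda>y. h (x, y))" for x
  proof (cases "x \<in> {a..b}")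
    case True
    have "continuous_on {l x..u x} (\<lambda>y. h (x, y))"
      by (rule continuous_on_compose2[OF P(2)]) (use slice[OF True] in \<open>auto intro!: continuous_intros\<close>)
    then have "integrable lborel (\<lambda>y. indicator {l x..u x} y *\<^sub>R h (x, y))"
      by (intro borel_integrable_compact) auto
    then have "(\<integral>y. indicator {l x..u x} y *\<^sub>R h (x, y) \<partial>lborel) = integral {l x..u x} (\<lambda>y. h (x, y))"
      using set_borel_integral_eq_integral(2)[of "{l x..u x}" "\<lambda>y. h (x, y)"]
      by (simp add: set_integrable_def set_lebesgue_integral_def)
    moreover have "indicator P (x, y) = (indicator {l x..u x} y :: real)" for y
    proof -
      have "(x, y) \<in> P \<longleftrightarrow> y \<in> {l x..u x}" unfolding slice[OF True, symmetric] by simp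
      then show ?thesis by (simp add: indicator_def)
    qed
    ultimately show ?thesis using True by simp
  next
    case False
    then have "indicator P (x, y) = (0 :: real)" for y using sub by (auto simp: indicator_def)
    then show ?thesis using False by simp
  qed
  have "integral P h = (\<integral>p. indicator P p *\<^sub>R h p \<partial>lborel)"
    using set_borel_integral_eq_integral(2)[of P h] borel_integrable_compact[OF P]
    by (simp add: set_integrable_def set_lebesgue_integral_def)
  also have "\<dots> = integral\<^sup>L (lborel \<Otimes>\<^sub>M lborel) (case_prod ?f)"
    by (simp add: lborel_prod case_prod_unfold)
  also have "\<dots> = (\<integral>x. \<integral>y. ?f x y \<partial>lborel \<partial>lborel)"
    using lborel_pair.integral_fst'[OF int] by simp
  also have "\<dots> = integral {a..b} (\<lambda>x. integral {l x..u x} (\<lambda>y. h (x, y)))"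
    using set_borel_integral_eq_integral(2)[of "{a..b}" "\<lambda>x. integral {l x..u x} (\<lambda>y. h (x, y))"]
      lborel_pair.integrable_fst'[OF int]
    by (simp add: set_integrable_def set_lebesgue_integral_def inner)
  finally show ?thesis .
qed

text \<open>The previous formula for the region reflected in the diagonal, since the Lebesgue
  integral is invariant under swapping coordinates.\<close>

lemma integral_compact_snd:
  fixes h :: "real \<times> real \<Rightarrow> complex"
  assumes P: "compact P" "continuous_on P h" and sub: "P \<subseteq> UNIV \<times> {a..b}"
    and slice: "\<And>y. y \<in> {a..b} \<Longrightarrow> {x. (x, y) \<in> P} = {l y..u y}"
  shows "integral P h = integral {a..b} (\<lambda>y. integral {l y..u y} (\<lambda>x. h (x, y)))"
proof -
  let ?P = "prod.swap ` P"
  have cont: "continuous_on ?P (h \<circ> prod.swap)"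
    by (rule continuous_on_compose) (auto intro: continuous_intros simp: image_image P)
  have comp: "compact ?P"
    by (intro compact_continuous_image P) (auto intro: continuous_intros)
  have "integral P h = (\<integral>p. indicator P p *\<^sub>R h p \<partial>(lborel \<Otimes>\<^sub>M lborel))"
    using set_borel_integral_eq_integral(2)[of P h] borel_integrable_compact[OF P]
    by (simp add: set_integrable_def set_lebesgue_integral_def lborel_prod)
  also have "\<dots> = (\<integral>(x, y). indicator P (y, x) *\<^sub>R h (y, x) \<partial>(lborel \<Otimes>\<^sub>M lborel))"
    by (rule lborel_pair.integral_product_swap[symmetric])
      (use borel_integrable_compact[OF P] in \<open>simp add: lborel_prod\<close>)
  also have "\<dots> = (\<integral>p. indicator ?P p *\<^sub>R (h \<circ> prod.swap) p \<partial>lborel)"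
  proof -
    have "indicator ?P p = (indicator P (snd p, fst p) :: real)" for p
      by (cases p) (auto simp: indicator_def)
    then show ?thesis by (simp add: lborel_prod case_prod_unfold prod.swap_def o_def)
  qed
  also have "\<dots> = integral ?P (h \<circ> prod.swap)"
    using set_borel_integral_eq_integral(2)[of ?P "h \<circ> prod.swap"] borel_integrable_compact[OF comp cont]
    by (simp add: set_integrable_def set_lebesgue_integral_def)
  also have "\<dots> = integral {a..b} (\<lambda>y. integral {l y..u y} (\<lambda>x. (h \<circ> prod.swap) (y, x)))"
  proof (rule integral_compact_fst[OF comp cont])
    show "{x. (y, x) \<in> ?P} = {l y..u y}" if "y \<in> {a..b}" for y
    proof -
      have "{x. (y, x) \<in> ?P} = {x. (x, y) \<in> P}" by force
      then show ?thesis using slice[OF that] by simp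
    qed
  qed (use sub in auto)
  finally show ?thesis by simp
qed

lemma compact_pentagon: "compact (pentagon \<rho> \<xi> \<alpha>1 \<alpha>2 \<epsilon>1 \<epsilon>2)"
proof -
  have "pentagon \<rho> \<xi> \<alpha>1 \<alpha>2 \<epsilon>1 \<epsilon>2 = ({\<epsilon>2..\<rho> - \<alpha>1} \<times> {\<epsilon>1..\<rho> - \<alpha>2}) \<inter> {p. \<xi> \<le> fst p - snd p}"
    by (auto simp: pentagon_def)
  also have "compact \<dots>"
    by (intro compact_Int_closed compact_Times compact_Icc closed_Collect_le continuous_intros)
  finally show ?thesis .
qed

text \<open>The partial derivatives are recorded through the chain rule along arbitrary lines rather
  than as a total derivative, because this is the form in which the faces use it.\<close>

definition C1_on ::
  "real3 set \<Rightarrow> (real3 \<Rightarrow> complex) \<Rightarrow> (nat \<Rightarrow> real3 \<Rightarrow> complex) \<Rightarrow> bool" where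
  "C1_on R U D \<longleftrightarrow> continuous_on R U \<and> (\<forall>i\<in>{1, 2, 3}. continuous_on R (D i)) \<and>
    (\<forall>x y z c1 c2 c3 r. (x + c1 * r, y + c2 * r, z + c3 * r) \<in> R \<longrightarrow>
      ((\<lambda>r. U (x + c1 * r, y + c2 * r, z + c3 * r)) has_vector_derivative
        (let p = (x + c1 * r, y + c2 * r, z + c3 * r) in
         of_real c1 * D 1 p + of_real c2 * D 2 p + of_real c3 * D 3 p)) (at r))"

text \<open>Here the line is recognised from its coordinate functions: p, q, u are the velocities,
  and affinity becomes a simplification goal even for the unsimplified parametrisations of the
  faces.\<close>

lemma C1_on_path:
  assumes "C1_on R U D"
    and "\<And>r. X r = X 0 + p * r" "\<And>r. Y r = Y 0 + q * r" "\<And>r. Z r = Z 0 + u * r"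
    and "(X r, Y r, Z r) \<in> R"
    and "d = of_real p * D 1 (X r, Y r, Z r) + of_real q * D 2 (X r, Y r, Z r) + of_real u * D 3 (X r, Y r, Z r)"
  shows "((\<lambda>r. U (X r, Y r, Z r)) has_vector_derivative d) (at r)"
proof -
  have "(X 0 + p * r, Y 0 + q * r, Z 0 + u * r) \<in> R"
    using assms(2-5) by metis
  then have "((\<lambda>r. U (X 0 + p * r, Y 0 + q * r, Z 0 + u * r)) has_vector_derivative
        (let w = (X 0 + p * r, Y 0 + q * r, Z 0 + u * r) in
         of_real p * D 1 w + of_real q * D 2 w + of_real u * D 3 w)) (at r)"
    using assms(1) unfolding C1_on_def by blast
  then show ?thesis
    unfolding Let_def assms(2-4)[symmetric] assms(6) .
qed

lemma C1_on_scale: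
  assumes "C1_on R U D"
  shows "C1_on R (\<lambda>p. c * U p) (\<lambda>i p. c * D i p)"
proof -
  have "((\<lambda>r. c * U (x + c1 * r, y + c2 * r, z + c3 * r)) has_vector_derivative
      (let p = (x + c1 * r, y + c2 * r, z + c3 * r) in
         of_real c1 * (c * D 1 p) + of_real c2 * (c * D 2 p) + of_real c3 * (c * D 3 p))) (at r)"
    if "(x + c1 * r, y + c2 * r, z + c3 * r) \<in> R" for x y z c1 c2 c3 r
  proof -
    have "((\<lambda>r. U (x + c1 * r, y + c2 * r, z + c3 * r)) has_vector_derivative
      (let p = (x + c1 * r, y + c2 * r, z + c3 * r) in
         of_real c1 * D 1 p + of_real c2 * D 2 p + of_real c3 * D 3 p)) (at r)"
      using assms that unfolding C1_on_def by blast
    from has_vector_derivative_mult_right[OF this, of c] show ?thesis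
      by (simp add: Let_def algebra_simps del: One_nat_def)
  qed
  moreover have "continuous_on R (\<lambda>p. c * U p)" "\<forall>i\<in>{1, 2, 3}. continuous_on R (\<lambda>p. c * D i p)"
    using assms unfolding C1_on_def by (auto intro!: continuous_intros)
  ultimately show ?thesis unfolding C1_on_def by blast
qed

lemma continuous_on_compose3:
  assumes "continuous_on R F" "continuous_on S X" "continuous_on S Y" "continuous_on S Z"
    "\<And>s. s \<in> S \<Longrightarrow> (X s, Y s, Z s) \<in> R"
  shows "continuous_on S (\<lambda>s. F (X s, Y s, Z s))"
  by (rule continuous_on_compose2[OF assms(1)]) (use assms in \<open>auto intro!: continuous_intros\<close>)

lemma integral_shift_Icc:
  fixes f :: "real \<Rightarrow> complex"
  shows "integral {a + c..b + c} f = integral {a..b} (\<lambda>x. f (x + c))"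
  using integral_shift_cbox_plus[of a b f c] by (simp add: o_def add.commute)

definition simplex_region :: "real \<Rightarrow> real3 set" where
  "simplex_region t = {(x, y, z). t < z \<and> z < y \<and> y < x}"

text \<open>The inequalities \<open>gaps\<close> say that the intervals {\<epsilon>2..\<rho> -
  \<alpha>2}, {\<epsilon>1..\<epsilon>2 - \<xi>} and {\<xi>..\<alpha>2 - \<alpha>1} have positive
  length. They make the pentagon nondegenerate and place all faces in \<Delta>.\<close>

locale pentagon_region =
  fixes t \<rho> \<epsilon>1 \<epsilon>2 \<alpha>1 \<alpha>2 \<xi> :: real
  assumes pos: "\<epsilon>1 > 0" "\<alpha>1 > 0" "\<xi> > 0"
    and gaps: "\<epsilon>2 + \<alpha>2 < \<rho>" "\<epsilon>1 + \<xi> < \<epsilon>2" "\<alpha>1 + \<xi> < \<alpha>2"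
begin

abbreviation \<Delta> where "\<Delta> \<equiv> simplex_region t"
abbreviation pent where "pent \<equiv> pentagon \<rho> \<xi> \<alpha>1 \<alpha>2 \<epsilon>1 \<epsilon>2"

text \<open>
  The three rectangular faces and the ten outer edges, parametrised literally as in the definitions
  of the operations, so that the values of the operator expressions match syntactically.
\<close>

abbreviation face_n where "face_n r s \<equiv> (s + (t + \<rho>) + \<alpha>1, s + (t + \<rho>), r + t)"
abbreviation face_m where "face_m r s \<equiv> (s + (r + (t + \<rho>) + \<alpha>2) + \<alpha>1, s + (r + (t + \<rho>) + \<alpha>2), r + (t + \<rho>))"
abbreviation face_mt where "face_mt r s \<equiv> (t + \<rho> + r + \<alpha>2, s + (t + \<rho> + r), t + \<rho> + r)"
abbreviation edge1 where "edge1 s \<equiv> (t + \<rho>, t + \<epsilon>2, s + t)"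
abbreviation edge2 where "edge2 s \<equiv> (t + \<rho>, s + (t + \<epsilon>2) + \<xi>, s + (t + \<epsilon>2))"
abbreviation edge3 where "edge3 s \<equiv> (t + \<rho>, s + t, t + \<epsilon>1)"
abbreviation edge4 where "edge4 s \<equiv> (s + (t + \<rho>) + \<alpha>1, s + (t + \<rho>), t + \<epsilon>1)"
abbreviation edge5 where "edge5 s \<equiv> (t + \<rho>, s + t + \<xi>, s + t)"
abbreviation edge6 where "edge6 s \<equiv> (s + (t + \<rho>) + \<alpha>2, s + (t + \<rho>) + \<xi>, s + (t + \<rho>))"
abbreviation edge7 where "edge7 s \<equiv> (t + \<rho> + \<alpha>1, t + \<rho>, s + t)"
abbreviation edge8 where "edge8 s \<equiv> (s + (t + \<rho>) + \<alpha>2 + \<alpha>1, s + (t + \<rho>) + \<alpha>2, s + (t + \<rho>))"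
abbreviation edge9 where "edge9 s \<equiv> (t + \<rho> + \<alpha>2, s + (t + \<rho>), t + \<rho>)"
abbreviation edge10 where "edge10 s \<equiv> (s + (t + \<rho> + \<alpha>2) + \<alpha>1, s + (t + \<rho> + \<alpha>2), t + \<rho>)"

text \<open>The integral over the four faces of the two-form K12 dx dy + K13 dz dx + K23 dy dz
  (wedge products). In the (r, s) parametrisation \<open>face_n\<close> has velocities (0,0,1),
  (1,1,0), \<open>face_m\<close> has (1,1,1), (1,1,0), and \<open>face_mt\<close> has (1,1,1),
  (0,1,0); the pullbacks are the displayed differences. The minus sign of the first integral is the
  orientation of the pentagon.\<close>

definition pentagon_sum ::
  "(real3 \<Rightarrow> complex) \<Rightarrow> (real3 \<Rightarrow> complex) \<Rightarrow> (real3 \<Rightarrow> complex) \<Rightarrow> complex" where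
  "pentagon_sum K12 K13 K23 =
    - integral pent (\<lambda>(x, y). K23 (\<rho> + t, x + t, y + t)) +
    (integral {\<epsilon>1..\<rho> - \<alpha>2} (\<lambda>r. integral {-\<alpha>1..0} (\<lambda>s. K13 (face_n r s) - K23 (face_n r s))) +
     integral {-\<alpha>2..0} (\<lambda>r. integral {-\<alpha>1..0} (\<lambda>s. K13 (face_m r s) - K23 (face_m r s)))) +
    integral {-\<alpha>2..0} (\<lambda>r. integral {\<xi>..\<alpha>2 - \<alpha>1} (\<lambda>s. K12 (face_mt r s) - K23 (face_mt r s)))"

text \<open>The one-form U1 dx + U2 dy + U3 dz on the ten outer edges: coordinates moving together
  contribute the sum of their components. Each bracketed pair is one operation n, its n' part
  followed by its m part.\<close>

definition edge_sum ::
  "(real3 \<Rightarrow> complex) \<Rightarrow> (real3 \<Rightarrow> complex) \<Rightarrow> (real3 \<Rightarrow> complex) \<Rightarrow> complex" where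
  "edge_sum U1 U2 U3 =
    (let U12 = (\<lambda>p. U1 p + U2 p); U23 = (\<lambda>p. U2 p + U3 p); U = (\<lambda>p. U1 p + U2 p + U3 p) in
    (integral {\<epsilon>1..\<epsilon>2 - \<xi>} (\<lambda>s. U3 (edge1 s)) +
     integral {-\<xi>..0} (\<lambda>s. U23 (edge2 s))) -
    (integral {\<epsilon>2..\<rho> - \<alpha>1} (\<lambda>s. U2 (edge3 s)) +
     integral {-\<alpha>1..0} (\<lambda>s. U12 (edge4 s))) +
    (integral {\<epsilon>2..\<rho> - \<alpha>2} (\<lambda>s. U23 (edge5 s)) +
     integral {-\<alpha>2..0} (\<lambda>s. U (edge6 s))) -
    (integral {\<epsilon>1..\<rho> - \<alpha>2} (\<lambda>s. U3 (edge7 s)) +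
     integral {-\<alpha>2..0} (\<lambda>s. U (edge8 s))) +
    (integral {\<xi>..\<alpha>2 - \<alpha>1} (\<lambda>s. U2 (edge9 s)) +
     integral {-\<alpha>1..0} (\<lambda>s. U12 (edge10 s))))"

lemma pentagon_subset:
  "(x, y) \<in> pent \<Longrightarrow> (\<rho> + t, x + t, y + t) \<in> \<Delta>"
  using pos gaps by (auto simp: pentagon_def simplex_region_def)

end

locale pentagon_stokes = pentagon_region +
  fixes U1 U2 U3 :: "real3 \<Rightarrow> complex" and D1 D2 D3 :: "nat \<Rightarrow> real3 \<Rightarrow> complex"
  assumes C1: "C1_on \<Delta> U1 D1" "C1_on \<Delta> U2 D2" "C1_on \<Delta> U3 D3"
begin

lemma continuous_UD:
  "continuous_on \<Delta> U1" "continuous_on \<Delta> U2" "continuous_on \<Delta> U3"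
  "i \<in> {1, 2, 3} \<Longrightarrow> continuous_on \<Delta> (D1 i)"
  "i \<in> {1, 2, 3} \<Longrightarrow> continuous_on \<Delta> (D2 i)"
  "i \<in> {1, 2, 3} \<Longrightarrow> continuous_on \<Delta> (D3 i)"
  using C1 by (auto simp: C1_on_def)

lemmas cont3 = continuous_UD[THEN continuous_on_compose3]

text \<open>Green's formula in (r, s): G = U1 + U2 is the component along the s-velocity (1,1,0),
  and H = U3 the component along the r-velocity (0,0,1).\<close>

lemma green_n:
  "integral {\<epsilon>1..\<rho> - \<alpha>2} (\<lambda>r. integral {-\<alpha>1..0} (\<lambda>s.
     let p = face_n r s in (D1 3 p - D3 1 p) - (D3 2 p - D2 3 p))) =
   integral {-\<alpha>1..0} (\<lambda>s. let p = (s + (t + \<rho>) + \<alpha>1, s + (t + \<rho>), \<rho> - \<alpha>2 + t) in U1 p + U2 p) -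
   integral {-\<alpha>1..0} (\<lambda>s. let p = (s + (t + \<rho>) + \<alpha>1, s + (t + \<rho>), \<epsilon>1 + t) in U1 p + U2 p) -
   (integral {\<epsilon>1..\<rho> - \<alpha>2} (\<lambda>r. U3 (0 + (t + \<rho>) + \<alpha>1, 0 + (t + \<rho>), r + t)) -
    integral {\<epsilon>1..\<rho> - \<alpha>2} (\<lambda>r. U3 (-\<alpha>1 + (t + \<rho>) + \<alpha>1, -\<alpha>1 + (t + \<rho>), r + t)))"
  unfolding Let_def
proof (rule trans[OF _ green_rectangle[where g = "\<lambda>r s. let p = face_n r s in D1 3 p + D2 3 p"
    and h = "\<lambda>r s. let p = face_n r s in D3 1 p + D3 2 p"]], goal_cases)
  case 1
  show ?case by (simp add: Let_def algebra_simps)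
next
  case (4 r s)
  then show ?case unfolding Let_def
    by (intro has_vector_derivative_add C1_on_path[OF C1(1), where p = 0 and q = 0 and u = 1]
      C1_on_path[OF C1(2), where p = 0 and q = 0 and u = 1]) (use pos gaps in \<open>auto simp: simplex_region_def\<close>)
next
  case (5 r s)
  then show ?case unfolding Let_def
    by (intro C1_on_path[OF C1(3), where p = 1 and q = 1 and u = 0]) (use pos gaps in \<open>auto simp: simplex_region_def\<close>)
qed (use pos gaps in \<open>auto simp: simplex_region_def Let_def case_prod_unfold intro!: continuous_intros cont3\<close>)

text \<open>The velocities are now (1,1,1) and (1,1,0), so H is the full sum U1 + U2 + U3; the
  derivatives common to g and h cancel and leave the same two components as on
  \<open>face_n\<close>.\<close>

lemma green_m:
  "integral {-\<alpha>2..0} (\<lambda>r. integral {-\<alpha>1..0} (\<lambda>s.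
     let p = face_m r s in
     (D1 3 p - D3 1 p) - (D3 2 p - D2 3 p))) =
   integral {-\<alpha>1..0} (\<lambda>s. let p = (s + (0 + (t + \<rho>) + \<alpha>2) + \<alpha>1, s + (0 + (t + \<rho>) + \<alpha>2), 0 + (t + \<rho>)) in U1 p + U2 p) -
   integral {-\<alpha>1..0} (\<lambda>s. let p = (s + (-\<alpha>2 + (t + \<rho>) + \<alpha>2) + \<alpha>1, s + (-\<alpha>2 + (t + \<rho>) + \<alpha>2), -\<alpha>2 + (t + \<rho>)) in U1 p + U2 p) -
   (integral {-\<alpha>2..0} (\<lambda>r. let p = (0 + (r + (t + \<rho>) + \<alpha>2) + \<alpha>1, 0 + (r + (t + \<rho>) + \<alpha>2), r + (t + \<rho>)) in U1 p + U2 p + U3 p) -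
    integral {-\<alpha>2..0} (\<lambda>r. let p = (-\<alpha>1 + (r + (t + \<rho>) + \<alpha>2) + \<alpha>1, -\<alpha>1 + (r + (t + \<rho>) + \<alpha>2), r + (t + \<rho>)) in U1 p + U2 p + U3 p))"
  unfolding Let_def
proof (rule trans[OF _ green_rectangle[where
    g = "\<lambda>r s. let p = face_m r s in
      (D1 1 p + D1 2 p + D1 3 p) + (D2 1 p + D2 2 p + D2 3 p)"
    and h = "\<lambda>r s. let p = face_m r s in
      (D1 1 p + D1 2 p) + (D2 1 p + D2 2 p) + (D3 1 p + D3 2 p)"]], goal_cases)
  case 1
  show ?case by (simp add: Let_def algebra_simps)
next
  case (4 r s)
  then show ?case unfolding Let_def
    by (intro has_vector_derivative_add C1_on_path[OF C1(1), where p = 1 and q = 1 and u = 1]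
      C1_on_path[OF C1(2), where p = 1 and q = 1 and u = 1]) (use pos gaps in \<open>auto simp: simplex_region_def\<close>)
next
  case (5 r s)
  then show ?case unfolding Let_def
    by (intro has_vector_derivative_add C1_on_path[OF C1(1), where p = 1 and q = 1 and u = 0]
      C1_on_path[OF C1(2), where p = 1 and q = 1 and u = 0]
      C1_on_path[OF C1(3), where p = 1 and q = 1 and u = 0]) (use pos gaps in \<open>auto simp: simplex_region_def\<close>)
qed (use pos gaps in \<open>auto simp: simplex_region_def Let_def case_prod_unfold intro!: continuous_intros cont3\<close>)

lemma green_mt:
  "integral {-\<alpha>2..0} (\<lambda>r. integral {\<xi>..\<alpha>2 - \<alpha>1} (\<lambda>s.
     let p = face_mt r s in (D2 1 p - D1 2 p) - (D3 2 p - D2 3 p))) =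
   integral {\<xi>..\<alpha>2 - \<alpha>1} (\<lambda>s. U2 (t + \<rho> + 0 + \<alpha>2, s + (t + \<rho> + 0), t + \<rho> + 0)) -
   integral {\<xi>..\<alpha>2 - \<alpha>1} (\<lambda>s. U2 (t + \<rho> + -\<alpha>2 + \<alpha>2, s + (t + \<rho> + -\<alpha>2), t + \<rho> + -\<alpha>2)) -
   (integral {-\<alpha>2..0} (\<lambda>r. let p = (t + \<rho> + r + \<alpha>2, (\<alpha>2 - \<alpha>1) + (t + \<rho> + r), t + \<rho> + r) in U1 p + U2 p + U3 p) -
    integral {-\<alpha>2..0} (\<lambda>r. let p = (t + \<rho> + r + \<alpha>2, \<xi> + (t + \<rho> + r), t + \<rho> + r) in U1 p + U2 p + U3 p))"
  unfolding Let_def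
proof (rule trans[OF _ green_rectangle[where
    g = "\<lambda>r s. let p = face_mt r s in D2 1 p + D2 2 p + D2 3 p"
    and h = "\<lambda>r s. let p = face_mt r s in D1 2 p + D2 2 p + D3 2 p"]], goal_cases)
  case 1
  show ?case by (simp add: Let_def algebra_simps)
next
  case (4 r s)
  then show ?case unfolding Let_def
    by (intro C1_on_path[OF C1(2), where p = 1 and q = 1 and u = 1]) (use pos gaps in \<open>auto simp: simplex_region_def\<close>)
next
  case (5 r s)
  then show ?case unfolding Let_def
    by (intro has_vector_derivative_add C1_on_path[OF C1(1), where p = 0 and q = 1 and u = 0]
      C1_on_path[OF C1(2), where p = 0 and q = 1 and u = 0]
      C1_on_path[OF C1(3), where p = 0 and q = 1 and u = 0]) (use pos gaps in \<open>auto simp: simplex_region_def\<close>)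
qed (use pos gaps in \<open>auto simp: simplex_region_def Let_def case_prod_unfold intro!: continuous_intros cont3\<close>)

text \<open>Each derivative is integrated first in its own direction. The slices end at max
  \<epsilon>2 (y + \<xi>) and min (\<rho> - \<alpha>2) (x - \<xi>); splitting at y = \<epsilon>2 -
  \<xi> and x = \<rho> - \<alpha>2 + \<xi>, the ends of the oblique edge x - y = \<xi>, separates
  the straight edges from it.\<close>

lemma green_pentagon:
  "integral pent (\<lambda>(x, y). D3 2 (\<rho> + t, x + t, y + t) - D2 3 (\<rho> + t, x + t, y + t)) =
    (integral {\<epsilon>1..\<rho> - \<alpha>2} (\<lambda>y. U3 (\<rho> + t, \<rho> - \<alpha>1 + t, y + t)) -
     integral {\<epsilon>1..\<epsilon>2 - \<xi>} (\<lambda>y. U3 (\<rho> + t, \<epsilon>2 + t, y + t)) -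
     integral {\<epsilon>2 - \<xi>..\<rho> - \<alpha>2} (\<lambda>y. U3 (\<rho> + t, y + \<xi> + t, y + t))) -
    (integral {\<epsilon>2 - \<xi>..\<rho> - \<alpha>2} (\<lambda>y. U2 (\<rho> + t, y + \<xi> + t, y + t)) +
     integral {\<xi>..\<alpha>2 - \<alpha>1} (\<lambda>x. U2 (\<rho> + t, x + (\<rho> - \<alpha>2) + t, \<rho> - \<alpha>2 + t)) -
     integral {\<epsilon>2..\<rho> - \<alpha>1} (\<lambda>x. U2 (\<rho> + t, x + t, \<epsilon>1 + t)))"
proof -
  let ?F2 = "\<lambda>x y. U2 (\<rho> + t, x + t, y + t)" and ?F3 = "\<lambda>x y. U3 (\<rho> + t, x + t, y + t)"
  let ?P = pent
  have cP: "continuous_on ?P (\<lambda>p. F (\<rho> + t, fst p + t, snd p + t))" if "continuous_on \<Delta> F" for F :: "_ \<Rightarrow> complex"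
    by (rule continuous_on_compose3[OF that]) (use pentagon_subset in \<open>auto intro!: continuous_intros\<close>)
  note cD = cP[OF continuous_UD(6)[of 2]] cP[OF continuous_UD(5)[of 3]]
  have "integral ?P (\<lambda>(x, y). D3 2 (\<rho> + t, x + t, y + t) - D2 3 (\<rho> + t, x + t, y + t)) =
     integral ?P (\<lambda>p. D3 2 (\<rho> + t, fst p + t, snd p + t)) - integral ?P (\<lambda>p. D2 3 (\<rho> + t, fst p + t, snd p + t))"
    unfolding case_prod_unfold by (intro integral_diff integrable_on_compact compact_pentagon cD) auto
  also have "integral ?P (\<lambda>p. D3 2 (\<rho> + t, fst p + t, snd p + t)) =
    integral {\<epsilon>1..\<rho> - \<alpha>2} (\<lambda>y. integral {max \<epsilon>2 (y + \<xi>)..\<rho> - \<alpha>1} (\<lambda>x. D3 2 (\<rho> + t, x + t, y + t)))"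
    by (subst integral_compact_snd[where a = \<epsilon>1 and b = "\<rho> - \<alpha>2" and l = "\<lambda>y. max \<epsilon>2 (y + \<xi>)" and u = "\<lambda>_. \<rho> - \<alpha>1"])
      (use compact_pentagon cD in \<open>auto simp: pentagon_def\<close>)
  also have "\<dots> = integral {\<epsilon>1..\<rho> - \<alpha>2} (\<lambda>y. ?F3 (\<rho> - \<alpha>1) y - ?F3 (max \<epsilon>2 (y + \<xi>)) y)"
  proof (intro integral_cong integral_unique fundamental_theorem_of_calculus)
    fix y x assume "y \<in> {\<epsilon>1..\<rho> - \<alpha>2}" "x \<in> {max \<epsilon>2 (y + \<xi>)..\<rho> - \<alpha>1}"
    then show "((\<lambda>x. ?F3 x y) has_vector_derivative D3 2 (\<rho> + t, x + t, y + t))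
      (at x within {max \<epsilon>2 (y + \<xi>)..\<rho> - \<alpha>1})"
      by - (rule has_vector_derivative_at_within, rule C1_on_path[OF C1(3), where p = 0 and q = 1 and u = 0],
        use pos gaps in \<open>auto simp: simplex_region_def\<close>)
  qed (use pos gaps in auto)
  also have "\<dots> = integral {\<epsilon>1..\<rho> - \<alpha>2} (\<lambda>y. ?F3 (\<rho> - \<alpha>1) y) -
    integral {\<epsilon>1..\<rho> - \<alpha>2} (\<lambda>y. ?F3 (max \<epsilon>2 (y + \<xi>)) y)"
    by (intro integral_diff integrable_continuous_real cont3 continuous_intros)
      (use pos gaps in \<open>auto simp: simplex_region_def max_def\<close>)
  also have "integral {\<epsilon>1..\<rho> - \<alpha>2} (\<lambda>y. ?F3 (max \<epsilon>2 (y + \<xi>)) y) =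
    integral {\<epsilon>1..\<epsilon>2 - \<xi>} (\<lambda>y. ?F3 (max \<epsilon>2 (y + \<xi>)) y) +
    integral {\<epsilon>2 - \<xi>..\<rho> - \<alpha>2} (\<lambda>y. ?F3 (max \<epsilon>2 (y + \<xi>)) y)"
    by (intro Henstock_Kurzweil_Integration.integral_combine[symmetric] integrable_continuous_real cont3 continuous_intros)
      (use pos gaps in \<open>auto simp: simplex_region_def max_def\<close>)
  also have "integral {\<epsilon>1..\<epsilon>2 - \<xi>} (\<lambda>y. ?F3 (max \<epsilon>2 (y + \<xi>)) y) =
    integral {\<epsilon>1..\<epsilon>2 - \<xi>} (\<lambda>y. ?F3 \<epsilon>2 y)"
    by (intro integral_cong) (auto simp: max_absorb1)
  also have "integral {\<epsilon>2 - \<xi>..\<rho> - \<alpha>2} (\<lambda>y. ?F3 (max \<epsilon>2 (y + \<xi>)) y) =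
    integral {\<epsilon>2 - \<xi>..\<rho> - \<alpha>2} (\<lambda>y. ?F3 (y + \<xi>) y)"
    by (intro integral_cong) (auto simp: max_def)
  also have "integral ?P (\<lambda>p. D2 3 (\<rho> + t, fst p + t, snd p + t)) =
    integral {\<epsilon>2..\<rho> - \<alpha>1} (\<lambda>x. integral {\<epsilon>1..min (\<rho> - \<alpha>2) (x - \<xi>)} (\<lambda>y. D2 3 (\<rho> + t, x + t, y + t)))"
    by (subst integral_compact_fst[where a = \<epsilon>2 and b = "\<rho> - \<alpha>1" and u = "\<lambda>x. min (\<rho> - \<alpha>2) (x - \<xi>)" and l = "\<lambda>_. \<epsilon>1"])
      (use compact_pentagon cD in \<open>auto simp: pentagon_def\<close>)
  also have "\<dots> = integral {\<epsilon>2..\<rho> - \<alpha>1} (\<lambda>x. ?F2 x (min (\<rho> - \<alpha>2) (x - \<xi>)) - ?F2 x \<epsilon>1)"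
  proof (intro integral_cong integral_unique fundamental_theorem_of_calculus)
    fix x y assume "x \<in> {\<epsilon>2..\<rho> - \<alpha>1}" "y \<in> {\<epsilon>1..min (\<rho> - \<alpha>2) (x - \<xi>)}"
    then show "((\<lambda>y. ?F2 x y) has_vector_derivative D2 3 (\<rho> + t, x + t, y + t))
      (at y within {\<epsilon>1..min (\<rho> - \<alpha>2) (x - \<xi>)})"
      by - (rule has_vector_derivative_at_within, rule C1_on_path[OF C1(2), where p = 0 and q = 0 and u = 1],
        use pos gaps in \<open>auto simp: simplex_region_def\<close>)
  qed (use pos gaps in auto)
  also have "\<dots> = integral {\<epsilon>2..\<rho> - \<alpha>1} (\<lambda>x. ?F2 x (min (\<rho> - \<alpha>2) (x - \<xi>))) -
    integral {\<epsilon>2..\<rho> - \<alpha>1} (\<lambda>x. ?F2 x \<epsilon>1)"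
    by (intro integral_diff integrable_continuous_real cont3 continuous_intros)
      (use pos gaps in \<open>auto simp: simplex_region_def min_def\<close>)
  also have "integral {\<epsilon>2..\<rho> - \<alpha>1} (\<lambda>x. ?F2 x (min (\<rho> - \<alpha>2) (x - \<xi>))) =
    integral {\<epsilon>2..\<rho> - \<alpha>2 + \<xi>} (\<lambda>x. ?F2 x (min (\<rho> - \<alpha>2) (x - \<xi>))) +
    integral {\<rho> - \<alpha>2 + \<xi>..\<rho> - \<alpha>1} (\<lambda>x. ?F2 x (min (\<rho> - \<alpha>2) (x - \<xi>)))"
    by (intro Henstock_Kurzweil_Integration.integral_combine[symmetric] integrable_continuous_real cont3 continuous_intros)
      (use pos gaps in \<open>auto simp: simplex_region_def min_def\<close>)
  also have "integral {\<epsilon>2..\<rho> - \<alpha>2 + \<xi>} (\<lambda>x. ?F2 x (min (\<rho> - \<alpha>2) (x - \<xi>))) =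
    integral {\<epsilon>2 - \<xi>..\<rho> - \<alpha>2} (\<lambda>y. ?F2 (y + \<xi>) y)"
    using integral_shift_Icc[of "\<epsilon>2 - \<xi>" \<xi> "\<rho> - \<alpha>2" "\<lambda>x. ?F2 x (min (\<rho> - \<alpha>2) (x - \<xi>))"]
    by (simp, intro integral_cong) (auto simp: min_def)
  also have "integral {\<rho> - \<alpha>2 + \<xi>..\<rho> - \<alpha>1} (\<lambda>x. ?F2 x (min (\<rho> - \<alpha>2) (x - \<xi>))) =
    integral {\<xi>..\<alpha>2 - \<alpha>1} (\<lambda>x. ?F2 (x + (\<rho> - \<alpha>2)) (\<rho> - \<alpha>2))"
    using integral_shift_Icc[of \<xi> "\<rho> - \<alpha>2" "\<alpha>2 - \<alpha>1" "\<lambda>x. ?F2 x (min (\<rho> - \<alpha>2) (x - \<xi>))"]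
    by (simp add: add.commute[of \<xi>], intro integral_cong) (auto simp: min_def)
  finally show ?thesis by simp
qed

text \<open>Four edges are shared and cancel: the pentagon meets \<open>face_n\<close> in x = \<rho>
  - \<alpha>1 and \<open>face_mt\<close> in y = \<rho> - \<alpha>2, while \<open>face_m\<close>
  meets \<open>face_n\<close> at r = -\<alpha>2 and \<open>face_mt\<close> at s = -\<alpha>1. Nine
  outer edges remain, and the oblique one counts twice.\<close>

lemma pentagon_sum_curl:
  "pentagon_sum (\<lambda>p. D2 1 p - D1 2 p) (\<lambda>p. D1 3 p - D3 1 p) (\<lambda>p. D3 2 p - D2 3 p) = edge_sum U1 U2 U3"
proof -
  \<comment> \<open>The oblique edge is cut at y = \<epsilon>2: its lower part belongs to the m term
    of n(A2, A3, A4), its upper part to the n' term with the pair (A2, A3) in the middle.\<close>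
  have split: "integral {\<epsilon>2 - \<xi>..\<rho> - \<alpha>2} (\<lambda>y. F (\<rho> + t, y + \<xi> + t, y + t)) =
    integral {-\<xi>..0} (\<lambda>s. F (edge2 s)) +
    integral {\<epsilon>2..\<rho> - \<alpha>2} (\<lambda>s. F (edge5 s))" if F: "continuous_on \<Delta> F" for F :: "_ \<Rightarrow> complex"
  proof -
    have "integral {\<epsilon>2 - \<xi>..\<rho> - \<alpha>2} (\<lambda>y. F (\<rho> + t, y + \<xi> + t, y + t)) =
      integral {\<epsilon>2 - \<xi>..\<epsilon>2} (\<lambda>y. F (\<rho> + t, y + \<xi> + t, y + t)) + integral {\<epsilon>2..\<rho> - \<alpha>2} (\<lambda>y. F (\<rho> + t, y + \<xi> + t, y + t))"
      by (intro Henstock_Kurzweil_Integration.integral_combine[symmetric] integrable_continuous_real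
          continuous_on_compose3[OF F] continuous_intros)
        (use pos gaps in \<open>auto simp: simplex_region_def\<close>)
    then show ?thesis
      using integral_shift_Icc[of "-\<xi>" \<epsilon>2 0 "\<lambda>y. F (\<rho> + t, y + \<xi> + t, y + t)"] by (simp add: algebra_simps)
  qed
  have add23: "integral {a..b} (\<lambda>s. U2 (t + \<rho>, s + c + \<xi>, s + c) + U3 (t + \<rho>, s + c + \<xi>, s + c)) =
     integral {a..b} (\<lambda>s. U2 (t + \<rho>, s + c + \<xi>, s + c)) + integral {a..b} (\<lambda>s. U3 (t + \<rho>, s + c + \<xi>, s + c))"
    if "a + c > t" "b + c + \<xi> < t + \<rho>" for a b c
    by (intro integral_add integrable_continuous_real cont3 continuous_intros)
      (use that pos in \<open>auto simp: simplex_region_def\<close>)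
  have 1: "integral {-\<xi>..0} (\<lambda>s. U2 (edge2 s) + U3 (edge2 s)) =
     integral {-\<xi>..0} (\<lambda>s. U2 (edge2 s)) + integral {-\<xi>..0} (\<lambda>s. U3 (edge2 s))"
    by (rule add23) (use pos gaps in auto)
  have 2: "integral {\<epsilon>2..\<rho> - \<alpha>2} (\<lambda>s. U2 (edge5 s) + U3 (edge5 s)) =
     integral {\<epsilon>2..\<rho> - \<alpha>2} (\<lambda>s. U2 (edge5 s)) + integral {\<epsilon>2..\<rho> - \<alpha>2} (\<lambda>s. U3 (edge5 s))"
    by (rule add23) (use pos gaps in auto)
  note eqs = green_n[unfolded Let_def] green_m[unfolded Let_def] green_mt[unfolded Let_def]
    green_pentagon split[OF continuous_UD(2)] split[OF continuous_UD(3)]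
  show ?thesis
    unfolding pentagon_sum_def edge_sum_def Let_def eqs 1 2
    by (simp add: algebra_simps)
qed

end

section \<open>Four-point functions\<close>

lemma sg_add: "sg (a + b) = sg a * sg b" by (simp add: sg_cases)
lemma sg_diff: "sg (a - b) = sg a * sg b" by (simp add: sg_cases)
lemma sg_minus: "sg (- a) = sg a" by (simp add: sg_cases)
lemma sg_numeral: "sg 0 = 1" "sg 1 = -1" "sg 2 = 1" by (simp_all add: sg_cases)
lemmas sg_simps = sg_add sg_diff sg_minus sg_numeral

context vertex_operator_superalgebra
begin

definition corr ::
  "('v \<Rightarrow> complex) \<Rightarrow> 'v \<Rightarrow> 'v \<Rightarrow> 'v \<Rightarrow> 'v \<Rightarrow> 'v \<Rightarrow> real \<Rightarrow> real3 \<Rightarrow> complex" where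
  "corr f v A B C D t = (\<lambda>(x, y, z). mel f [Vertex A x, Vertex B y, Vertex C z, Vertex D t] v)"

text \<open>The modes of the fourth operator are summed as well, but t is fixed, so its power
  belongs to the coefficient and only three exponents remain.\<close>

definition corr_series ::
  "('v \<Rightarrow> complex) \<Rightarrow> 'v \<Rightarrow> 'v \<Rightarrow> 'v \<Rightarrow> 'v \<Rightarrow> 'v \<Rightarrow> real \<Rightarrow>
    (int \<times> int \<times> int \<times> int) laurent" where
  "corr_series f v A B C D t =
    (\<lambda>(k, l, m, n). of_real (t powi (- n - 1)) * f (md V A k (md V B l (md V C m (md V D n v)))),
     \<lambda>(k, l, m, n). - k - 1, \<lambda>(k, l, m, n). - l - 1, \<lambda>(k, l, m, n). - m - 1)"

lemma laurent_term_corr_series: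
  assumes f: "f \<in> restricted_dual V"
  shows "laurent_term (corr_series f v A B C D t) (k, l, m, n) (x, y, z) =
    f (word_term V [Vertex A x, Vertex B y, Vertex C z, Vertex D t] [k, l, m, n] v)"
  by (simp add: laurent_term_def corr_series_def md_right restricted_dual_linear[OF f] mult_ac)

lemma bij_modes4:
  "bij_betw (\<lambda>(k, l, m, n). [k, l, m, n]) UNIV (word_modes [Vertex A x, Vertex B y, Vertex C z, Vertex D t])"
  by (rule bij_betwI'; force)

lemma corr_series_summable:
  assumes f: "f \<in> restricted_dual V" and "t > 0" "q \<in> simplex_region t"
  shows "(\<lambda>k. laurent_term (corr_series f v A B C D t) k q) summable_on UNIV"
proof -
  obtain x y z where q: "q = (x, y, z)" by (cases q)
  have "(\<lambda>ks. f (word_term V [Vertex A x, Vertex B y, Vertex C z, Vertex D t] ks v)) summable_on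
    word_modes [Vertex A x, Vertex B y, Vertex C z, Vertex D t]"
    by (rule word_summable[OF _ f]) (use assms in \<open>auto simp: simplex_region_def q\<close>)
  then show ?thesis
    by (subst (asm) summable_on_reindex_bij_betw[OF bij_modes4, symmetric])
      (simp add: case_prod_unfold q laurent_term_corr_series[OF f, symmetric] del: word_term_simps)
qed

lemma laurent_sum_corr_series:
  assumes f: "f \<in> restricted_dual V"
  shows "laurent_sum (corr_series f v A B C D t) = corr f v A B C D t"
proof
  fix q :: "real3"
  obtain x y z where q: "q = (x, y, z)" by (cases q)
  show "laurent_sum (corr_series f v A B C D t) q = corr f v A B C D t q"
    unfolding corr_def q prod.case mel_def laurent_sum_def
    by (subst infsum_reindex_bij_betw[OF bij_modes4, symmetric])
      (simp add: case_prod_unfold laurent_term_corr_series[OF f, symmetric] del: word_term_simps)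
qed

lemma md_translation: "md V (Lmode V (-1) A) (n + 1) B = scl V (of_int (- n - 1)) (md V A n B)"
  using L_derivative[of A "n + 1" B] by simp

text \<open>Differentiation produces the factor -k-1 and lowers the exponent by one; by the
  derivative axiom this is exactly the mode k + 1 of L_{-1} A.\<close>

lemma laurent_term_corr_deriv:
  assumes f: "f \<in> restricted_dual V"
  shows "laurent_term (laurent_deriv 1 (corr_series f v A B C D t)) (k, l, m, n) (x, y, z) =
      laurent_term (corr_series f v (Lmode V (-1) A) B C D t) (k + 1, l, m, n) (x, y, z)" (is ?thesis1)
    "laurent_term (laurent_deriv 2 (corr_series f v A B C D t)) (k, l, m, n) (x, y, z) =
      laurent_term (corr_series f v A (Lmode V (-1) B) C D t) (k, l + 1, m, n) (x, y, z)" (is ?thesis2)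
    "laurent_term (laurent_deriv 3 (corr_series f v A B C D t)) (k, l, m, n) (x, y, z) =
      laurent_term (corr_series f v A B (Lmode V (-1) C) D t) (k, l, m + 1, n) (x, y, z)" (is ?thesis3)
proof -
  have e: "- k - 1 - 1 = - (k + 1) - (1 :: int)" for k by simp
  show ?thesis1 ?thesis2 ?thesis3
    by (simp add: laurent_term_def corr_series_def;
      simp only: md_translation md_right restricted_dual_linear(2)[OF f] e mult_ac of_int_diff of_int_minus of_int_1 simp_thms)+
qed

text \<open>Up to the bijective shift of one index, the derived series is the series of a
  correlation function with L_{-1} inserted, so its summability and continuity are already
  known.\<close>

lemma C1_on_corr:
  assumes f: "f \<in> restricted_dual V" and t: "t > 0"
  shows "C1_on (simplex_region t) (corr f v A B C D t)
    (\<lambda>i. if i = 1 then corr f v (Lmode V (-1) A) B C D t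
         else if i = 2 then corr f v A (Lmode V (-1) B) C D t else corr f v A B (Lmode V (-1) C) D t)"
proof -
  let ?R = "simplex_region t"
  have "?R = {p. t < snd (snd p)} \<inter> {p. snd (snd p) < fst (snd p)} \<inter> {p. fst (snd p) < fst p}"
    by (auto simp: simplex_region_def)
  also have "open \<dots>" by (intro open_Int open_Collect_less continuous_intros)
  finally have R: "open ?R" .
  have R': "?R \<subseteq> {(x, y, z). 0 < x \<and> 0 < y \<and> 0 < z}" using t by (auto simp: simplex_region_def)
  note summ = corr_series_summable[OF f t]
  have cont: "continuous_on ?R (corr f v A B C D t)" for A B C
    using laurent_sum_continuous[OF R R' summ] by (simp add: laurent_sum_corr_series[OF f])
  define sh1 :: "int \<times> int \<times> int \<times> int \<Rightarrow> int \<times> int \<times> int \<times> int" where "sh1 = (\<lambda>(k, l, m, n). (k + 1, l, m, n))"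
  define sh2 :: "int \<times> int \<times> int \<times> int \<Rightarrow> int \<times> int \<times> int \<times> int" where "sh2 = (\<lambda>(k, l, m, n). (k, l + 1, m, n))"
  define sh3 :: "int \<times> int \<times> int \<times> int \<Rightarrow> int \<times> int \<times> int \<times> int" where "sh3 = (\<lambda>(k, l, m, n). (k, l, m + 1, n))"
  have bij: "bij_betw sh1 UNIV UNIV"
    by (rule bij_betw_byWitness[where f' = "\<lambda>(k, l, m, n). (k - 1, l, m, n)"]) (auto simp: sh1_def)
  have bij2: "bij_betw sh2 UNIV UNIV"
    by (rule bij_betw_byWitness[where f' = "\<lambda>(k, l, m, n). (k, l - 1, m, n)"]) (auto simp: sh2_def)
  have bij3: "bij_betw sh3 UNIV UNIV"
    by (rule bij_betw_byWitness[where f' = "\<lambda>(k, l, m, n). (k, l, m - 1, n)"]) (auto simp: sh3_def)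
  have deriv: "laurent_term (laurent_deriv 1 (corr_series f v A B C D t)) k q = laurent_term (corr_series f v (Lmode V (-1) A) B C D t) (sh1 k) q"
    "laurent_term (laurent_deriv 2 (corr_series f v A B C D t)) k q = laurent_term (corr_series f v A (Lmode V (-1) B) C D t) (sh2 k) q"
    "laurent_term (laurent_deriv 3 (corr_series f v A B C D t)) k q = laurent_term (corr_series f v A B (Lmode V (-1) C) D t) (sh3 k) q" for k q
    using laurent_term_corr_deriv[OF f] by (cases k; cases q; simp add: sh1_def sh2_def sh3_def del: laurent_deriv.simps One_nat_def)+
  have summ': "(\<lambda>k. laurent_term (laurent_deriv i (corr_series f v A B C D t)) k q) summable_on UNIV"
    if "i \<in> {1, 2, 3}" "q \<in> ?R" for i q
  proof -
    have "(\<lambda>k. laurent_term (corr_series f v A B C D t) (sh k) q) summable_on UNIV"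
      if "bij_betw sh UNIV UNIV" for sh A B C
      using summable_on_reindex_bij_betw[OF that, of "\<lambda>k. laurent_term (corr_series f v A B C D t) k q"]
        summ[OF \<open>q \<in> ?R\<close>] by simp
    then show ?thesis
      using that(1) bij bij2 bij3 by (elim insertE emptyE; simp only: deriv)
  qed
  have sums: "laurent_sum (laurent_deriv 1 (corr_series f v A B C D t)) q = corr f v (Lmode V (-1) A) B C D t q"
    "laurent_sum (laurent_deriv 2 (corr_series f v A B C D t)) q = corr f v A (Lmode V (-1) B) C D t q"
    "laurent_sum (laurent_deriv 3 (corr_series f v A B C D t)) q = corr f v A B (Lmode V (-1) C) D t q" for q
    unfolding laurent_sum_corr_series[OF f, symmetric] laurent_sum_def deriv
    by (rule infsum_reindex_bij_betw[OF bij] infsum_reindex_bij_betw[OF bij2] infsum_reindex_bij_betw[OF bij3])+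
  show ?thesis
    unfolding C1_on_def
  proof (intro conjI ballI allI impI, goal_cases)
    case (3 x y z c1 c2 c3 r)
    from laurent_sum_derivative[OF R R' summ summ' this] show ?case
      by (simp add: Let_def laurent_sum_corr_series[OF f] sums del: laurent_deriv.simps One_nat_def)
  qed (use cont in auto)
qed

text \<open>Covers Q and b_{-1} together: b has weight 2, so b_{-1} is its mode number 0. Only the
  parity of the element enters the signs.\<close>

definition odd_zero_mode :: "'v \<Rightarrow> bool" where
  "odd_zero_mode A \<longleftrightarrow> (\<exists>i \<mu>. A \<in> gr V i \<mu> \<and> odd \<mu>)"

lemma mel_bracket1:
  assumes A: "odd_zero_mode A" and B: "B \<in> fermionic_space V \<beta>"
    and good: "good_args (word_args w @ s # word_args w')" and f: "f \<in> restricted_dual V"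
  shows "mel f (w @ Mode A 0 # Vertex B s # w') v =
    sg \<beta> * mel f (w @ Vertex B s # Mode A 0 # w') v + mel f (w @ Vertex (md V A 0 B) s # w') v"
proof -
  obtain i \<mu> where "A \<in> gr V i \<mu>" "odd \<mu>" using A by (auto simp: odd_zero_mode_def)
  moreover from this have "sg (\<mu> * \<beta>) = sg \<beta>" by (simp add: sg_cases)
  ultimately show ?thesis using mel_zero_mode[OF _ B good f] by metis
qed

lemma mel_bracket2:
  assumes A: "odd_zero_mode A" and B: "B1 \<in> fermionic_space V \<beta>1" "B2 \<in> fermionic_space V \<beta>2"
    and good: "good_args (word_args w @ s1 # s2 # word_args w')" and f: "f \<in> restricted_dual V"
  shows "mel f (w @ Mode A 0 # Vertex B1 s1 # Vertex B2 s2 # w') v =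
    sg \<beta>1 * sg \<beta>2 * mel f (w @ Vertex B1 s1 # Vertex B2 s2 # Mode A 0 # w') v +
    mel f (w @ Vertex (md V A 0 B1) s1 # Vertex B2 s2 # w') v +
    sg \<beta>1 * mel f (w @ Vertex B1 s1 # Vertex (md V A 0 B2) s2 # w') v"
  using mel_bracket1[OF A B(1), of w s1 "Vertex B2 s2 # w'" f v]
    mel_bracket1[OF A B(2), of "w @ [Vertex B1 s1]" s2 w' f v] good f
  by (simp add: algebra_simps)

lemma mel_bracket3:
  assumes A: "odd_zero_mode A"
    and B: "B1 \<in> fermionic_space V \<beta>1" "B2 \<in> fermionic_space V \<beta>2" "B3 \<in> fermionic_space V \<beta>3"
    and good: "good_args (word_args w @ s1 # s2 # s3 # word_args w')" and f: "f \<in> restricted_dual V"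
  shows "mel f (w @ Mode A 0 # Vertex B1 s1 # Vertex B2 s2 # Vertex B3 s3 # w') v =
    sg \<beta>1 * sg \<beta>2 * sg \<beta>3 * mel f (w @ Vertex B1 s1 # Vertex B2 s2 # Vertex B3 s3 # Mode A 0 # w') v +
    mel f (w @ Vertex (md V A 0 B1) s1 # Vertex B2 s2 # Vertex B3 s3 # w') v +
    sg \<beta>1 * mel f (w @ Vertex B1 s1 # Vertex (md V A 0 B2) s2 # Vertex B3 s3 # w') v +
    sg \<beta>1 * sg \<beta>2 * mel f (w @ Vertex B1 s1 # Vertex B2 s2 # Vertex (md V A 0 B3) s3 # w') v"
  using mel_bracket2[OF A B(1,2), of w s1 s2 "Vertex B3 s3 # w'" f v]
    mel_bracket1[OF A B(3), of "w @ [Vertex B1 s1, Vertex B2 s2]" s3 w' f v] good f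
  by (simp add: algebra_simps)

text \<open>The Ward identity of an odd zero mode: moved from the left end to the right end it acts
  once on each slot, with the sign of the slots already passed, and finally on v.\<close>

lemma corr_bracket:
  assumes A: "odd_zero_mode A"
    and B: "B1 \<in> fermionic_space V \<beta>1" "B2 \<in> fermionic_space V \<beta>2" "B3 \<in> fermionic_space V \<beta>3" "B4 \<in> fermionic_space V \<beta>4"
    and q: "q \<in> simplex_region t" "t > 0" and f: "f \<in> restricted_dual V"
  shows "corr (\<lambda>u. f (md V A 0 u)) v B1 B2 B3 B4 t q =
    sg \<beta>1 * sg \<beta>2 * sg \<beta>3 * sg \<beta>4 * corr f (md V A 0 v) B1 B2 B3 B4 t q +
    corr f v (md V A 0 B1) B2 B3 B4 t q + sg \<beta>1 * corr f v B1 (md V A 0 B2) B3 B4 t q +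
    sg \<beta>1 * sg \<beta>2 * corr f v B1 B2 (md V A 0 B3) B4 t q +
    sg \<beta>1 * sg \<beta>2 * sg \<beta>3 * corr f v B1 B2 B3 (md V A 0 B4) t q"
proof -
  obtain x y z where q': "q = (x, y, z)" by (cases q)
  show ?thesis
    using mel_bracket3[OF A B(1-3), of "[]" x y z "[Vertex B4 t]" f v]
      mel_bracket1[OF A B(4), of "[Vertex B1 x, Vertex B2 y, Vertex B3 z]" t "[]" f v]
      mel_Mode_last[of "[Vertex B1 x, Vertex B2 y, Vertex B3 z, Vertex B4 t]" f A 0 v] q f
    by (simp add: q' corr_def simplex_region_def mel_Mode algebra_simps)
qed

lemma corr_vertex_add:
  assumes q: "q \<in> simplex_region t" "t > 0" and f: "f \<in> restricted_dual V"
  shows "corr f v (A + A') B C D t q = corr f v A B C D t q + corr f v A' B C D t q"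
    "corr f v A (B + B') C D t q = corr f v A B C D t q + corr f v A B' C D t q"
    "corr f v A B (C + C') D t q = corr f v A B C D t q + corr f v A B C' D t q"
proof -
  obtain x y z where q': "q = (x, y, z)" by (cases q)
  show "corr f v (A + A') B C D t q = corr f v A B C D t q + corr f v A' B C D t q"
    using mel_vertex_lincomb[of "[]" x "[Vertex B y, Vertex C z, Vertex D t]" f 1 A 1 A' v] q f
    by (simp add: q' corr_def simplex_region_def)
  show "corr f v A (B + B') C D t q = corr f v A B C D t q + corr f v A B' C D t q"
    using mel_vertex_lincomb[of "[Vertex A x]" y "[Vertex C z, Vertex D t]" f 1 B 1 B' v] q f
    by (simp add: q' corr_def simplex_region_def)
  show "corr f v A B (C + C') D t q = corr f v A B C D t q + corr f v A B C' D t q"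
    using mel_vertex_lincomb[of "[Vertex A x, Vertex B y]" z "[Vertex D t]" f 1 C 1 C' v] q f
    by (simp add: q' corr_def simplex_region_def)
qed

end

section \<open>Brackets with \<open>b\<^sub>-\<^sub>1\<close>\<close>

lemma value_times: "opex_value (X * Y) \<phi> = opex_value X (\<lambda>w. opex_value Y (\<lambda>w'. \<phi> (w @ w')))"
  by (simp add: times_opex_def)

lemma value_plus:
  "opex_value X \<phi> = Some a \<Longrightarrow> opex_value Y \<phi> = Some b \<Longrightarrow> opex_value (X + Y) \<phi> = Some (a + b)"
  by (simp add: plus_opex_def)

lemma value_diff:
  "opex_value X \<phi> = Some a \<Longrightarrow> opex_value Y \<phi> = Some b \<Longrightarrow> opex_value (X - Y) \<phi> = Some (a - b)"
  by (simp add: minus_opex_def)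

lemma value_scale: "opex_value X \<phi> = Some a \<Longrightarrow> opex_value (c \<cdot> X) \<phi> = Some (c * a)"
  by simp

lemma integral_opt_eq:
  assumes "\<And>s. s \<in> S \<Longrightarrow> g s = Some (h s)" "h integrable_on S"
  shows "integral_opt S g = Some (integral S h)"
proof -
  have "(\<lambda>s. the (g s)) integrable_on S"
    using assms by (subst integrable_cong[where g = h]) auto
  moreover have "integral S (\<lambda>s. the (g s)) = integral S h"
    using assms(1) by (intro integral_cong) auto
  ultimately show ?thesis using assms(1) by (auto simp: integral_opt_def)
qed

lemma value_OInt:
  assumes "\<And>s. s \<in> S \<Longrightarrow> opex_value (X s) \<phi> = Some (h s)" "h integrable_on S"
  shows "opex_value (OInt S X) \<phi> = Some (integral S h)"
  by (simp add: integral_opt_eq assms)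

lemma value_bbr:
  assumes "opex_value X (\<lambda>w. \<phi> (Mode (elb V) 0 # w)) = Some p"
    and "opex_value X (\<lambda>w. \<phi> (w @ [Mode (elb V) 0])) = Some r"
  shows "opex_value (bbr V d X) \<phi> = Some (p - sg d * r)"
  using assms by (simp add: bbr_def minus_opex_def times_opex_def sg_minus)

text \<open>Expanding the bracket gives two separate integrals, each of which must exist. The value
  of the right product is recovered from h1 and h, so integrability of these two is enough.\<close>

lemma value_bbr_OInt:
  assumes b: "\<And>s. s \<in> S \<Longrightarrow> opex_value (X s) (\<lambda>w. \<phi> (Mode (elb V) 0 # w)) = Some (h1 s)"
    and h: "\<And>s. s \<in> S \<Longrightarrow> opex_value (bbr V d (X s)) \<phi> = Some (h s)"
    and int: "h1 integrable_on S" "h integrable_on S"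
  shows "opex_value (bbr V d (OInt S X)) \<phi> = Some (integral S h)"
proof -
  have right: "opex_value (X s) (\<lambda>w. \<phi> (w @ [Mode (elb V) 0])) = Some (sg d * (h1 s - h s))" if "s \<in> S" for s
  proof -
    from h[OF that] b[OF that] obtain r where r: "opex_value (X s) (\<lambda>w. \<phi> (w @ [Mode (elb V) 0])) = Some r"
      by (auto simp: bbr_def minus_opex_def times_opex_def bind_eq_Some_conv)
    with value_bbr[OF b[OF that] r, of d] h[OF that] show ?thesis by simp
  qed
  have int': "(\<lambda>s. sg d * (h1 s - h s)) integrable_on S"
    using integrable_on_mult_right[OF integrable_diff[OF int], of "sg d"] by simp
  have "opex_value (bbr V d (OInt S X)) \<phi> = Some (integral S h1 - sg d * integral S (\<lambda>s. sg d * (h1 s - h s)))"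
    by (intro value_bbr value_OInt b right int int')
  also have "integral S (\<lambda>s. sg d * (h1 s - h s)) = sg d * (integral S h1 - integral S h)"
    using int by (simp add: integral_mult_right integral_diff)
  finally show ?thesis by simp
qed

lemma value_bbr_OInt_times:
  assumes "\<And>s. s \<in> S \<Longrightarrow> opex_value (X s * Z) (\<lambda>w. \<phi> (Mode (elb V) 0 # w)) = Some (h1 s)"
    and "\<And>s. s \<in> S \<Longrightarrow> opex_value (bbr V d (X s * Z)) \<phi> = Some (h s)"
    and "h1 integrable_on S" "h integrable_on S"
  shows "opex_value (bbr V d (OInt S X * Z)) \<phi> = Some (integral S h)"
proof -
  have "opex_value (bbr V d (OInt S X * Z)) \<phi> = opex_value (bbr V d (OInt S (\<lambda>s. X s * Z))) \<phi>"
    by (simp add: bbr_def minus_opex_def times_opex_def)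
  with value_bbr_OInt[OF assms] show ?thesis by simp
qed

lemma value_op_n:
  assumes "opex_value (op_at (op_n' V r p q X Y Z) s) \<psi> = Some c" "opex_value (op_at (op_pair r (op_m V p X Y) Z) s) \<psi> = Some d"
  shows "opex_value (op_at (op_n V r p q X Y Z) s) \<psi> = Some (c + d)"
  unfolding op_n_def fam.sel by (rule value_plus[OF assms])

context topological_voa
begin

abbreviation b :: "'v \<Rightarrow> 'v" where "b A \<equiv> md V (elb V) 0 A"
abbreviation b0 :: "'v letter" where "b0 \<equiv> Mode (elb V) 0"
abbreviation vx :: "'v \<Rightarrow> real \<Rightarrow> 'v opex" where "vx A s \<equiv> Letter (Vertex A s)"

lemma odd_b: "odd_zero_mode (elb V)" and odd_J: "odd_zero_mode (elJ V)"
  unfolding odd_zero_mode_def using b_graded J_graded by (metis odd_one even_minus)+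

lemma b_mem: "A \<in> fermionic_space V a \<Longrightarrow> b A \<in> fermionic_space V (a - 1)"
  using fermionic_space_md[OF b_graded, of A a 0] by simp

lemma Q_mem: "A \<in> fermionic_space V a \<Longrightarrow> Qop V A \<in> fermionic_space V (a + 1)"
  using fermionic_space_md[OF J_graded, of A a 0] by (simp add: Qop_def add.commute)

lemma b_b [simp]: "b (b A) = 0"
  using b_minus_one_square[of A] by (simp add: bmode_def)

text \<open>[b_{-1}, B(s)] = (b B)(s), stated between arbitrary letters l and r because products are
  evaluated by concatenating words.\<close>

lemma value_bbr1:
  assumes B: "B \<in> fermionic_space V \<beta>" and good: "good_args (word_args l @ s # word_args r)" and f: "f \<in> restricted_dual V"
  shows "opex_value (bbr V \<beta> (vx B s)) (\<lambda>w. word_mel V f v (l @ w @ r)) =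
    Some (mel f (l @ Vertex (b B) s # r) v)"
proof -
  have "opex_value (bbr V \<beta> (vx B s)) (\<lambda>w. word_mel V f v (l @ w @ r)) =
    Some (mel f (l @ b0 # Vertex B s # r) v - sg \<beta> * mel f (l @ Vertex B s # b0 # r) v)"
    by (rule value_bbr) (use good in \<open>auto simp: word_mel_eq[OF f]\<close>)
  then show ?thesis using mel_bracket1[OF odd_b B good f, of v] by simp
qed

lemma value_bbr2:
  assumes B: "B1 \<in> fermionic_space V \<beta>1" "B2 \<in> fermionic_space V \<beta>2"
    and good: "good_args (word_args l @ s1 # s2 # word_args r)" and f: "f \<in> restricted_dual V"
    and d: "sg d = sg \<beta>1 * sg \<beta>2"
  shows "opex_value (bbr V d (vx B1 s1 * vx B2 s2)) (\<lambda>w. word_mel V f v (l @ w @ r)) =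
    Some (mel f (l @ Vertex (b B1) s1 # Vertex B2 s2 # r) v + sg \<beta>1 * mel f (l @ Vertex B1 s1 # Vertex (b B2) s2 # r) v)"
proof -
  have "opex_value (bbr V d (vx B1 s1 * vx B2 s2)) (\<lambda>w. word_mel V f v (l @ w @ r)) =
    Some (mel f (l @ b0 # Vertex B1 s1 # Vertex B2 s2 # r) v -
      sg d * mel f (l @ Vertex B1 s1 # Vertex B2 s2 # b0 # r) v)"
    by (rule value_bbr) (use good in \<open>auto simp: word_mel_eq[OF f] value_times\<close>)
  then show ?thesis using mel_bracket2[OF odd_b B good f, of v] by (simp add: d)
qed

lemma value_bbr3:
  assumes B: "B1 \<in> fermionic_space V \<beta>1" "B2 \<in> fermionic_space V \<beta>2" "B3 \<in> fermionic_space V \<beta>3"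
    and good: "good_args (word_args l @ s1 # s2 # s3 # word_args r)" and f: "f \<in> restricted_dual V"
    and d: "sg d = sg \<beta>1 * sg \<beta>2 * sg \<beta>3"
    and X: "X \<in> {vx B1 s1 * (vx B2 s2 * vx B3 s3),
      vx B1 s1 * vx B2 s2 * vx B3 s3}"
  shows "opex_value (bbr V d X) (\<lambda>w. word_mel V f v (l @ w @ r)) =
    Some (mel f (l @ Vertex (b B1) s1 # Vertex B2 s2 # Vertex B3 s3 # r) v +
      sg \<beta>1 * mel f (l @ Vertex B1 s1 # Vertex (b B2) s2 # Vertex B3 s3 # r) v +
      sg \<beta>1 * sg \<beta>2 * mel f (l @ Vertex B1 s1 # Vertex B2 s2 # Vertex (b B3) s3 # r) v)"
proof -
  have "opex_value (bbr V d X) (\<lambda>w. word_mel V f v (l @ w @ r)) =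
    Some (mel f (l @ b0 # Vertex B1 s1 # Vertex B2 s2 # Vertex B3 s3 # r) v -
      sg d * mel f (l @ Vertex B1 s1 # Vertex B2 s2 # Vertex B3 s3 # b0 # r) v)"
    by (rule value_bbr) (use good X in \<open>auto simp: word_mel_eq[OF f] value_times\<close>)
  then show ?thesis using mel_bracket3[OF odd_b B good f, of v] by (simp add: d)
qed

lemma good_args4: "(x, y, z) \<in> simplex_region t \<Longrightarrow> t > 0 \<Longrightarrow> good_args [x, y, z, t]"
  by (auto simp: simplex_region_def)

lemma value_bbr_bbr:
  assumes A: "A2 \<in> fermionic_space V a2" "A3 \<in> fermionic_space V a3"
    and q: "(x, y, z) \<in> simplex_region t" "t > 0" and f: "f \<in> restricted_dual V"
  shows "opex_value (bbr V a2 (vx A2 y) * bbr V a3 (vx A3 z))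
      (\<lambda>w. word_mel V f v (Vertex A1 x # w @ [Vertex A4 t])) = Some (corr f v A1 (b A2) (b A3) A4 t (x, y, z))"
proof -
  note good = good_args4[OF q]
  have "opex_value (bbr V a3 (vx A3 z)) (\<lambda>w. word_mel V f v (Vertex A1 x # b0 # Vertex A2 y # w @ [Vertex A4 t]))
     = Some (mel f [Vertex A1 x, b0, Vertex A2 y, Vertex (b A3) z, Vertex A4 t] v)"
    using value_bbr1[OF A(2) _ f, of "[Vertex A1 x, b0, Vertex A2 y]" z "[Vertex A4 t]" v] good by simp
  moreover have "opex_value (bbr V a3 (vx A3 z)) (\<lambda>w. word_mel V f v (Vertex A1 x # Vertex A2 y # b0 # w @ [Vertex A4 t]))
     = Some (mel f [Vertex A1 x, Vertex A2 y, b0, Vertex (b A3) z, Vertex A4 t] v)"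
    using value_bbr1[OF A(2) _ f, of "[Vertex A1 x, Vertex A2 y, b0]" z "[Vertex A4 t]" v] good by simp
  ultimately have "opex_value (bbr V a2 (vx A2 y) * bbr V a3 (vx A3 z))
      (\<lambda>w. word_mel V f v (Vertex A1 x # w @ [Vertex A4 t])) =
    Some (mel f [Vertex A1 x, b0, Vertex A2 y, Vertex (b A3) z, Vertex A4 t] v -
      sg a2 * mel f [Vertex A1 x, Vertex A2 y, b0, Vertex (b A3) z, Vertex A4 t] v)"
    unfolding value_times by (intro value_bbr) auto
  also have "\<dots> = Some (corr f v A1 (b A2) (b A3) A4 t (x, y, z))"
    using mel_bracket1[OF odd_b A(1) _ f, of "[Vertex A1 x]" y "[Vertex (b A3) z, Vertex A4 t]" v] good
    by (simp add: corr_def)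
  finally show ?thesis .
qed

lemma value_bbr2_bbr:
  assumes A: "A1 \<in> fermionic_space V a1" "A2 \<in> fermionic_space V a2" "A3 \<in> fermionic_space V a3"
    and q: "(x, y, z) \<in> simplex_region t" "t > 0" and f: "f \<in> restricted_dual V"
  shows "opex_value (bbr V (a1 + a2) (vx A1 x * vx A2 y))
      (\<lambda>w. opex_value (bbr V a3 (vx A3 z)) (\<lambda>w'. word_mel V f v (w @ w' @ [Vertex A4 t]))) =
    Some (corr f v (b A1) A2 (b A3) A4 t (x, y, z) + sg a1 * corr f v A1 (b A2) (b A3) A4 t (x, y, z))"
proof -
  note good = good_args4[OF q]
  have "opex_value (bbr V a3 (vx A3 z)) (\<lambda>w. word_mel V f v (b0 # Vertex A1 x # Vertex A2 y # w @ [Vertex A4 t]))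
     = Some (mel f [b0, Vertex A1 x, Vertex A2 y, Vertex (b A3) z, Vertex A4 t] v)"
    using value_bbr1[OF A(3) _ f, of "[b0, Vertex A1 x, Vertex A2 y]" z "[Vertex A4 t]" v] good by simp
  moreover have "opex_value (bbr V a3 (vx A3 z)) (\<lambda>w. word_mel V f v (Vertex A1 x # Vertex A2 y # b0 # w @ [Vertex A4 t]))
     = Some (mel f [Vertex A1 x, Vertex A2 y, b0, Vertex (b A3) z, Vertex A4 t] v)"
    using value_bbr1[OF A(3) _ f, of "[Vertex A1 x, Vertex A2 y, b0]" z "[Vertex A4 t]" v] good by simp
  ultimately have "opex_value (bbr V (a1 + a2) (vx A1 x * vx A2 y))
      (\<lambda>w. opex_value (bbr V a3 (vx A3 z)) (\<lambda>w'. word_mel V f v (w @ w' @ [Vertex A4 t]))) =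
    Some (mel f [b0, Vertex A1 x, Vertex A2 y, Vertex (b A3) z, Vertex A4 t] v -
      sg (a1 + a2) * mel f [Vertex A1 x, Vertex A2 y, b0, Vertex (b A3) z, Vertex A4 t] v)"
    by (intro value_bbr) (auto simp: value_times)
  also have "\<dots> = Some (corr f v (b A1) A2 (b A3) A4 t (x, y, z) + sg a1 * corr f v A1 (b A2) (b A3) A4 t (x, y, z))"
    using mel_bracket2[OF odd_b A(1,2) _ f, of "[]" x y "[Vertex (b A3) z, Vertex A4 t]" v] good
    by (simp add: corr_def sg_simps)
  finally show ?thesis .
qed

lemma corr_0:
  assumes "q \<in> simplex_region t" "t > 0" "f \<in> restricted_dual V"
  shows "corr f v 0 B C D t q = 0" "corr f v A 0 C D t q = 0" "corr f v A B 0 D t q = 0"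
proof -
  obtain x y z where q: "q = (x, y, z)" by (cases q)
  with good_args4 assms have good: "good_args [x, y, z, t]" by blast
  show "corr f v 0 B C D t q = 0" "corr f v A 0 C D t q = 0" "corr f v A B 0 D t q = 0"
    using mel_vertex_0[OF _ assms(3), of "[]" x "[Vertex B y, Vertex C z, Vertex D t]" v]
      mel_vertex_0[OF _ assms(3), of "[Vertex A x]" y "[Vertex C z, Vertex D t]" v]
      mel_vertex_0[OF _ assms(3), of "[Vertex A x, Vertex B y]" z "[Vertex D t]" v] good
    by (auto simp: corr_def q)
qed

lemma value_left_b_bbr2:
  assumes A: "A1 \<in> fermionic_space V a1" "A2 \<in> fermionic_space V a2"
    and q: "(x, y, z) \<in> simplex_region t" "t > 0" and f: "f \<in> restricted_dual V"
  shows "opex_value (bbr V (a1 + a2) (vx A1 x * vx A2 y) * vx A3 z)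
      (\<lambda>w. word_mel V f v (b0 # w @ [Vertex A4 t])) =
    Some (corr (\<lambda>u. f (b u)) v (b A1) A2 A3 A4 t (x, y, z) + sg a1 * corr (\<lambda>u. f (b u)) v A1 (b A2) A3 A4 t (x, y, z))"
  using value_bbr2[OF A _ f, of "[b0]" x y "[Vertex A3 z, Vertex A4 t]" "a1 + a2" v] good_args4[OF q]
  by (simp add: value_times corr_def mel_Mode sg_simps)

text \<open>The outer bracket acting on a slot that already carries b gives zero, and the two terms
  with b on both A1 and A2 cancel by sign. This is why no K12 occurs on the faces coming from nested
  m.\<close>

lemma value_bbr_bbr2:
  assumes A: "A1 \<in> fermionic_space V a1" "A2 \<in> fermionic_space V a2" "A3 \<in> fermionic_space V a3"
    and q: "(x, y, z) \<in> simplex_region t" "t > 0" and f: "f \<in> restricted_dual V"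
  shows "opex_value (bbr V (a1 + a2 - 1 + a3) (bbr V (a1 + a2) (vx A1 x * vx A2 y) * vx A3 z))
      (\<lambda>w. word_mel V f v (w @ [Vertex A4 t])) =
    Some (sg (a1 + a2 - 1) * corr f v (b A1) A2 (b A3) A4 t (x, y, z) - sg a2 * corr f v A1 (b A2) (b A3) A4 t (x, y, z))"
proof -
  note good = good_args4[OF q]
  have "opex_value (bbr V (a1 + a2) (vx A1 x * vx A2 y) * vx A3 z)
      (\<lambda>w. word_mel V f v ((w @ [b0]) @ [Vertex A4 t])) =
    Some (mel f [Vertex (b A1) x, Vertex A2 y, Vertex A3 z, b0, Vertex A4 t] v +
      sg a1 * mel f [Vertex A1 x, Vertex (b A2) y, Vertex A3 z, b0, Vertex A4 t] v)"
    using value_bbr2[OF A(1,2) _ f, of "[]" x y "[Vertex A3 z, b0, Vertex A4 t]" "a1 + a2" v] good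
    by (simp add: value_times sg_simps)
  note val = value_bbr[of _ "\<lambda>w. word_mel V f v (w @ [Vertex A4 t])", OF value_left_b_bbr2[OF A(1,2) q f, of A3 v A4, folded append_Cons] this, of "a1 + a2 - 1 + a3"]
  have "mel (\<lambda>u. f (b u)) [Vertex (b A1) x, Vertex A2 y, Vertex A3 z, Vertex A4 t] v =
    sg (a1 - 1) * sg a2 * sg a3 * mel f [Vertex (b A1) x, Vertex A2 y, Vertex A3 z, b0, Vertex A4 t] v +
    sg (a1 - 1) * mel f [Vertex (b A1) x, Vertex (b A2) y, Vertex A3 z, Vertex A4 t] v +
    sg (a1 - 1) * sg a2 * mel f [Vertex (b A1) x, Vertex A2 y, Vertex (b A3) z, Vertex A4 t] v"
    using mel_bracket3[OF odd_b b_mem[OF A(1)] A(2,3) _ f, of "[]" x y z "[Vertex A4 t]" v] good corr_0(1)[OF q f, of v]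
    by (simp add: mel_Mode corr_def)
  moreover have "mel (\<lambda>u. f (b u)) [Vertex A1 x, Vertex (b A2) y, Vertex A3 z, Vertex A4 t] v =
    sg a1 * sg (a2 - 1) * sg a3 * mel f [Vertex A1 x, Vertex (b A2) y, Vertex A3 z, b0, Vertex A4 t] v +
    mel f [Vertex (b A1) x, Vertex (b A2) y, Vertex A3 z, Vertex A4 t] v +
    sg a1 * sg (a2 - 1) * mel f [Vertex A1 x, Vertex (b A2) y, Vertex (b A3) z, Vertex A4 t] v"
    using mel_bracket3[OF odd_b A(1) b_mem[OF A(2)] A(3) _ f, of "[]" x y z "[Vertex A4 t]" v] good corr_0(2)[OF q f, of v]
    by (simp add: mel_Mode corr_def)
  ultimately show ?thesis using val by (simp add: corr_def sg_simps ring_distribs mult_ac)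
qed

lemma value_left_b_mid:
  assumes A: "A2 \<in> fermionic_space V a2"
    and q: "(x, y, z) \<in> simplex_region t" "t > 0" and f: "f \<in> restricted_dual V"
  shows "opex_value (c \<cdot> (vx A1 x * bbr V a2 (vx A2 y) * vx A3 z))
      (\<lambda>w. word_mel V f v (b0 # w @ [Vertex A4 t])) =
    Some (c * corr (\<lambda>u. f (b u)) v A1 (b A2) A3 A4 t (x, y, z))"
  using value_bbr1[OF A _ f, of "[b0, Vertex A1 x]" y "[Vertex A3 z, Vertex A4 t]" v] good_args4[OF q]
  by (simp add: value_times corr_def mel_Mode)

text \<open>The middle slot already carries b, so the outer bracket reaches only the first and third
  slots; hence K12 and K23, but no K13, on \<open>face_mt\<close>.\<close>

lemma value_bbr_mid:
  assumes A: "A1 \<in> fermionic_space V a1" "A2 \<in> fermionic_space V a2" "A3 \<in> fermionic_space V a3"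
    and q: "(x, y, z) \<in> simplex_region t" "t > 0" and f: "f \<in> restricted_dual V"
  shows "opex_value (bbr V (a1 + a2 + a3 - 1) (sg a1 \<cdot> (vx A1 x * bbr V a2 (vx A2 y) * vx A3 z)))
      (\<lambda>w. word_mel V f v (w @ [Vertex A4 t])) =
    Some (sg a1 * corr f v (b A1) (b A2) A3 A4 t (x, y, z) - sg a2 * corr f v A1 (b A2) (b A3) A4 t (x, y, z))"
proof -
  note good = good_args4[OF q]
  have "opex_value (sg a1 \<cdot> (vx A1 x * bbr V a2 (vx A2 y) * vx A3 z))
      (\<lambda>w. word_mel V f v ((w @ [b0]) @ [Vertex A4 t])) =
    Some (sg a1 * mel f [Vertex A1 x, Vertex (b A2) y, Vertex A3 z, b0, Vertex A4 t] v)"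
    using value_bbr1[OF A(2) _ f, of "[Vertex A1 x]" y "[Vertex A3 z, b0, Vertex A4 t]" v] good
    by (simp add: value_times)
  note val = value_bbr[of _ "\<lambda>w. word_mel V f v (w @ [Vertex A4 t])", OF value_left_b_mid[OF A(2) q f, of "sg a1" A1 A3 v A4, folded append_Cons] this, of "a1 + a2 + a3 - 1"]
  have "mel (\<lambda>u. f (b u)) [Vertex A1 x, Vertex (b A2) y, Vertex A3 z, Vertex A4 t] v =
    sg a1 * sg (a2 - 1) * sg a3 * mel f [Vertex A1 x, Vertex (b A2) y, Vertex A3 z, b0, Vertex A4 t] v +
    mel f [Vertex (b A1) x, Vertex (b A2) y, Vertex A3 z, Vertex A4 t] v +
    sg a1 * sg (a2 - 1) * mel f [Vertex A1 x, Vertex (b A2) y, Vertex (b A3) z, Vertex A4 t] v"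
    using mel_bracket3[OF odd_b A(1) b_mem[OF A(2)] A(3) _ f, of "[]" x y z "[Vertex A4 t]" v] good corr_0(2)[OF q f, of v]
    by (simp add: mel_Mode corr_def)
  with val show ?thesis by (simp add: corr_def sg_simps ring_distribs mult_ac)
qed

end

section \<open>The two sides of the pentagon relation\<close>

lemma double_integral_integrable:
  fixes h :: "real \<Rightarrow> real \<Rightarrow> complex"
  assumes "continuous_on ({a..b} \<times> {c..d}) (\<lambda>(r, s). h r s)"
  shows "(\<lambda>r. integral {c..d} (h r)) integrable_on {a..b}"
  using integral_continuous_on_param[of "{a..b}" c d h] assms by (intro integrable_continuous_real) simp

locale pentagon_voa = topological_voa V + pentagon_region t \<rho> \<epsilon>1 \<epsilon>2 \<alpha>1 \<alpha>2 \<xi>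
  for V :: "('v :: ab_group_add, 'm) tvoa_scheme" and t \<rho> \<epsilon>1 \<epsilon>2 \<alpha>1 \<alpha>2 \<xi> :: real +
  assumes t: "t > 0"
begin

lemma continuous_corr:
  assumes "f \<in> restricted_dual V"
  shows "continuous_on \<Delta> (corr f v A B C D t)"
  using C1_on_corr[OF assms t] by (simp add: C1_on_def)

lemmas continuous_corr_path = continuous_on_compose3[OF continuous_corr]

end

lemma double_integral_lincomb:
  fixes h h' :: "real \<Rightarrow> real \<Rightarrow> complex"
  assumes "continuous_on ({a..b} \<times> {c..d}) (\<lambda>(r, s). h r s)" "continuous_on ({a..b} \<times> {c..d}) (\<lambda>(r, s). h' r s)"
  shows "integral {a..b} (\<lambda>r. integral {c..d} (\<lambda>s. h r s + e * h' r s)) =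
    integral {a..b} (\<lambda>r. integral {c..d} (h r)) + e * integral {a..b} (\<lambda>r. integral {c..d} (h' r))"
proof -
  have slice: "f r integrable_on {c..d}" if "continuous_on ({a..b} \<times> {c..d}) (\<lambda>(r, s). f r s)" "r \<in> {a..b}"
    for f :: "real \<Rightarrow> real \<Rightarrow> complex" and r
  proof -
    have "continuous_on {c..d} (\<lambda>s. case_prod f (r, s))"
      by (rule continuous_on_compose2[OF that(1)]) (use that(2) in \<open>auto intro!: continuous_intros\<close>)
    then show ?thesis by (intro integrable_continuous_real) simp
  qed
  have "integral {a..b} (\<lambda>r. integral {c..d} (\<lambda>s. h r s + e * h' r s)) =
    integral {a..b} (\<lambda>r. integral {c..d} (h r) + e * integral {c..d} (h' r))"
    by (intro integral_cong)
      (simp add: integral_add slice[OF assms(1)] integrable_on_mult_right[OF slice[OF assms(2)]])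
  also have "\<dots> = integral {a..b} (\<lambda>r. integral {c..d} (h r)) + e * integral {a..b} (\<lambda>r. integral {c..d} (h' r))"
    using assms[THEN double_integral_integrable]
    by (simp add: integral_add integrable_on_mult_right)
  finally show ?thesis .
qed

context pentagon_region
begin

text \<open>The shape k + e l allows a linear combination of several integrands to be split off one
  summand at a time.\<close>

lemma pentagon_sum_lincomb:
  assumes "continuous_on \<Delta> k12" "continuous_on \<Delta> k13" "continuous_on \<Delta> k23"
    and "continuous_on \<Delta> l12" "continuous_on \<Delta> l13" "continuous_on \<Delta> l23"
  shows "pentagon_sum (\<lambda>p. k12 p + e * l12 p) (\<lambda>p. k13 p + e * l13 p) (\<lambda>p. k23 p + e * l23 p) =
    pentagon_sum k12 k13 k23 + e * pentagon_sum l12 l13 l23"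
proof -
  note cont = assms[THEN continuous_on_compose3]
  have P: "continuous_on pent (\<lambda>(x, y). k23 (\<rho> + t, x + t, y + t))"
    "continuous_on pent (\<lambda>(x, y). l23 (\<rho> + t, x + t, y + t))"
    unfolding case_prod_unfold by (intro cont continuous_intros; use pentagon_subset in auto)+
  have 1: "integral pent (\<lambda>(x, y). k23 (\<rho> + t, x + t, y + t) + e * l23 (\<rho> + t, x + t, y + t)) =
    integral pent (\<lambda>(x, y). k23 (\<rho> + t, x + t, y + t)) +
    e * integral pent (\<lambda>(x, y). l23 (\<rho> + t, x + t, y + t))"
    using P[THEN integrable_on_compact[OF compact_pentagon]]
    by (simp add: case_prod_unfold integral_add integrable_on_mult_right)
  have reorder: "k13 p + e * l13 p - (k23 p + e * l23 p) = k13 p - k23 p + e * (l13 p - l23 p)"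
    "k12 p + e * l12 p - (k23 p + e * l23 p) = k12 p - k23 p + e * (l12 p - l23 p)" for p
    by (simp_all add: algebra_simps)
  have face: "integral {a..b} (\<lambda>r. integral {c..d} (\<lambda>s. (F (p r s) - k23 (p r s)) + e * (G (p r s) - l23 (p r s)))) =
      integral {a..b} (\<lambda>r. integral {c..d} (\<lambda>s. F (p r s) - k23 (p r s))) +
      e * integral {a..b} (\<lambda>r. integral {c..d} (\<lambda>s. G (p r s) - l23 (p r s)))"
    if F: "continuous_on \<Delta> F" "continuous_on \<Delta> G"
      and p: "continuous_on ({a..b} \<times> {c..d}) (\<lambda>(r, s). p r s)" "\<And>r s. r \<in> {a..b} \<Longrightarrow> s \<in> {c..d} \<Longrightarrow> p r s \<in> \<Delta>"
    for a b c d :: real and p F G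
  proof -
    have "continuous_on ({a..b} \<times> {c..d}) (\<lambda>x. H (p (fst x) (snd x)))"
      if "continuous_on \<Delta> H" for H :: "_ \<Rightarrow> complex"
      by (rule continuous_on_compose2[OF that p(1)[unfolded case_prod_unfold]]) (use p(2) in auto)
    then show ?thesis
      by (intro double_integral_lincomb) (auto simp: case_prod_unfold F assms intro!: continuous_intros)
  qed
  show ?thesis
    unfolding pentagon_sum_def reorder 1
    by (subst (1 2 3) face; (use pos gaps assms in \<open>auto simp: simplex_region_def case_prod_unfold intro!: continuous_intros\<close>)?)
      (simp add: algebra_simps)
qed

lemma pentagon_sum_cong:
  assumes "\<And>p. p \<in> \<Delta> \<Longrightarrow> k12 p = l12 p" "\<And>p. p \<in> \<Delta> \<Longrightarrow> k13 p = l13 p"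
    "\<And>p. p \<in> \<Delta> \<Longrightarrow> k23 p = l23 p"
  shows "pentagon_sum k12 k13 k23 = pentagon_sum l12 l13 l23"
  unfolding pentagon_sum_def
  by (intro arg_cong2[where f = "(+)"] arg_cong[where f = uminus] integral_cong)
    (use pos gaps in \<open>auto simp: assms pentagon_def simplex_region_def\<close>)

end

locale pentagon_vertices = pentagon_voa V t \<rho> \<epsilon>1 \<epsilon>2 \<alpha>1 \<alpha>2 \<xi>
  for V :: "('v :: ab_group_add, 'm) tvoa_scheme" and t \<rho> \<epsilon>1 \<epsilon>2 \<alpha>1 \<alpha>2 \<xi> :: real +
  fixes A1 A2 A3 A4 :: 'v and a1 a2 a3 a4 :: int and f :: "'v \<Rightarrow> complex" and v :: 'v
  assumes A: "A1 \<in> fermionic_space V a1" "A2 \<in> fermionic_space V a2" "A3 \<in> fermionic_space V a3" "A4 \<in> fermionic_space V a4"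
    and f: "f \<in> restricted_dual V"
begin

text \<open>The signs are those of moving b past the operators to its left, so that the value of a
  bracket is the plain sum of the components of its slots.\<close>

definition U1 where "U1 p = corr f v (b A1) A2 A3 A4 t p"
definition U2 where "U2 p = sg a1 * corr f v A1 (b A2) A3 A4 t p"
definition U3 where "U3 p = sg a1 * sg a2 * corr f v A1 A2 (b A3) A4 t p"

lemma continuous_U:
  "continuous_on \<Delta> U1" "continuous_on \<Delta> U2" "continuous_on \<Delta> U3"
  unfolding U1_def[abs_def] U2_def[abs_def] U3_def[abs_def] by (intro continuous_intros continuous_corr f)+

lemmas continuous_U_path = continuous_U[THEN continuous_on_compose3]

abbreviation \<phi> :: "'v letter list \<Rightarrow> complex option" where "\<phi> \<equiv> word_mel V f v"

abbreviation X1 :: "'v fam" where "X1 \<equiv> vertex a1 A1"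
abbreviation X2 :: "'v fam" where "X2 \<equiv> vertex a2 A2"
abbreviation X3 :: "'v fam" where "X3 \<equiv> vertex a3 A3"
abbreviation X4 :: "'v fam" where "X4 \<equiv> vertex a4 A4"
abbreviation P where "P \<equiv> op_p V \<rho> \<xi> \<alpha>1 \<alpha>2 \<epsilon>1 \<epsilon>2"

section \<open>Values of the summands of p as face integrals\<close>

lemma value_op_p':
  "opex_value (op_at (op_p' V \<rho> \<xi> \<alpha>1 \<alpha>2 \<epsilon>1 \<epsilon>2 X1 X2 X3 X4) t) \<phi> =
    Some (- integral pent (\<lambda>(x, y). sg a2 * corr f v A1 (b A2) (b A3) A4 t (\<rho> + t, x + t, y + t)))"
proof -
  let ?P = pent
  let ?h = "\<lambda>(x, y). corr f v A1 (b A2) (b A3) A4 t (\<rho> + t, x + t, y + t)"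
  have "continuous_on ?P (\<lambda>p. corr f v A1 (b A2) (b A3) A4 t (\<rho> + t, fst p + t, snd p + t))"
    by (intro continuous_corr_path f continuous_intros) (use pentagon_subset in auto)
  then have int: "?h integrable_on ?P"
    using integrable_on_compact[OF compact_pentagon] by (simp add: case_prod_unfold)
  have "opex_value (bbr V a2 (Letter (Vertex A2 (x + t))) * bbr V a3 (Letter (Vertex A3 (y + t))))
      (\<lambda>w. \<phi> (Vertex A1 (\<rho> + t) # w @ [Vertex A4 t])) = Some (?h (x, y))" if "(x, y) \<in> ?P" for x y
    using value_bbr_bbr[OF A(2,3) pentagon_subset[OF that] t f] by simp
  then have "integral_opt ?P (\<lambda>p. opex_value (case p of (x, y) \<Rightarrow>
        bbr V a2 (Letter (Vertex A2 (x + t))) * bbr V a3 (Letter (Vertex A3 (y + t))))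
      (\<lambda>w. \<phi> (Vertex A1 (\<rho> + t) # w @ [Vertex A4 t]))) = Some (integral ?P ?h)"
    by (intro integral_opt_eq int) auto
  then show ?thesis
    by (simp add: op_p'_def vertex_def int_dx_dy_def value_times case_prod_unfold)
qed

lemma value_op_n'_op_m:
  "opex_value (op_at (op_n' V \<rho> \<alpha>2 \<epsilon>1 (op_m V \<alpha>1 X1 X2) X3 X4) t) \<phi> =
    Some (integral {\<epsilon>1..\<rho> - \<alpha>2} (\<lambda>r. integral {-\<alpha>1..0} (\<lambda>s.
      let p = face_n r s in
      sg (a1 + a2 - 1) * corr f v (b A1) A2 (b A3) A4 t p - sg a2 * corr f v A1 (b A2) (b A3) A4 t p)))"
proof -
  let ?p = face_n
  let ?h = "\<lambda>r s. corr f v (b A1) A2 (b A3) A4 t (?p r s) + sg a1 * corr f v A1 (b A2) (b A3) A4 t (?p r s)"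
  have R: "?p r s \<in> \<Delta>" if "r \<in> {\<epsilon>1..\<rho> - \<alpha>2}" "s \<in> {-\<alpha>1..0}" for r s
    using that pos gaps by (auto simp: simplex_region_def)
  have inner: "opex_value (OInt {-\<alpha>1..0} (\<lambda>s. bbr V (a1 + a2) (Letter (Vertex A1 (s + (t + \<rho>) + \<alpha>1)) * Letter (Vertex A2 (s + (t + \<rho>))))))
      (\<lambda>w. opex_value (bbr V a3 (Letter (Vertex A3 (r + t)))) (\<lambda>w'. \<phi> (w @ w' @ [Vertex A4 t]))) =
    Some (integral {-\<alpha>1..0} (?h r))" if r: "r \<in> {\<epsilon>1..\<rho> - \<alpha>2}" for r
  proof (rule value_OInt[OF value_bbr2_bbr[OF A(1-3) R[OF r] t f]])
    show "?h r integrable_on {-\<alpha>1..0}"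
      by (intro integrable_continuous_real continuous_intros continuous_corr_path f) (use R[OF r] in auto)
  qed
  have "continuous_on ({\<epsilon>1..\<rho> - \<alpha>2} \<times> {-\<alpha>1..0}) (\<lambda>(r, s). sg (a1 + a2 - 1) * ?h r s)"
    unfolding case_prod_unfold by (intro continuous_intros continuous_corr_path f) (use R in auto)
  note int = double_integral_integrable[OF this]
  have "opex_value (op_at (op_n' V \<rho> \<alpha>2 \<epsilon>1 (op_m V \<alpha>1 X1 X2) X3 X4) t) \<phi> =
    Some (integral {\<epsilon>1..\<rho> - \<alpha>2} (\<lambda>r. integral {-\<alpha>1..0} (\<lambda>s. sg (a1 + a2 - 1) * ?h r s)))"
    unfolding op_n'_def fam.sel
  proof (rule value_OInt[OF _ int])
    fix r assume r: "r \<in> {\<epsilon>1..\<rho> - \<alpha>2}"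
    have eq: "integral {-\<alpha>1..0} (\<lambda>s. sg (a1 + a2 - 1) * ?h r s) = sg (a1 + a2 - 1) * integral {-\<alpha>1..0} (?h r)"
      by (rule integral_mult_right)
    show "opex_value (sg (deg (op_m V \<alpha>1 X1 X2)) \<cdot> (op_at (op_m V \<alpha>1 X1 X2) (t + \<rho>) *
        bbr V (deg X3) (op_at X3 (r + t)) * op_at X4 t)) \<phi> =
      Some (integral {-\<alpha>1..0} (\<lambda>s. sg (a1 + a2 - 1) * ?h r s))"
      unfolding eq using inner[OF r] by (simp add: op_m_def vertex_def value_times del: opex_value.simps(5))
  qed
  also have "(\<lambda>r. integral {-\<alpha>1..0} (\<lambda>s. sg (a1 + a2 - 1) * ?h r s)) = (\<lambda>r. integral {-\<alpha>1..0} (\<lambda>s.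
      let p = ?p r s in sg (a1 + a2 - 1) * corr f v (b A1) A2 (b A3) A4 t p - sg a2 * corr f v A1 (b A2) (b A3) A4 t p))"
    by (simp add: Let_def sg_simps ring_distribs mult_ac)
  finally show ?thesis .
qed

lemma value_op_m_op_m:
  "opex_value (op_at (op_pair \<rho> (op_m V \<alpha>2 (op_m V \<alpha>1 X1 X2) X3) X4) t) \<phi> =
    Some (integral {-\<alpha>2..0} (\<lambda>r. integral {-\<alpha>1..0} (\<lambda>s.
      let p = face_m r s in
      sg (a1 + a2 - 1) * corr f v (b A1) A2 (b A3) A4 t p - sg a2 * corr f v A1 (b A2) (b A3) A4 t p)))"
proof -
  let ?p = face_m
  let ?h = "\<lambda>r s. sg (a1 + a2 - 1) * corr f v (b A1) A2 (b A3) A4 t (?p r s) - sg a2 * corr f v A1 (b A2) (b A3) A4 t (?p r s)"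
  let ?X = "\<lambda>r. bbr V (a1 + a2 - 1 + a3) (OInt {-\<alpha>1..0} (\<lambda>s. bbr V (a1 + a2)
        (Letter (Vertex A1 (s + (r + (t + \<rho>) + \<alpha>2) + \<alpha>1)) * Letter (Vertex A2 (s + (r + (t + \<rho>) + \<alpha>2))))) *
        Letter (Vertex A3 (r + (t + \<rho>))))"
  have fb: "(\<lambda>u. f (b u)) \<in> restricted_dual V" by (rule restricted_dual_md[OF f])
  have R: "?p r s \<in> \<Delta>" if "r \<in> {-\<alpha>2..0}" "s \<in> {-\<alpha>1..0}" for r s
    using that pos gaps by (auto simp: simplex_region_def)
  have inner: "opex_value (?X r) (\<lambda>w. \<phi> (w @ [Vertex A4 t])) =
    Some (integral {-\<alpha>1..0} (?h r))" if r: "r \<in> {-\<alpha>2..0}" for r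
  proof (rule value_bbr_OInt_times[OF value_left_b_bbr2[OF A(1,2) R[OF r] t f, folded append_Cons] value_bbr_bbr2[OF A(1-3) R[OF r] t f]])
    show "?h r integrable_on {-\<alpha>1..0}"
      by (intro integrable_continuous_real continuous_intros continuous_corr_path f) (use R[OF r] in auto)
    show "(\<lambda>s. corr (\<lambda>u. f (b u)) v (b A1) A2 A3 A4 t (?p r s) + sg a1 * corr (\<lambda>u. f (b u)) v A1 (b A2) A3 A4 t (?p r s)) integrable_on {-\<alpha>1..0}"
      by (intro integrable_continuous_real continuous_intros continuous_corr_path fb) (use R[OF r] in auto)
  qed
  have "continuous_on ({-\<alpha>2..0} \<times> {-\<alpha>1..0}) (\<lambda>(r, s). ?h r s)"
    unfolding case_prod_unfold by (intro continuous_intros continuous_corr_path f) (use R in auto)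
  note int = double_integral_integrable[OF this]
  have "opex_value (OInt {-\<alpha>2..0} (\<lambda>r. ?X r)) (\<lambda>w. \<phi> (w @ [Vertex A4 t])) =
    Some (integral {-\<alpha>2..0} (\<lambda>r. integral {-\<alpha>1..0} (?h r)))"
    by (rule value_OInt[OF inner int])
  then show ?thesis by (simp add: op_pair_def op_m_def vertex_def value_times Let_def del: opex_value.simps(5))
qed

lemma value_op_mt:
  "opex_value (op_at (op_pair \<rho> (op_mt V \<alpha>2 \<alpha>1 \<xi> X1 X2 X3) X4) t) \<phi> =
    Some (integral {-\<alpha>2..0} (\<lambda>r. integral {\<xi>..\<alpha>2 - \<alpha>1} (\<lambda>s.
      let p = face_mt r s in
      sg a1 * corr f v (b A1) (b A2) A3 A4 t p - sg a2 * corr f v A1 (b A2) (b A3) A4 t p)))"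
proof -
  let ?p = face_mt
  let ?h = "\<lambda>r s. sg a1 * corr f v (b A1) (b A2) A3 A4 t (?p r s) - sg a2 * corr f v A1 (b A2) (b A3) A4 t (?p r s)"
  let ?X = "\<lambda>r. bbr V (a1 + a2 + a3 - 1) (OInt {\<xi>..\<alpha>2 - \<alpha>1} (\<lambda>s. sg a1 \<cdot>
        (Letter (Vertex A1 (t + \<rho> + r + \<alpha>2)) * bbr V a2 (Letter (Vertex A2 (s + (t + \<rho> + r)))) * Letter (Vertex A3 (t + \<rho> + r)))))"
  have fb: "(\<lambda>u. f (b u)) \<in> restricted_dual V" by (rule restricted_dual_md[OF f])
  have R: "?p r s \<in> \<Delta>" if "r \<in> {-\<alpha>2..0}" "s \<in> {\<xi>..\<alpha>2 - \<alpha>1}" for r s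
    using that pos gaps by (auto simp: simplex_region_def)
  have inner: "opex_value (?X r)
        (\<lambda>w. \<phi> (w @ [Vertex A4 t])) =
    Some (integral {\<xi>..\<alpha>2 - \<alpha>1} (?h r))" if r: "r \<in> {-\<alpha>2..0}" for r
  proof (rule value_bbr_OInt[OF value_left_b_mid[OF A(2) R[OF r] t f, folded append_Cons] value_bbr_mid[OF A(1-3) R[OF r] t f]])
    show "?h r integrable_on {\<xi>..\<alpha>2 - \<alpha>1}"
      by (intro integrable_continuous_real continuous_intros continuous_corr_path f) (use R[OF r] in auto)
    show "(\<lambda>s. sg a1 * corr (\<lambda>u. f (b u)) v A1 (b A2) A3 A4 t (?p r s)) integrable_on {\<xi>..\<alpha>2 - \<alpha>1}"
      by (intro integrable_continuous_real continuous_intros continuous_corr_path fb) (use R[OF r] in auto)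
  qed
  have "continuous_on ({-\<alpha>2..0} \<times> {\<xi>..\<alpha>2 - \<alpha>1}) (\<lambda>(r, s). ?h r s)"
    unfolding case_prod_unfold by (intro continuous_intros continuous_corr_path f) (use R in auto)
  note int = double_integral_integrable[OF this]
  have "opex_value (OInt {-\<alpha>2..0} (\<lambda>r. ?X r))
        (\<lambda>w. \<phi> (w @ [Vertex A4 t])) =
    Some (integral {-\<alpha>2..0} (\<lambda>r. integral {\<xi>..\<alpha>2 - \<alpha>1} (?h r)))"
    by (rule value_OInt[OF inner int])
  then show ?thesis by (simp add: op_pair_def op_mt_def op_n'_def vertex_def value_times Let_def del: opex_value.simps(5))
qed

lemma value_op_p:
  "opex_value (op_at (P X1 X2 X3 X4) t) \<phi> =
    Some (pentagon_sum (\<lambda>p. sg a1 * corr f v (b A1) (b A2) A3 A4 t p)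
      (\<lambda>p. sg (a1 + a2 - 1) * corr f v (b A1) A2 (b A3) A4 t p)
      (\<lambda>p. sg a2 * corr f v A1 (b A2) (b A3) A4 t p))"
proof -
  \<comment> \<open>The operation n is unfolded into its n' and m parts so that the summands are
    grouped as in \<open>pentagon_sum\<close>.\<close>
  have "op_at (P X1 X2 X3 X4) t =
    op_at (op_p' V \<rho> \<xi> \<alpha>1 \<alpha>2 \<epsilon>1 \<epsilon>2 X1 X2 X3 X4) t +
    (op_at (op_n' V \<rho> \<alpha>2 \<epsilon>1 (op_m V \<alpha>1 X1 X2) X3 X4) t +
     op_at (op_pair \<rho> (op_m V \<alpha>2 (op_m V \<alpha>1 X1 X2) X3) X4) t) +
    op_at (op_pair \<rho> (op_mt V \<alpha>2 \<alpha>1 \<xi> X1 X2 X3) X4) t"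
    by (simp add: op_p_def op_n_def)
  then show ?thesis
    unfolding pentagon_sum_def
    by (simp only:)
      (intro value_plus value_op_p'
        value_op_n'_op_m[unfolded Let_def] value_op_m_op_m[unfolded Let_def] value_op_mt[unfolded Let_def])
qed

section \<open>The five right-hand terms as edge integrals\<close>

lemma value_b2:
  assumes "(x, y, z) \<in> \<Delta>"
  shows "opex_value (bbr V a2 (vx A2 y)) (\<lambda>w. \<phi> (Vertex A1 x # w @ [Vertex A3 z, Vertex A4 t])) = Some (sg a1 * U2 (x, y, z))"
  using value_bbr1[OF A(2) _ f, of "[Vertex A1 x]" y "[Vertex A3 z, Vertex A4 t]" v] good_args4[OF assms t]
  by (simp add: corr_def U2_def)

lemma value_b3:
  assumes "(x, y, z) \<in> \<Delta>"
  shows "opex_value (bbr V a3 (vx A3 z)) (\<lambda>w. \<phi> (Vertex A1 x # Vertex A2 y # w @ [Vertex A4 t])) = Some (sg a1 * sg a2 * U3 (x, y, z))"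
  using value_bbr1[OF A(3) _ f, of "[Vertex A1 x, Vertex A2 y]" z "[Vertex A4 t]" v] good_args4[OF assms t]
  by (simp add: corr_def U3_def mult_ac)

lemma value_b12:
  assumes "(x, y, z) \<in> \<Delta>"
  shows "opex_value (bbr V (a1 + a2) (vx A1 x * vx A2 y)) (\<lambda>w. \<phi> (w @ [Vertex A3 z, Vertex A4 t])) =
    Some (U1 (x, y, z) + U2 (x, y, z))"
  using value_bbr2[OF A(1,2) _ f, of "[]" x y "[Vertex A3 z, Vertex A4 t]" "a1 + a2" v] good_args4[OF assms t]
  by (simp add: corr_def U1_def U2_def sg_simps)

lemma value_b23:
  assumes "(x, y, z) \<in> \<Delta>"
  shows "opex_value (bbr V (a2 + a3) (vx A2 y * vx A3 z)) (\<lambda>w. \<phi> (Vertex A1 x # w @ [Vertex A4 t])) =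
    Some (sg a1 * (U2 (x, y, z) + U3 (x, y, z)))"
  using value_bbr2[OF A(2,3) _ f, of "[Vertex A1 x]" y z "[Vertex A4 t]" "a2 + a3" v] good_args4[OF assms t]
  by (simp add: corr_def U2_def U3_def sg_simps ring_distribs mult_ac)

lemma value_b123:
  assumes "(x, y, z) \<in> \<Delta>"
    and "X \<in> {vx A1 x * (vx A2 y * vx A3 z), vx A1 x * vx A2 y * vx A3 z}"
    and "sg d = sg a1 * sg a2 * sg a3"
  shows "opex_value (bbr V d X) (\<lambda>w. \<phi> (w @ [Vertex A4 t])) = Some (U1 (x, y, z) + U2 (x, y, z) + U3 (x, y, z))"
  using value_bbr3[OF A(1-3) _ f assms(3,2), of "[]" "[Vertex A4 t]" v] good_args4[OF assms(1) t]
  by (simp add: corr_def U1_def U2_def U3_def)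

text \<open>Every bracket stands to the right of A1, so U2 and U3 appear with the factor
  \<open>sg a1\<close>; the prefactor of this summand of the relation removes it.\<close>

lemma value_rhs1:
  "opex_value (sg a1 \<cdot> op_at (op_pair \<rho> X1 (op_n V \<epsilon>2 \<xi> \<epsilon>1 X2 X3 X4)) t) \<phi> =
    Some (integral {\<epsilon>1..\<epsilon>2 - \<xi>} (\<lambda>s. U3 (edge1 s)) +
      integral {-\<xi>..0} (\<lambda>s. U2 (edge2 s) + U3 (edge2 s)))"
proof -
  let ?\<psi> = "\<lambda>w. \<phi> (Vertex A1 (t + \<rho>) # w)"
  have R: "edge1 s \<in> \<Delta>" if "s \<in> {\<epsilon>1..\<epsilon>2 - \<xi>}" for s
    using that pos gaps by (auto simp: simplex_region_def)
  have R': "edge2 s \<in> \<Delta>" if "s \<in> {-\<xi>..0}" for s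
    using that pos gaps by (auto simp: simplex_region_def)
  have "opex_value (op_at (op_n' V \<epsilon>2 \<xi> \<epsilon>1 X2 X3 X4) t) ?\<psi> =
    Some (integral {\<epsilon>1..\<epsilon>2 - \<xi>} (\<lambda>s. sg a1 * U3 (edge1 s)))"
    unfolding op_n'_def fam.sel
  proof (rule value_OInt)
    fix s assume "s \<in> {\<epsilon>1..\<epsilon>2 - \<xi>}"
    from value_b3[OF R[OF this]]
    show "opex_value (sg (deg X2) \<cdot> (op_at X2 (t + \<epsilon>2) * bbr V (deg X3) (op_at X3 (s + t)) * op_at X4 t)) ?\<psi> =
      Some (sg a1 * U3 (edge1 s))"
      by (simp add: vertex_def value_times mult_ac)
  qed (use R in \<open>auto intro!: integrable_continuous_real continuous_intros continuous_U_path\<close>)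
  moreover have "opex_value (op_at (op_pair \<epsilon>2 (op_m V \<xi> X2 X3) X4) t) ?\<psi> =
    Some (integral {-\<xi>..0} (\<lambda>s. sg a1 * (U2 (edge2 s) + U3 (edge2 s))))"
  proof -
    have "(\<lambda>s. sg a1 * (U2 (edge2 s) + U3 (edge2 s))) integrable_on {-\<xi>..0}"
      by (intro integrable_continuous_real continuous_intros continuous_U_path) (use R' in auto)
    from value_OInt[OF value_b23[OF R'] this] show ?thesis
      by (simp add: op_pair_def op_m_def vertex_def value_times del: opex_value.simps(5))
  qed
  ultimately have "opex_value (op_at (op_n V \<epsilon>2 \<xi> \<epsilon>1 X2 X3 X4) t) ?\<psi> =
    Some (integral {\<epsilon>1..\<epsilon>2 - \<xi>} (\<lambda>s. sg a1 * U3 (edge1 s)) +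
      integral {-\<xi>..0} (\<lambda>s. sg a1 * (U2 (edge2 s) + U3 (edge2 s))))"
    by (rule value_op_n)
  also have "\<dots> = Some (sg a1 * (integral {\<epsilon>1..\<epsilon>2 - \<xi>} (\<lambda>s. U3 (edge1 s)) +
      integral {-\<xi>..0} (\<lambda>s. U2 (edge2 s) + U3 (edge2 s))))"
    unfolding integral_mult_right by (rule arg_cong[where f = Some], rule distrib_left[symmetric])
  finally have "opex_value (op_at (op_n V \<epsilon>2 \<xi> \<epsilon>1 X2 X3 X4) t) ?\<psi> =
    Some (sg a1 * (integral {\<epsilon>1..\<epsilon>2 - \<xi>} (\<lambda>s. U3 (edge1 s)) +
      integral {-\<xi>..0} (\<lambda>s. U2 (edge2 s) + U3 (edge2 s))))" .
  then show ?thesis by (simp add: op_pair_def vertex_def value_times)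
qed

lemma value_rhs2:
  "opex_value (op_at (op_n V \<rho> \<alpha>1 \<epsilon>2 X1 X2 (op_pair \<epsilon>1 X3 X4)) t) \<phi> =
    Some (integral {\<epsilon>2..\<rho> - \<alpha>1} (\<lambda>s. U2 (edge3 s)) +
      integral {-\<alpha>1..0} (\<lambda>s. U1 (edge4 s) + U2 (edge4 s)))"
proof (rule value_op_n, goal_cases)
  case 1
  have R: "edge3 s \<in> \<Delta>" if "s \<in> {\<epsilon>2..\<rho> - \<alpha>1}" for s
    using that pos gaps by (auto simp: simplex_region_def)
  show ?case
    unfolding op_n'_def fam.sel
  proof (rule value_OInt, goal_cases)
    case (1 s)
    from value_b2[OF R[OF this]] show ?case
      by (simp add: vertex_def op_pair_def value_times)
  qed (use R in \<open>auto intro!: integrable_continuous_real continuous_intros continuous_U_path\<close>)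
next
  case 2
  have R': "edge4 s \<in> \<Delta>" if "s \<in> {-\<alpha>1..0}" for s
    using that pos gaps by (auto simp: simplex_region_def)
  have "(\<lambda>s. U1 (edge4 s) + U2 (edge4 s)) integrable_on {-\<alpha>1..0}"
    by (intro integrable_continuous_real continuous_intros continuous_U_path) (use R' in auto)
  from value_OInt[OF value_b12[OF R'] this] show ?case
    by (simp add: op_pair_def op_m_def vertex_def value_times del: opex_value.simps(5))
qed

lemma value_rhs3:
  "opex_value (op_at (op_n V \<rho> \<alpha>2 \<epsilon>2 X1 (op_pair \<xi> X2 X3) X4) t) \<phi> =
    Some (integral {\<epsilon>2..\<rho> - \<alpha>2} (\<lambda>s. U2 (edge5 s) + U3 (edge5 s)) +
      integral {-\<alpha>2..0} (\<lambda>s. U1 (edge6 s) + U2 (edge6 s) + U3 (edge6 s)))"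
proof (rule value_op_n, goal_cases)
  case 1
  have R: "edge5 s \<in> \<Delta>" if "s \<in> {\<epsilon>2..\<rho> - \<alpha>2}" for s
    using that pos gaps by (auto simp: simplex_region_def)
  show ?case
    unfolding op_n'_def fam.sel
  proof (rule value_OInt, goal_cases)
    case (1 s)
    from value_b23[OF R[OF this]] show ?case
      unfolding op_pair_def vertex_def fam.sel value_times[of _ "Letter _"] value_times[of _ "bbr _ _ _"] opex_value.simps
      by simp
  qed (use R in \<open>auto intro!: integrable_continuous_real continuous_intros continuous_U_path\<close>)
next
  case 2
  have R': "edge6 s \<in> \<Delta>" if "s \<in> {-\<alpha>2..0}" for s
    using that pos gaps by (auto simp: simplex_region_def)
  have "(\<lambda>s. U1 (edge6 s) + U2 (edge6 s) + U3 (edge6 s)) integrable_on {-\<alpha>2..0}"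
    by (intro integrable_continuous_real continuous_intros continuous_U_path) (use R' in auto)
  from value_OInt[OF value_b123[OF R' insertI1, of _ "a1 + (a2 + a3)"] this] show ?case
    by (simp add: op_pair_def op_m_def vertex_def value_times[of "OInt _ _"] sg_simps del: opex_value.simps(5))
qed

lemma value_rhs4:
  "opex_value (op_at (op_n V \<rho> \<alpha>2 \<epsilon>1 (op_pair \<alpha>1 X1 X2) X3 X4) t) \<phi> =
    Some (integral {\<epsilon>1..\<rho> - \<alpha>2} (\<lambda>s. U3 (edge7 s)) +
      integral {-\<alpha>2..0} (\<lambda>s. U1 (edge8 s) + U2 (edge8 s) + U3 (edge8 s)))"
proof (rule value_op_n, goal_cases)
  case 1
  have R: "edge7 s \<in> \<Delta>" if "s \<in> {\<epsilon>1..\<rho> - \<alpha>2}" for s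
    using that pos gaps by (auto simp: simplex_region_def)
  show ?case
    unfolding op_n'_def fam.sel
  proof (rule value_OInt, goal_cases)
    case (1 s)
    from value_b3[OF R[OF this]] show ?case
      by (simp add: vertex_def op_pair_def value_times sg_simps mult_ac)
  qed (use R in \<open>auto intro!: integrable_continuous_real continuous_intros continuous_U_path\<close>)
next
  case 2
  have R': "edge8 s \<in> \<Delta>" if "s \<in> {-\<alpha>2..0}" for s
    using that pos gaps by (auto simp: simplex_region_def)
  have "(\<lambda>s. U1 (edge8 s) + U2 (edge8 s) + U3 (edge8 s)) integrable_on {-\<alpha>2..0}"
    by (intro integrable_continuous_real continuous_intros continuous_U_path) (use R' in auto)
  from value_OInt[OF value_b123[OF R' insertI2[OF insertI1], of _ "a1 + a2 + a3"] this] show ?case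
    by (simp add: op_pair_def op_m_def vertex_def value_times[of "OInt _ _"] sg_simps del: opex_value.simps(5))
qed

lemma value_rhs5:
  "opex_value (op_at (op_pair \<rho> (op_n V \<alpha>2 \<alpha>1 \<xi> X1 X2 X3) X4) t) \<phi> =
    Some (integral {\<xi>..\<alpha>2 - \<alpha>1} (\<lambda>s. U2 (edge9 s)) +
      integral {-\<alpha>1..0} (\<lambda>s. U1 (edge10 s) + U2 (edge10 s)))"
proof -
  let ?\<psi> = "\<lambda>w. \<phi> (w @ [Vertex A4 t])"
  have R: "edge9 s \<in> \<Delta>" if "s \<in> {\<xi>..\<alpha>2 - \<alpha>1}" for s
    using that pos gaps by (auto simp: simplex_region_def)
  have R': "edge10 s \<in> \<Delta>" if "s \<in> {-\<alpha>1..0}" for s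
    using that pos gaps by (auto simp: simplex_region_def)
  have 1: "opex_value (op_at (op_n' V \<alpha>2 \<alpha>1 \<xi> X1 X2 X3) (t + \<rho>)) ?\<psi> =
    Some (integral {\<xi>..\<alpha>2 - \<alpha>1} (\<lambda>s. U2 (edge9 s)))"
    unfolding op_n'_def fam.sel
  proof (rule value_OInt)
    fix s assume "s \<in> {\<xi>..\<alpha>2 - \<alpha>1}"
    from value_b2[OF R[OF this]]
    show "opex_value (sg (deg X1) \<cdot> (op_at X1 (t + \<rho> + \<alpha>2) * bbr V (deg X2) (op_at X2 (s + (t + \<rho>))) *
        op_at X3 (t + \<rho>))) ?\<psi> = Some (U2 (edge9 s))"
      by (simp add: vertex_def value_times)
  qed (use R in \<open>auto intro!: integrable_continuous_real continuous_intros continuous_U_path\<close>)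
  have "(\<lambda>s. U1 (edge10 s) + U2 (edge10 s)) integrable_on {-\<alpha>1..0}"
    by (intro integrable_continuous_real continuous_intros continuous_U_path) (use R' in auto)
  from value_OInt[OF value_b12[OF R'] this]
  have 2: "opex_value (op_at (op_pair \<alpha>2 (op_m V \<alpha>1 X1 X2) X3) (t + \<rho>)) ?\<psi> =
    Some (integral {-\<alpha>1..0} (\<lambda>s. U1 (edge10 s) + U2 (edge10 s)))"
    by (simp add: op_pair_def op_m_def vertex_def value_times del: opex_value.simps(5))
  from value_op_n[OF 1 2] show ?thesis
    by (subst op_pair_def) (simp add: vertex_def value_times)
qed

lemma value_rhs:
  "opex_value (sg a1 \<cdot> op_at (op_pair \<rho> X1 (op_n V \<epsilon>2 \<xi> \<epsilon>1 X2 X3 X4)) t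
      - op_at (op_n V \<rho> \<alpha>1 \<epsilon>2 X1 X2 (op_pair \<epsilon>1 X3 X4)) t
      + op_at (op_n V \<rho> \<alpha>2 \<epsilon>2 X1 (op_pair \<xi> X2 X3) X4) t
      - op_at (op_n V \<rho> \<alpha>2 \<epsilon>1 (op_pair \<alpha>1 X1 X2) X3 X4) t
      + op_at (op_pair \<rho> (op_n V \<alpha>2 \<alpha>1 \<xi> X1 X2 X3) X4) t) \<phi> =
    Some (edge_sum U1 U2 U3)"
  unfolding edge_sum_def Let_def
  by (intro value_plus value_diff value_rhs1 value_rhs2 value_rhs3 value_rhs4 value_rhs5)

definition D1 where "D1 i = (if i = 1 then corr f v (Lmode V (-1) (b A1)) A2 A3 A4 t
  else if i = 2 then corr f v (b A1) (Lmode V (-1) A2) A3 A4 t else corr f v (b A1) A2 (Lmode V (-1) A3) A4 t)" for i :: nat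
definition D2 where "D2 i p = sg a1 * (if i = 1 then corr f v (Lmode V (-1) A1) (b A2) A3 A4 t
  else if i = 2 then corr f v A1 (Lmode V (-1) (b A2)) A3 A4 t else corr f v A1 (b A2) (Lmode V (-1) A3) A4 t) p" for i :: nat
definition D3 where "D3 i p = sg a1 * sg a2 * (if i = 1 then corr f v (Lmode V (-1) A1) A2 (b A3) A4 t
  else if i = 2 then corr f v A1 (Lmode V (-1) A2) (b A3) A4 t else corr f v A1 A2 (Lmode V (-1) (b A3)) A4 t) p" for i :: nat

sublocale stokes: pentagon_stokes t \<rho> \<epsilon>1 \<epsilon>2 \<alpha>1 \<alpha>2 \<xi> U1 U2 U3 D1 D2 D3
proof unfold_locales
  show "C1_on \<Delta> U1 D1"
    using C1_on_corr[OF f t, of v "b A1" A2 A3 A4] unfolding U1_def[abs_def] D1_def[abs_def] .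
  show "C1_on \<Delta> U2 D2"
    using C1_on_scale[OF C1_on_corr[OF f t, of v A1 "b A2" A3 A4]] unfolding U2_def[abs_def] D2_def[abs_def] .
  show "C1_on \<Delta> U3 D3"
    using C1_on_scale[OF C1_on_corr[OF f t, of v A1 A2 "b A3" A4]] unfolding U3_def[abs_def] D3_def[abs_def] .
qed

text \<open>The letter Q is eliminated: on the left it turns f into f composed with Q, on the right
  it turns v into Q v. The values of p are then needed for these other choices of functional and
  vector.\<close>

lemma value_Qbr:
  assumes "opex_value X (word_mel V (\<lambda>u. f (Qop V u)) v) = Some c" "opex_value X (word_mel V f (Qop V v)) = Some d"
  shows "opex_value (Qbr V n X) \<phi> = Some (c + (- sg n) * d)"
proof -
  have "(\<lambda>w. \<phi> (Mode (elJ V) 0 # w)) = word_mel V (\<lambda>u. f (Qop V u)) v"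
    unfolding Qop_def word_mel_eq[OF f] word_mel_eq[OF restricted_dual_md[OF f]] by (auto simp: mel_Mode fun_eq_iff)
  moreover have "(\<lambda>w. \<phi> (w @ [Mode (elJ V) 0])) = word_mel V f (Qop V v)"
    unfolding Qop_def word_mel_eq[OF f] using mel_Mode_last[OF _ f] by auto
  ultimately show ?thesis
    using assms by (simp add: Qbr_def minus_opex_def times_opex_def)
qed

text \<open>The axiom [Q, b(z)] = L(z) for the mode -1: this turns Q-variations into
  derivatives.\<close>

lemma translation_eq: "Lmode V (-1) B = Qop V (b B) + b (Qop V B)"
  using Q_b[of "-1" B] by (simp add: bmode_def)

text \<open>All summands on the left are the same \<open>pentagon_sum\<close> with different
  insertions, so by linearity it suffices to compare the three components of the two-form
  pointwise.\<close>

lemma pentagon_relation: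
  shows "opex_value (op_at (Qfam V (P X1 X2 X3 X4)) t
      - op_at (P (vertex (a1 + 1) (Qop V A1)) X2 X3 X4) t
      - sg a1 \<cdot> op_at (P X1 (vertex (a2 + 1) (Qop V A2)) X3 X4) t
      - sg (a1 + a2) \<cdot> op_at (P X1 X2 (vertex (a3 + 1) (Qop V A3)) X4) t
      - sg (a1 + a2 + a3) \<cdot> op_at (P X1 X2 X3 (vertex (a4 + 1) (Qop V A4))) t) \<phi> =
    Some (edge_sum U1 U2 U3)" (is "?lhs = _")
proof -
  let ?fQ = "\<lambda>u. f (Qop V u)"
  have fQ: "?fQ \<in> restricted_dual V" unfolding Qop_def by (rule restricted_dual_md[OF f])
  define k12 where "k12 f v b1 B1 b2 B2 b3 B3 b4 B4 p = sg b1 * corr f v (b B1) (b B2) B3 B4 t p"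
    for f v and b1 b2 b3 b4 :: int and B1 B2 B3 B4 p
  define k13 where "k13 f v b1 B1 b2 B2 b3 B3 b4 B4 p = sg (b1 + b2 - 1) * corr f v (b B1) B2 (b B3) B4 t p"
    for f v and b1 b2 b3 b4 :: int and B1 B2 B3 B4 p
  define k23 where "k23 f v b1 B1 b2 B2 b3 B3 b4 B4 p = sg b2 * corr f v B1 (b B2) (b B3) B4 t p"
    for f v and b1 b2 b3 b4 :: int and B1 B2 B3 B4 p
  note k_defs = k12_def k13_def k23_def
  have cont: "continuous_on \<Delta> (k12 f v b1 B1 b2 B2 b3 B3 b4 B4)"
    "continuous_on \<Delta> (k13 f v b1 B1 b2 B2 b3 B3 b4 B4)"
    "continuous_on \<Delta> (k23 f v b1 B1 b2 B2 b3 B3 b4 B4)"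
    if "f \<in> restricted_dual V" for f v and b1 b2 b3 b4 :: int and B1 B2 B3 B4
    unfolding k12_def[abs_def] k13_def[abs_def] k23_def[abs_def]
    by (intro continuous_intros continuous_corr that)+
  note conts = cont[OF f] cont[OF fQ]
  \<comment> \<open>The value of p is taken from the locale at other parameters, since Q changes the
    functional, the vector, an insertion and its degree.\<close>
  have val: "opex_value (op_at (P (vertex b1 B1) (vertex b2 B2) (vertex b3 B3) (vertex b4 B4)) t) (word_mel V g u) =
    Some (pentagon_sum (k12 g u b1 B1 b2 B2 b3 B3 b4 B4) (k13 g u b1 B1 b2 B2 b3 B3 b4 B4) (k23 g u b1 B1 b2 B2 b3 B3 b4 B4))"
    if "B1 \<in> fermionic_space V b1" "B2 \<in> fermionic_space V b2" "B3 \<in> fermionic_space V b3" "B4 \<in> fermionic_space V b4"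
      "g \<in> restricted_dual V"
    for g u and b1 b2 b3 b4 :: int and B1 B2 B3 B4
    unfolding k12_def[abs_def] k13_def[abs_def] k23_def[abs_def] 
    by (intro pentagon_vertices.value_op_p pentagon_vertices.intro pentagon_vertices_axioms.intro pentagon_voa_axioms that)
  \<comment> \<open>The sign of the term with Q on the right of p, which has degree a1 + a2 + a3 +
    a4 - 2.\<close>
  define c where "c = - sg (a1 + a2 + a3 + a4 - 2)"
  define K where "K k q = k ?fQ v a1 A1 a2 A2 a3 A3 a4 A4 q + c * k f (Qop V v) a1 A1 a2 A2 a3 A3 a4 A4 q
      + (- 1) * k f v (a1 + 1) (Qop V A1) a2 A2 a3 A3 a4 A4 q + (- sg a1) * k f v a1 A1 (a2 + 1) (Qop V A2) a3 A3 a4 A4 q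
      + (- sg (a1 + a2)) * k f v a1 A1 a2 A2 (a3 + 1) (Qop V A3) a4 A4 q
      + (- sg (a1 + a2 + a3)) * k f v a1 A1 a2 A2 a3 A3 (a4 + 1) (Qop V A4) q"
    for k :: "('v \<Rightarrow> complex) \<Rightarrow> 'v \<Rightarrow> int \<Rightarrow> 'v \<Rightarrow> int \<Rightarrow> 'v \<Rightarrow> int \<Rightarrow> 'v \<Rightarrow> int \<Rightarrow> 'v \<Rightarrow> real3 \<Rightarrow> complex" and q
  let ?S = "\<lambda>g u b1 B1 b2 B2 b3 B3 b4 B4. pentagon_sum (k12 g u b1 B1 b2 B2 b3 B3 b4 B4) (k13 g u b1 B1 b2 B2 b3 B3 b4 B4) (k23 g u b1 B1 b2 B2 b3 B3 b4 B4)"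
  have "opex_value (op_at (Qfam V (P X1 X2 X3 X4)) t) \<phi> =
    Some (?S ?fQ v a1 A1 a2 A2 a3 A3 a4 A4 + c * ?S f (Qop V v) a1 A1 a2 A2 a3 A3 a4 A4)"
  proof -
    have "deg (P X1 X2 X3 X4) = a1 + a2 + a3 + a4 - 2"
      by (simp add: op_p_def vertex_def)
    then show ?thesis
      unfolding Qfam_def fam.sel c_def by (simp only:) (intro value_Qbr val A f fQ)
  qed
  then have "?lhs =
    Some (?S ?fQ v a1 A1 a2 A2 a3 A3 a4 A4 + c * ?S f (Qop V v) a1 A1 a2 A2 a3 A3 a4 A4
      - ?S f v (a1 + 1) (Qop V A1) a2 A2 a3 A3 a4 A4 - sg a1 * ?S f v a1 A1 (a2 + 1) (Qop V A2) a3 A3 a4 A4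
      - sg (a1 + a2) * ?S f v a1 A1 a2 A2 (a3 + 1) (Qop V A3) a4 A4
      - sg (a1 + a2 + a3) * ?S f v a1 A1 a2 A2 a3 A3 (a4 + 1) (Qop V A4))" (is "_ = Some ?sum")
    by (intro value_diff value_scale val A Q_mem f)
  also have "?sum = pentagon_sum (K k12) (K k13) (K k23)"
    unfolding K_def[abs_def]
    by (subst pentagon_sum_lincomb, (intro continuous_intros conts)+)+ simp
  also have "\<dots> = pentagon_sum (\<lambda>p. D2 1 p - D1 2 p) (\<lambda>p. D1 3 p - D3 1 p) (\<lambda>p. D3 2 p - D2 3 p)"
  \<comment> \<open>In each component the Ward identity for Q cancels the term at Q v and all slots
    without b; a slot with b combines with its Q A_i term to L_{-1} A_i, a partial derivative of
    some U.\<close>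
  proof (rule pentagon_sum_cong)
    fix q assume q: "q \<in> \<Delta>"
    note br = corr_bracket[OF odd_J _ _ _ _ q t f, folded Qop_def]
    note add = corr_vertex_add[OF q t f]
    note mem = A[THEN b_mem] A
    show "K k12 q = D2 1 q - D1 2 q"
      by (simp add: K_def k_defs c_def D1_def D2_def D3_def br[OF mem(1,2) A(3,4)] translation_eq add sg_simps ring_distribs mult_ac)
    show "K k13 q = D1 3 q - D3 1 q"
      by (simp add: K_def k_defs c_def D1_def D2_def D3_def br[OF mem(1) A(2) mem(3) A(4)] translation_eq add sg_simps ring_distribs mult_ac)
    show "K k23 q = D3 2 q - D2 3 q"
      by (simp add: K_def k_defs c_def D1_def D2_def D3_def br[OF A(1) mem(2,3) A(4)] translation_eq add sg_simps ring_distribs mult_ac)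
  qed
  also have "\<dots> = edge_sum U1 U2 U3" by (rule stokes.pentagon_sum_curl)
  finally show ?thesis .
qed

end

theorem proposition3p3:
  fixes V :: "'v :: ab_group_add tvoa"
    and A1 A2 A3 A4 :: 'v
    and a1 a2 a3 a4 :: int
    and t \<rho> \<epsilon>1 \<epsilon>2 \<alpha>1 \<alpha>2 \<xi> :: real
  assumes "topological_voa V"
    and "A1 \<in> fermionic_space V a1" "A2 \<in> fermionic_space V a2"
    and "A3 \<in> fermionic_space V a3" "A4 \<in> fermionic_space V a4"
    and "t > 0"
    and "\<rho> > 0" "\<epsilon>1 > 0" "\<epsilon>2 > 0" "\<alpha>1 > 0" "\<alpha>2 > 0" "\<xi> > 0"
    and "\<epsilon>2 + \<alpha>2 < \<rho>" "\<epsilon>1 + \<xi> < \<epsilon>2" "\<alpha>1 + \<xi> < \<alpha>2"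
  shows "let X1 = vertex a1 A1; X2 = vertex a2 A2; X3 = vertex a3 A3; X4 = vertex a4 A4;
      p = op_p V \<rho> \<xi> \<alpha>1 \<alpha>2 \<epsilon>1 \<epsilon>2
    in weakly_equal V
    (op_at (Qfam V (p X1 X2 X3 X4)) t
      - op_at (p (Qvertex V a1 A1) X2 X3 X4) t
      - sg a1 \<cdot> op_at (p X1 (Qvertex V a2 A2) X3 X4) t
      - sg (a1 + a2) \<cdot> op_at (p X1 X2 (Qvertex V a3 A3) X4) t
      - sg (a1 + a2 + a3) \<cdot> op_at (p X1 X2 X3 (Qvertex V a4 A4)) t)
    (sg a1 \<cdot> op_at (op_pair \<rho> X1 (op_n V \<epsilon>2 \<xi> \<epsilon>1 X2 X3 X4)) t
      - op_at (op_n V \<rho> \<alpha>1 \<epsilon>2 X1 X2 (op_pair \<epsilon>1 X3 X4)) t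
      + op_at (op_n V \<rho> \<alpha>2 \<epsilon>2 X1 (op_pair \<xi> X2 X3) X4) t
      - op_at (op_n V \<rho> \<alpha>2 \<epsilon>1 (op_pair \<alpha>1 X1 X2) X3 X4) t
      + op_at (op_pair \<rho> (op_n V \<alpha>2 \<alpha>1 \<xi> X1 X2 X3) X4) t)"
proof -
  have "pentagon_vertices V t \<rho> \<epsilon>1 \<epsilon>2 \<alpha>1 \<alpha>2 \<xi> A1 A2 A3 A4 a1 a2 a3 a4 f" if "f \<in> restricted_dual V" for f
    using assms that
    by (simp add: pentagon_vertices_def pentagon_vertices_axioms_def pentagon_voa_def pentagon_voa_axioms_def pentagon_region_def)
  \<comment> \<open>Both sides evaluate to the same edge sum for every f and v, which contains the
    claim that both are weakly defined.\<close>
  from pentagon_vertices.pentagon_relation[OF this] pentagon_vertices.value_rhs[OF this]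
  show ?thesis
    unfolding Let_def weakly_equal_def matrix_element_def Qvertex_def by blast
qed

end
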